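(* Let $P$ be a convex $d$-polytope in $\mathbb R^d$, let $(\mathcal S^{d-1},\psi)$ be a lifted cubical boundary subdivision of $P$, and let $H$ be a hyperplane in $\mathbb R^d$ such that $P$ and $(\mathcal S^{d-1},\psi)$ are symmetric with respect to $H$ and $\mathcal S^{d-1}\cap H$ is a subcomplex of $\mathcal S^{d-1}$. Then there is a lifted cubification $(\mathcal B^d,\phi)$ of $(\mathcal S^{d-1},\psi)$.
   Context: A lifted boundary subdivision of a $d$-polytope $P$ is a pair $(\mathcal S,\psi)$ of a polytopal subdivision $\mathcal S$ of the boundary of $P$ and a piecewise linear function $\psi:\partial P\to\mathbb R$ such that for each facet $F$ of $P$ the restriction of $\psi$ to $F$ is a concave function whose domains of linearity are exactly the cells of $\mathcal S\cap F$; it is cubical if all cells of $\mathcal S$ are combinatorial cubes. Symmetry with respect to $H$ means the reflection $\sigma$ in $H$ maps $P$ and $\mathcal S$ onto themselves and $\psi\circ\sigma=\psi$. A lifted cubification of $(\mathcal S,\psi)$ is a pair $(\mathcal B,\phi)$ where $\mathcal B$ is a polytopal subdivision of $P$ into combinatorial $d$-cubes (a cubical $d$-ball) whose boundary complex is $\mathcal S$, and $\phi:P\to\mathbb R$ is a concave function whose domains of linearity are exactly the facets of $\mathcal B$ and whose restriction to $\partial P$ equals $\psi$. *)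

theory Defs
  imports "HOL-Analysis.Analysis"
begin

section \<open>Polytopal complexes and subdivisions\<close>

text \<open>The empty set counts as a polytope and as a face of every polytope, so every nonempty
  complex contains the empty cell.\<close>

definition polytopal_complex :: "'a::euclidean_space set set \<Rightarrow> bool" where
  "polytopal_complex K \<longleftrightarrow>
     finite K \<and>
     (\<forall>C\<in>K. polytope C) \<and>
     (\<forall>C\<in>K. \<forall>F. F face_of C \<longrightarrow> F \<in> K) \<and>
     (\<forall>C\<in>K. \<forall>D\<in>K. (C \<inter> D) face_of C \<and> (C \<inter> D) face_of D)"

definition subcomplex :: "'a::euclidean_space set set \<Rightarrow> 'a set set \<Rightarrow> bool" where
  "subcomplex L K \<longleftrightarrow> L \<subseteq> K \<and> polytopal_complex L"

definition complex_facets :: "'a set set \<Rightarrow> 'a set set" where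
  "complex_facets K = {C \<in> K. \<forall>D\<in>K. C \<subseteq> D \<longrightarrow> D = C}"

text \<open>\<open>restrict_complex K X\<close> is the set of the cells of \<open>K\<close> that lie in \<open>X\<close>; this is the
  meaning of \<open>K \<inter> F\<close> for a facet \<open>F\<close> of a polytope whose boundary is subdivided by \<open>K\<close>.\<close>

definition restrict_complex :: "'a set set \<Rightarrow> 'a set \<Rightarrow> 'a set set" where
  "restrict_complex K X = {C \<in> K. C \<subseteq> X}"

definition subdivision_of :: "'a::euclidean_space set set \<Rightarrow> 'a set set \<Rightarrow> bool" where
  "subdivision_of K L \<longleftrightarrow>
     polytopal_complex K \<and> \<Union>K = \<Union>L \<and> (\<forall>C\<in>K. \<exists>D\<in>L. C \<subseteq> D)"

definition polytopal_subdivision :: "'a::euclidean_space set set \<Rightarrow> 'a set \<Rightarrow> bool" where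
  "polytopal_subdivision K P \<longleftrightarrow> subdivision_of K {F. F face_of P}"

definition boundary_subdivision :: "'a::euclidean_space set set \<Rightarrow> 'a set \<Rightarrow> bool" where
  "boundary_subdivision K P \<longleftrightarrow> subdivision_of K {F. F face_of P \<and> F \<noteq> P}"

text \<open>The boundary complex of a full-dimensional ball in the ambient space: the subcomplex of the
  cells contained in the topological boundary of the underlying set.\<close>

definition boundary_complex :: "'a::euclidean_space set set \<Rightarrow> 'a set set" where
  "boundary_complex K = restrict_complex K (frontier (\<Union>K))"


section \<open>Combinatorial cubes\<close>

definition combinatorially_equivalent ::
    "'a::euclidean_space set \<Rightarrow> 'b::euclidean_space set \<Rightarrow> bool" where
  "combinatorially_equivalent P Q \<longleftrightarrow>
     (\<exists>f. bij_betw f {F. F face_of P} {G. G face_of Q} \<and>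
          (\<forall>F F'. F face_of P \<longrightarrow> F' face_of P \<longrightarrow> (F \<subseteq> F' \<longleftrightarrow> f F \<subseteq> f F')))"

text \<open>For a set \<open>B\<close> of \<open>k\<close> standard basis vectors, \<open>cbox 0 (\<Sum>B)\<close> is the standard cube
  \<open>[0,1]\<^sup>k\<close> in the coordinate subspace spanned by \<open>B\<close>.\<close>

definition combinatorial_cube :: "nat \<Rightarrow> 'a::euclidean_space set \<Rightarrow> bool" where
  "combinatorial_cube k C \<longleftrightarrow>
     polytope C \<and>
     (\<exists>B. B \<subseteq> (Basis :: 'a set) \<and> card B = k \<and> combinatorially_equivalent C (cbox 0 (\<Sum>B)))"

definition cubical_complex :: "'a::euclidean_space set set \<Rightarrow> bool" where
  "cubical_complex K \<longleftrightarrow>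
     polytopal_complex K \<and> (\<forall>C\<in>K. C \<noteq> {} \<longrightarrow> (\<exists>k. combinatorial_cube k C))"


section \<open>Piecewise linear functions and domains of linearity\<close>

definition affine_fun_on :: "'a::euclidean_space set \<Rightarrow> ('a \<Rightarrow> real) \<Rightarrow> bool" where
  "affine_fun_on D f \<longleftrightarrow> (\<exists>a c. \<forall>x\<in>D. f x = a \<bullet> x + c)"

text \<open>Continuity need not be required: it follows from the gluing over finitely many closed
  cells.\<close>

definition piecewise_linear_on :: "'a::euclidean_space set \<Rightarrow> ('a \<Rightarrow> real) \<Rightarrow> bool" where
  "piecewise_linear_on X f \<longleftrightarrow>
     (\<exists>K. polytopal_complex K \<and> \<Union>K = X \<and> (\<forall>C\<in>K. affine_fun_on C f))"

text \<open>The domains of linearity of \<open>f\<close> on \<open>X\<close> are the inclusion-maximal convex subsets of \<open>X\<close>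
  on which \<open>f\<close> is affine. (Without convexity, maximality would be meaningless: an affine function
  can always be made to agree with \<open>f\<close> at affinely independent points.)\<close>

definition domains_of_linearity ::
    "'a::euclidean_space set \<Rightarrow> ('a \<Rightarrow> real) \<Rightarrow> 'a set set" where
  "domains_of_linearity X f =
     {D. D \<subseteq> X \<and> convex D \<and> affine_fun_on D f \<and>
         (\<forall>D'. D \<subseteq> D' \<longrightarrow> D' \<subseteq> X \<longrightarrow> convex D' \<longrightarrow> affine_fun_on D' f \<longrightarrow> D' = D)}"


section \<open>Lifted boundary subdivisions and lifted cubifications\<close>

text \<open>Functions on the boundary of \<open>P\<close> or on \<open>P\<close> are represented by total functions; only their
  values on the respective set matter.

  The domains of linearity of a concave function on a facet \<open>F\<close> are full-dimensional in \<open>F\<close>, so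
  they are matched with the maximal cells of the induced subdivision of \<open>F\<close>.\<close>

definition lifted_boundary_subdivision ::
    "'a::euclidean_space set \<Rightarrow> 'a set set \<Rightarrow> ('a \<Rightarrow> real) \<Rightarrow> bool" where
  "lifted_boundary_subdivision P S \<psi> \<longleftrightarrow>
     boundary_subdivision S P \<and>
     piecewise_linear_on (frontier P) \<psi> \<and>
     (\<forall>F. F facet_of P \<longrightarrow>
        concave_on F \<psi> \<and>
        domains_of_linearity F \<psi> = complex_facets (restrict_complex S F))"

definition lifted_cubical_boundary_subdivision ::
    "'a::euclidean_space set \<Rightarrow> 'a set set \<Rightarrow> ('a \<Rightarrow> real) \<Rightarrow> bool" where
  "lifted_cubical_boundary_subdivision P S \<psi> \<longleftrightarrow>
     lifted_boundary_subdivision P S \<psi> \<and> cubical_complex S"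

definition lifted_cubification ::
    "'a::euclidean_space set \<Rightarrow> 'a set set \<Rightarrow> ('a \<Rightarrow> real) \<Rightarrow> 'a set set \<Rightarrow> ('a \<Rightarrow> real) \<Rightarrow> bool"
where
  "lifted_cubification P S \<psi> B \<phi> \<longleftrightarrow>
     polytopal_subdivision B P \<and>
     cubical_complex B \<and>
     (\<forall>C \<in> complex_facets B. combinatorial_cube DIM('a) C) \<and>
     boundary_complex B = S \<and>
     concave_on P \<phi> \<and>
     domains_of_linearity P \<phi> = complex_facets B \<and>
     (\<forall>x \<in> frontier P. \<phi> x = \<psi> x)"


section \<open>Reflections\<close>

text \<open>The orthogonal reflection in the hyperplane \<open>{x. a \<bullet> x = b}\<close>, where \<open>a \<noteq> 0\<close>.\<close>

definition hyperplane_reflection :: "'a::euclidean_space \<Rightarrow> real \<Rightarrow> 'a \<Rightarrow> 'a" where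
  "hyperplane_reflection a b x = x - (2 * (a \<bullet> x - b) / (a \<bullet> a)) *\<^sub>R a"

end

theory Submission
  imports Defs
begin

text \<open>
  Let \<open>\<sigma>\<close> be the reflection in \<open>H\<close>, let \<open>p\<close> be an interior point of \<open>P\<close> on \<open>H\<close>, and let \<open>q\<close> and
  \<open>q' = \<sigma> q\<close> be interior points slightly above and below \<open>p\<close>. Put \<open>\<eta> = z - \<psi>\<close> for a large
  constant \<open>z\<close> and let \<open>\<phi> = z - M\<close>, where \<open>M\<close> is the maximum of the following affine functions.
  For every \<open>(d-1)\<close>-cell \<open>F\<close> above \<open>H\<close> take the function \<open>g\<^sub>F\<close> that equals \<open>\<eta>\<close> on \<open>F\<close> and vanishes
  at \<open>q\<close>, and the function \<open>f\<^sub>F\<close> that vanishes at \<open>q'\<close> and coincides with \<open>g\<^sub>F\<close> where \<open>g\<^sub>F = 1\<close>;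
  add the mirror images of both. For every \<open>(d-2)\<close>-cell \<open>G\<close> in \<open>H\<close> take the function \<open>m\<^sub>G\<close> that
  equals \<open>\<eta>\<close> on \<open>G\<close> and vanishes on the line through \<open>q\<close> and \<open>q'\<close>. The region where \<open>g\<^sub>F\<close> is
  maximal is the pyramid over \<open>F\<close> with apex \<open>q\<close>, truncated at \<open>g\<^sub>F = 1\<close>; the region of \<open>f\<^sub>F\<close> is
  the pyramid over this truncation facet with apex \<open>q'\<close>, truncated by \<open>H\<close>; and the region of
  \<open>m\<^sub>G\<close>, a product of \<open>G\<close> with a quadrilateral, arises from \<open>G\<close> by two such truncations with
  apexes \<open>q'\<close> and \<open>q\<close>. A truncated pyramid over a cube is a projective image of a prism, so all
  regions are cubes, and only the base facets \<open>F\<close> and \<open>\<sigma> F\<close> lie in the boundary of \<open>P\<close>.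
\<close>

subsection \<open>Affine maps\<close>

text \<open>A pyramid over a cube is in general no cube, so its apex \<open>q\<close> has to be cut
  off; this leaves a cavity around \<open>p\<close> that must be filled by cubes without creating
  new boundary. Symmetry supplies the filling: the slope of \<open>g F\<close> in direction
  \<open>a\<close> is positive (\<open>e_pos\<close>), so \<open>f F\<close> is at least its mirror
  image exactly on and above H, and the filling cells over F and its mirror image meet in H. The
  function \<open>f F\<close> is a weighted mean of \<open>g F\<close> and the constant 1, hence
  \<open>f F \<le> g F\<close> exactly where \<open>g F \<ge> 1\<close>. The level 1 is common to
  all F, so a bound \<open>g F' \<le> g F\<close> at a point with \<open>g F \<ge> 1\<close> also
  bounds \<open>f F'\<close>; and \<open>z - \<psi> > 1\<close> keeps the level away from the
  boundary of P. Two apexes are forced: for \<open>q = q'\<close> the functions \<open>f F\<close>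
  and \<open>g F\<close> would coincide. The constant z multiplies supporting functions that are 1
  on a facet hyperplane, or on a facet of the section of P by H, and smaller elsewhere on P. A large
  z therefore bends the lifted boundary at the ridges so strongly that every \<open>g F\<close> and
  \<open>m G\<close> stays below it.\<close>

definition affine_map :: "('a::real_vector \<Rightarrow> 'b::real_vector) \<Rightarrow> bool" where
  "affine_map f \<longleftrightarrow> (\<forall>x y u. f ((1 - u) *\<^sub>R x + u *\<^sub>R y) = (1 - u) *\<^sub>R f x + u *\<^sub>R f y)"

lemma affine_mapD:
  "affine_map f \<Longrightarrow> f ((1 - u) *\<^sub>R x + u *\<^sub>R y) = (1 - u) *\<^sub>R f x + u *\<^sub>R f y"
  by (simp add: affine_map_def)

lemma affine_mapD_real:
  fixes f :: "'a::real_vector \<Rightarrow> real"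
  shows "affine_map f \<Longrightarrow> f ((1 - u) *\<^sub>R x + u *\<^sub>R y) = (1 - u) * f x + u * f y"
  by (simp add: affine_map_def)

lemma affine_map_ray:
  fixes f :: "'a::real_vector \<Rightarrow> real"
  assumes "affine_map f"
  shows "f (x + u *\<^sub>R (y - x)) = (1 - u) * f x + u * f y"
proof -
  have "x + u *\<^sub>R (y - x) = (1 - u) *\<^sub>R x + u *\<^sub>R y"
    by (simp add: algebra_simps)
  then show ?thesis
    using affine_mapD_real[OF assms] by metis
qed

lemma affine_map_const: "affine_map (\<lambda>x. c)"
  by (simp add: affine_map_def flip: scaleR_add_left)

lemma affine_map_id: "affine_map (\<lambda>x. x)"
  by (simp add: affine_map_def)

lemma affine_map_add: "affine_map f \<Longrightarrow> affine_map g \<Longrightarrow> affine_map (\<lambda>x. f x + g x)"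
  by (simp add: affine_map_def scaleR_add_right)

lemma affine_map_diff: "affine_map f \<Longrightarrow> affine_map g \<Longrightarrow> affine_map (\<lambda>x. f x - g x)"
  by (simp add: affine_map_def scaleR_diff_right)

lemma affine_map_compose: "affine_map f \<Longrightarrow> affine_map g \<Longrightarrow> affine_map (\<lambda>x. f (g x))"
  by (simp add: affine_map_def)

lemma linear_imp_affine_map: "linear f \<Longrightarrow> affine_map f"
  by (simp add: affine_map_def linear_add linear_scale)

lemma affine_map_linear_compose: "linear h \<Longrightarrow> affine_map f \<Longrightarrow> affine_map (\<lambda>x. h (f x))"
  by (simp add: affine_map_def linear_add linear_scale)

lemma affine_map_scaleR_left:
  assumes "affine_map f"
  shows "affine_map (\<lambda>x. f x *\<^sub>R c)"
  by (rule affine_map_linear_compose[OF _ assms]) (simp add: linear_iff scaleR_add_left)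

lemma affine_map_cmult:
  fixes f :: "'a::real_vector \<Rightarrow> real"
  assumes "affine_map f"
  shows "affine_map (\<lambda>x. c * f x)"
  by (rule affine_map_linear_compose[OF _ assms]) (simp add: linear_iff distrib_left)

lemma affine_map_divide:
  fixes f :: "'a::real_vector \<Rightarrow> real"
  assumes "affine_map f"
  shows "affine_map (\<lambda>x. f x / c)"
  by (rule affine_map_linear_compose[OF _ assms]) (simp add: linear_iff add_divide_distrib)

lemma affine_map_scaleR:
  assumes "affine_map f"
  shows "affine_map (\<lambda>x. c *\<^sub>R f x)"
  by (rule affine_map_linear_compose[OF _ assms]) (simp add: linear_iff scaleR_add_right)

lemma affine_map_inner: "affine_map f \<Longrightarrow> affine_map (\<lambda>x. a \<bullet> f x)"
  by (rule affine_map_linear_compose) (simp_all add: linear_iff inner_add_right)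

lemma affine_map_Pair: "affine_map f \<Longrightarrow> affine_map g \<Longrightarrow> affine_map (\<lambda>x. (f x, g x))"
  by (simp add: affine_map_def)

lemma affine_map_fst: "affine_map f \<Longrightarrow> affine_map (\<lambda>x. fst (f x))"
  by (simp add: affine_map_def)

lemma affine_map_snd: "affine_map f \<Longrightarrow> affine_map (\<lambda>x. snd (f x))"
  by (simp add: affine_map_def)

lemmas affine_map_intros = affine_map_const affine_map_id affine_map_add affine_map_diff
  affine_map_scaleR_left affine_map_cmult affine_map_divide affine_map_scaleR affine_map_inner
  affine_map_Pair affine_map_fst affine_map_snd

lemma affine_map_eq_inner:
  fixes f :: "'a::euclidean_space \<Rightarrow> real"
  assumes "affine_map f"
  shows "\<exists>a c. f = (\<lambda>x. a \<bullet> x + c)"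
proof -
  have sc: "f (u *\<^sub>R y) - f 0 = u * (f y - f 0)" for u y
    using affine_mapD_real[OF assms, of u 0 y] by (simp add: algebra_simps)
  \<comment> \<open>\<open>x + y\<close> is the midpoint of \<open>2 x\<close> and
    \<open>2 y\<close>.\<close>
  have "f (x + y) - f 0 = (f x - f 0) + (f y - f 0)" for x y
    using affine_mapD_real[OF assms, of "1/2" "2 *\<^sub>R x" "2 *\<^sub>R y"] sc[of 2 x] sc[of 2 y]
    by simp
  then have l: "linear (\<lambda>x. f x - f 0)"
    using sc by (simp add: linear_iff)
  have "f x - f 0 = adjoint (\<lambda>x. f x - f 0) 1 \<bullet> x" for x
    using adjoint_works[OF l, of x 1] by (simp add: inner_commute)
  then have "f = (\<lambda>x. adjoint (\<lambda>x. f x - f 0) 1 \<bullet> x + f 0)"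
    by (metis diff_add_cancel)
  then show ?thesis
    by blast
qed

lemma affine_map_affine_fun_on:
  "affine_map f \<Longrightarrow> affine_fun_on D f"
  using affine_map_eq_inner unfolding affine_fun_on_def by metis

lemma affine_fun_on_affine_map:
  assumes "affine_fun_on D f"
  obtains h where "affine_map h" "\<And>x. x \<in> D \<Longrightarrow> f x = h x"
proof -
  obtain a c where "\<forall>x\<in>D. f x = a \<bullet> x + c"
    using assms by (auto simp: affine_fun_on_def)
  moreover have "affine_map (\<lambda>x. a \<bullet> x + c)"
    by (intro affine_map_intros)
  ultimately show ?thesis
    using that[of "\<lambda>x. a \<bullet> x + c"] by auto
qed

text \<open>The zero set of the difference is affine. This identifies affine functions on
  full-dimensional cells and also shows that a given point lies outside an affine hull.\<close>

lemma affine_map_eq_on_affine_hull: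
  fixes f g :: "'a::euclidean_space \<Rightarrow> real"
  assumes "affine_map f" "affine_map g" "\<And>x. x \<in> S \<Longrightarrow> f x = g x" "x \<in> affine hull S"
  shows "f x = g x"
proof -
  have "affine_map (\<lambda>x. f x - g x)"
    using assms by (intro affine_map_intros)
  then obtain a c where ac: "(\<lambda>x. f x - g x) = (\<lambda>x. a \<bullet> x + c)"
    using affine_map_eq_inner by blast
  then have *: "f x - g x = a \<bullet> x + c" for x
    by metis
  have "S \<subseteq> {x. a \<bullet> x = - c}"
    using assms(3) * by (auto simp flip: eq_neg_iff_add_eq_0) (metis add.commute add.left_neutral add_diff_cancel_left' diff_0 diff_self)
  then have "affine hull S \<subseteq> {x. a \<bullet> x = - c}"
    by (simp add: affine_hyperplane hull_minimal)
  then show ?thesis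
    using assms(4) *[of x] by auto
qed

lemma affine_map_convex_le:
  fixes f :: "'a::real_vector \<Rightarrow> real"
  assumes "affine_map f" "\<And>x. x \<in> S \<Longrightarrow> f x \<le> c" "x \<in> convex hull S"
  shows "f x \<le> c"
proof -
  have "convex {x. f x \<le> c}"
    unfolding convex_alt
  proof clarsimp
    fix x y u assume "f x \<le> c" "f y \<le> c" "0 \<le> u" "u \<le> (1::real)"
    then show "f ((1 - u) *\<^sub>R x + u *\<^sub>R y) \<le> c"
      using convex_bound_le[of "f x" c "f y" "1-u" u] by (simp add: affine_mapD_real[OF assms(1)])
  qed
  then have "convex hull S \<subseteq> {x. f x \<le> c}"
    using assms(2) by (intro hull_minimal) auto
  then show ?thesis
    using assms(3) by auto
qed

lemma face_of_affine_eq: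
  fixes f :: "'a::euclidean_space \<Rightarrow> real"
  assumes "convex C" "affine_map f" "\<And>x. x \<in> C \<Longrightarrow> f x \<le> c"
  shows "{x \<in> C. f x = c} face_of C"
proof -
  obtain a d where ad: "f = (\<lambda>x. a \<bullet> x + d)"
    using affine_map_eq_inner[OF assms(2)] by blast
  have "C \<inter> {x. a \<bullet> x = c - d} face_of C"
    using assms(3) by (intro face_of_Int_supporting_hyperplane_le assms(1)) (force simp: ad)
  moreover have "C \<inter> {x. a \<bullet> x = c - d} = {x \<in> C. f x = c}"
    by (auto simp: ad)
  ultimately show ?thesis
    by simp
qed

subsection \<open>Projective maps\<close>

text \<open>Dividing an affine map by a positive affine function preserves segments up to
  reparametrization. Faces are defined by open segments, so every injective map of this kind
  transports the whole face lattice.\<close>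

locale projective_map =
  fixes C :: "'a::real_vector set" and f :: "'a \<Rightarrow> 'b::real_vector" and r :: "'a \<Rightarrow> real"
  assumes conv: "convex C" and f: "affine_map f" and r: "affine_map r"
    and pos: "\<And>x. x \<in> C \<Longrightarrow> 0 < r x"
begin

definition g where "g x = (1 / r x) *\<^sub>R f x"

lemma denominator_pos:
  assumes "x \<in> C" "y \<in> C" "0 \<le> u" "u \<le> 1"
  shows "0 < (1 - u) * r x + u * r y"
  using pos[of "(1 - u) *\<^sub>R x + u *\<^sub>R y"] convexD_alt[OF conv assms] affine_mapD_real[OF r] by simp

text \<open>The weights of the convex combination are multiplied by the denominators at the two
  points and renormalized.\<close>

lemma forward:
  assumes "x \<in> C" "y \<in> C" "0 \<le> u" "u \<le> 1"
  defines "v \<equiv> u * r y / ((1 - u) * r x + u * r y)"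
  shows "g ((1 - u) *\<^sub>R x + u *\<^sub>R y) = (1 - v) *\<^sub>R g x + v *\<^sub>R g y"
proof -
  let ?R = "(1 - u) * r x + u * r y"
  have R: "?R > 0"
    by (rule denominator_pos[OF assms(1-4)])
  have "1 - v = (1 - u) * r x / ?R"
    using R by (simp add: v_def field_simps)
  then have "(1 - v) / r x = (1 - u) / ?R" "v / r y = u / ?R"
    using pos[OF assms(1)] pos[OF assms(2)] by (auto simp: v_def)
  then show ?thesis
    using pos[OF assms(1)] pos[OF assms(2)] R
    by (simp add: g_def affine_mapD[OF f] affine_mapD_real[OF r] scaleR_add_right)
qed

text \<open>The formula of \<open>forward\<close> is solved for u; the denominators at x and y
  exchange their roles.\<close>

lemma backward:
  assumes "x \<in> C" "y \<in> C" "0 \<le> v" "v \<le> 1"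
  defines "u \<equiv> v * r x / ((1 - v) * r y + v * r x)"
  shows "g ((1 - u) *\<^sub>R x + u *\<^sub>R y) = (1 - v) *\<^sub>R g x + v *\<^sub>R g y"
    and "0 \<le> u" "u \<le> 1" "0 < v \<Longrightarrow> 0 < u" "v < 1 \<Longrightarrow> u < 1"
proof -
  let ?R = "(1 - v) * r y + v * r x"
  have p: "r x > 0" "r y > 0"
    using pos assms(1,2) by auto
  have R: "?R > 0"
    by (rule denominator_pos[OF assms(2,1,3,4)])
  have u: "1 - u = (1 - v) * r y / ?R"
    using R by (simp add: u_def field_simps)
  show *: "0 \<le> u" "u \<le> 1" "0 < v \<Longrightarrow> 0 < u" "v < 1 \<Longrightarrow> u < 1"
  proof -
    show "0 \<le> u" "0 < v \<Longrightarrow> 0 < u"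
      using R p assms(3) by (simp_all add: u_def)
    have "0 \<le> 1 - u" "v < 1 \<Longrightarrow> 0 < 1 - u"
      using R p assms(4) by (simp_all add: u)
    then show "u \<le> 1" "v < 1 \<Longrightarrow> u < 1"
      by auto
  qed
  have "(1 - u) * r x + u * r y = (((1 - v) * r y) * r x + (v * r x) * r y) / ?R"
    unfolding u by (simp add: u_def add_divide_distrib)
  also have "\<dots> = r x * r y / ?R"
    by (simp add: algebra_simps)
  finally have "u * r y / ((1 - u) * r x + u * r y) = v"
    using p R by (simp add: u_def)
  then show "g ((1 - u) *\<^sub>R x + u *\<^sub>R y) = (1 - v) *\<^sub>R g x + v *\<^sub>R g y"
    using forward[OF assms(1,2) *(1,2)] by simp
qed

lemma image_closed_segment:
  assumes "x \<in> C" "y \<in> C"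
  shows "g ` closed_segment x y = closed_segment (g x) (g y)"
proof
  show "g ` closed_segment x y \<subseteq> closed_segment (g x) (g y)"
  proof clarify
    fix z assume "z \<in> closed_segment x y"
    then obtain u where u: "0 \<le> u" "u \<le> 1" and z: "z = (1 - u) *\<^sub>R x + u *\<^sub>R y"
      by (auto simp: closed_segment_def)
    have "0 \<le> u * r y" "u * r y \<le> (1 - u) * r x + u * r y"
      using u pos[OF assms(1)] pos[OF assms(2)] by auto
    then have "0 \<le> u * r y / ((1 - u) * r x + u * r y)" "u * r y / ((1 - u) * r x + u * r y) \<le> 1"
      using denominator_pos[OF assms u] by auto
    then show "g z \<in> closed_segment (g x) (g y)"
      unfolding z forward[OF assms u] by (auto simp: closed_segment_def)
  qed
  show "closed_segment (g x) (g y) \<subseteq> g ` closed_segment x y"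
  proof
    fix z assume "z \<in> closed_segment (g x) (g y)"
    then obtain v where v: "0 \<le> v" "v \<le> 1" and z: "z = (1 - v) *\<^sub>R g x + v *\<^sub>R g y"
      by (auto simp: closed_segment_def)
    define u where "u = v * r x / ((1 - v) * r y + v * r x)"
    have "z = g ((1 - u) *\<^sub>R x + u *\<^sub>R y)" "0 \<le> u" "u \<le> 1"
      using backward[OF assms v] by (simp_all add: z u_def)
    then show "z \<in> g ` closed_segment x y"
      by (auto simp: closed_segment_def)
  qed
qed

lemma image_open_segment:
  assumes "inj_on g C" "x \<in> C" "y \<in> C"
  shows "g ` open_segment x y = open_segment (g x) (g y)"
proof -
  have "closed_segment x y \<subseteq> C"
    using assms conv by (simp add: closed_segment_subset)
  then have "g ` (closed_segment x y - {x, y}) = g ` closed_segment x y - g ` {x, y}"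
    using assms by (intro inj_on_image_set_diff[OF assms(1)]) auto
  then show ?thesis
    by (simp add: open_segment_def image_closed_segment assms)
qed

lemma convex_image: assumes "D \<subseteq> C" "convex D" shows "convex (g ` D)"
  unfolding convex_contains_segment
proof clarify
  fix x y z assume "x \<in> D" "y \<in> D" "z \<in> closed_segment (g x) (g y)"
  then show "z \<in> g ` D"
    using image_closed_segment[of x y] assms by (metis closed_segment_subset image_mono subset_iff)
qed

lemma face_of_image_iff:
  assumes "inj_on g C" "T \<subseteq> C"
  shows "g ` T face_of g ` C \<longleftrightarrow> T face_of C"
proof
  assume L: "T face_of C"
  then have "convex T"
    by (simp add: face_of_def)
  show "g ` T face_of g ` C"
    unfolding face_of_def
  proof (intro conjI ballI impI)
    show "g ` T \<subseteq> g ` C" "convex (g ` T)"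
      using assms convex_image \<open>convex T\<close> by auto
    fix a b x assume "a \<in> g ` C" "b \<in> g ` C" "x \<in> g ` T" "x \<in> open_segment a b"
    then obtain a' b' x' where *: "a = g a'" "b = g b'" "x = g x'" "a' \<in> C" "b' \<in> C" "x' \<in> T"
      by blast
    then have "g x' \<in> g ` open_segment a' b'"
      using \<open>x \<in> open_segment a b\<close> image_open_segment[OF assms(1)] by metis
    moreover have "open_segment a' b' \<subseteq> C"
      using * conv by (meson convex_contains_open_segment)
    ultimately have "x' \<in> open_segment a' b'"
      using * assms by (meson inj_on_image_mem_iff subsetD)
    then have "a' \<in> T" "b' \<in> T"
      using L * unfolding face_of_def by blast+
    then show "a \<in> g ` T" "b \<in> g ` T"
      using * by auto
  qed
next
  assume R: "g ` T face_of g ` C"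
  show "T face_of C"
    unfolding face_of_def
  proof (intro conjI ballI impI)
    show "T \<subseteq> C"
      by fact
    have cT: "convex (g ` T)"
      using R by (simp add: face_of_def)
    show "convex T"
      unfolding convex_contains_segment
    proof clarify
      fix x y z assume *: "x \<in> T" "y \<in> T" "z \<in> closed_segment x y"
      then have xy: "x \<in> C" "y \<in> C"
        using assms by auto
      then have "z \<in> C"
        using *(3) conv by (meson convex_contains_segment subsetD)
      have "g z \<in> closed_segment (g x) (g y)"
        using * image_closed_segment[OF xy] by blast
      then have "g z \<in> g ` T"
        using * cT by (meson convex_contains_segment imageI subsetD)
      then show "z \<in> T"
        using \<open>z \<in> C\<close> assms by (meson inj_on_image_mem_iff)
    qed
    fix a b x assume *: "a \<in> C" "b \<in> C" "x \<in> T" "x \<in> open_segment a b"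
    then have "g x \<in> open_segment (g a) (g b)"
      using image_open_segment[OF assms(1)] by blast
    then have "g a \<in> g ` T" "g b \<in> g ` T"
      using R * unfolding face_of_def by blast+
    then show "a \<in> T" "b \<in> T"
      using * assms by (meson inj_on_image_mem_iff)+
  qed
qed

lemma faces_of_image:
  assumes "inj_on g C" "D face_of g ` C"
  shows "\<exists>T. T face_of C \<and> D = g ` T"
proof -
  have "D \<subseteq> g ` C"
    using assms(2) face_of_imp_subset by blast
  then have "D = g ` {x \<in> C. g x \<in> D}"
    by auto
  then show ?thesis
    using face_of_image_iff[OF assms(1), of "{x \<in> C. g x \<in> D}"] assms(2) by auto
qed

text \<open>One inclusion is convexity of the image. For the other, the part of C that is mapped
  into a convex set is itself convex, because segments go onto segments.\<close>

lemma image_convex_hull: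
  assumes "V \<subseteq> C"
  shows "g ` (convex hull V) = convex hull (g ` V)"
proof
  have VC: "convex hull V \<subseteq> C"
    using assms conv by (simp add: hull_minimal)
  show "convex hull (g ` V) \<subseteq> g ` (convex hull V)"
    by (rule hull_minimal[OF image_mono[OF hull_subset[of V convex]]])
      (rule convex_image[OF VC convex_convex_hull])
  let ?W = "{x \<in> C. g x \<in> convex hull (g ` V)}"
  have "convex ?W"
  proof (rule iffD2[OF convex_contains_segment], intro ballI subsetI)
    fix x y z assume "x \<in> ?W" "y \<in> ?W" and z: "z \<in> closed_segment x y"
    then have *: "x \<in> C" "y \<in> C" "g x \<in> convex hull (g ` V)" "g y \<in> convex hull (g ` V)"
      by auto
    then have "g z \<in> closed_segment (g x) (g y)"
      using image_closed_segment[of x y] z by blast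
    then have "g z \<in> convex hull (g ` V)"
      using * by (meson convex_contains_segment convex_convex_hull subsetD)
    moreover have "z \<in> C"
      using * z conv by (meson convex_contains_segment subsetD)
    ultimately show "z \<in> ?W"
      by simp
  qed
  moreover have "V \<subseteq> ?W"
    using assms by (auto simp: hull_inc)
  ultimately have "convex hull V \<subseteq> ?W"
    by (intro hull_minimal)
  then show "g ` (convex hull V) \<subseteq> convex hull (g ` V)"
    by auto
qed

lemma polytope_image: "polytope C \<Longrightarrow> polytope (g ` C)"
  unfolding polytope_def by (metis finite_imageI hull_subset image_convex_hull)

end

subsection \<open>Combinatorial equivalence\<close>

lemma combinatorially_equivalentI:
  fixes P :: "'a::euclidean_space set" and Q :: "'b::euclidean_space set"
  assumes "\<And>F. F face_of P \<Longrightarrow> f F face_of Q"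
    and "\<And>G. G face_of Q \<Longrightarrow> \<exists>F. F face_of P \<and> f F = G"
    and "\<And>F F'. F face_of P \<Longrightarrow> F' face_of P \<Longrightarrow> F \<subseteq> F' \<longleftrightarrow> f F \<subseteq> f F'"
  shows "combinatorially_equivalent P Q"
proof -
  have "inj_on f {F. F face_of P}"
    using assms(3) by (intro inj_onI) (metis mem_Collect_eq order_refl subset_antisym)
  moreover have "f ` {F. F face_of P} = {G. G face_of Q}"
    using assms(1,2) by blast
  ultimately show ?thesis
    unfolding combinatorially_equivalent_def bij_betw_def using assms(3) by blast
qed

lemma combinatorially_equivalentE:
  assumes "combinatorially_equivalent P Q"
  obtains f where "\<And>F. F face_of P \<Longrightarrow> f F face_of Q"
    and "\<And>G. G face_of Q \<Longrightarrow> \<exists>F. F face_of P \<and> f F = G"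
    and "\<And>F F'. F face_of P \<Longrightarrow> F' face_of P \<Longrightarrow> F \<subseteq> F' \<longleftrightarrow> f F \<subseteq> f F'"
proof -
  obtain f where f: "bij_betw f {F. F face_of P} {G. G face_of Q}"
    "\<forall>F F'. F face_of P \<longrightarrow> F' face_of P \<longrightarrow> (F \<subseteq> F' \<longleftrightarrow> f F \<subseteq> f F')"
    using assms unfolding combinatorially_equivalent_def by blast
  have "f ` {F. F face_of P} = {G. G face_of Q}"
    using f(1) by (simp add: bij_betw_def)
  show ?thesis
  proof (rule that)
    show "f F face_of Q" if "F face_of P" for F
      using that \<open>f ` _ = _\<close> by blast
    show "\<exists>F. F face_of P \<and> f F = G" if "G face_of Q" for G
      using that \<open>f ` _ = _\<close> by (metis (mono_tags, lifting) imageE mem_Collect_eq)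
    show "F \<subseteq> F' \<longleftrightarrow> f F \<subseteq> f F'" if "F face_of P" "F' face_of P" for F F'
      using that f(2) by blast
  qed
qed

lemma combinatorially_equivalent_sym:
  assumes "combinatorially_equivalent P Q"
  shows "combinatorially_equivalent Q P"
proof -
  obtain f where f: "\<And>F. F face_of P \<Longrightarrow> f F face_of Q"
    "\<And>G. G face_of Q \<Longrightarrow> \<exists>F. F face_of P \<and> f F = G"
    "\<And>F F'. F face_of P \<Longrightarrow> F' face_of P \<Longrightarrow> F \<subseteq> F' \<longleftrightarrow> f F \<subseteq> f F'"
    using combinatorially_equivalentE[OF assms] by blast
  have "\<forall>G. \<exists>F. G face_of Q \<longrightarrow> F face_of P \<and> f F = G"
    using f(2) by blast
  then obtain h where h: "\<And>G. G face_of Q \<Longrightarrow> h G face_of P \<and> f (h G) = G"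
    by metis
  show ?thesis
  proof (rule combinatorially_equivalentI[of _ h])
    show "\<exists>G. G face_of Q \<and> h G = F" if "F face_of P" for F
      using f(1)[OF that] h[of "f F"] f(3) that by (metis order_refl subset_antisym)
  qed (use f h in auto)
qed

lemma combinatorially_equivalent_trans:
  assumes "combinatorially_equivalent P Q" "combinatorially_equivalent Q R"
  shows "combinatorially_equivalent P R"
proof -
  obtain f where f: "\<And>F. F face_of P \<Longrightarrow> f F face_of Q"
    "\<And>G. G face_of Q \<Longrightarrow> \<exists>F. F face_of P \<and> f F = G"
    "\<And>F F'. F face_of P \<Longrightarrow> F' face_of P \<Longrightarrow> F \<subseteq> F' \<longleftrightarrow> f F \<subseteq> f F'"
    using combinatorially_equivalentE[OF assms(1)] by blast
  obtain h where h: "\<And>F. F face_of Q \<Longrightarrow> h F face_of R"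
    "\<And>G. G face_of R \<Longrightarrow> \<exists>F. F face_of Q \<and> h F = G"
    "\<And>F F'. F face_of Q \<Longrightarrow> F' face_of Q \<Longrightarrow> F \<subseteq> F' \<longleftrightarrow> h F \<subseteq> h F'"
    using combinatorially_equivalentE[OF assms(2)] by blast
  show ?thesis
  proof (rule combinatorially_equivalentI[of _ "\<lambda>F. h (f F)"])
    show "\<exists>F. F face_of P \<and> h (f F) = G" if "G face_of R" for G
      using h(2)[OF that] f(2) by blast
  qed (use f h in auto)
qed

text \<open>The empty face is the least element of both face lattices.\<close>

lemma order_embedding_empty_face:
  assumes "\<And>G. G face_of Q \<Longrightarrow> \<exists>F. F face_of P \<and> f F = G"
    and "\<And>F F'. F face_of P \<Longrightarrow> F' face_of P \<Longrightarrow> F \<subseteq> F' \<longleftrightarrow> f F \<subseteq> f F'"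
  shows "f {} = {}"
  using assms(1)[of "{}"] assms(2)[of "{}"] by (metis empty_face_of empty_subsetI subset_empty)

lemma combinatorially_equivalent_face:
  assumes f: "\<And>F. F face_of P \<Longrightarrow> f F face_of Q"
    "\<And>G. G face_of Q \<Longrightarrow> \<exists>F. F face_of P \<and> f F = G"
    "\<And>F F'. F face_of P \<Longrightarrow> F' face_of P \<Longrightarrow> F \<subseteq> F' \<longleftrightarrow> f F \<subseteq> f F'"
    and T: "T face_of P"
  shows "combinatorially_equivalent T (f T)"
proof (rule combinatorially_equivalentI[of _ f])
  fix F assume F: "F face_of T"
  then have "F face_of P" "F \<subseteq> T"
    using T face_of_trans face_of_imp_subset by blast+
  then show "f F face_of f T"
    using f(1,3) T by (meson face_of_imp_subset face_of_subset)
next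
  fix G assume G: "G face_of f T"
  then have "G face_of Q"
    using f(1) T face_of_trans by blast
  then obtain F where F: "F face_of P" "f F = G"
    using f(2) by blast
  then have "F \<subseteq> T"
    using f(3) T G face_of_imp_subset by blast
  then have "F face_of T"
    using F T by (meson face_of_imp_subset face_of_subset)
  then show "\<exists>F. F face_of T \<and> f F = G"
    using F by blast
next
  fix F F' assume "F face_of T" "F' face_of T"
  then show "F \<subseteq> F' \<longleftrightarrow> f F \<subseteq> f F'"
    using f(3) T face_of_trans by blast
qed

text \<open>Passing to a facet lowers the dimension of P by exactly one, while its image is a proper
  face of Q and loses at least one. Used in both directions, this makes the dimension a
  combinatorial invariant.\<close>

lemma combinatorially_equivalent_aff_dim_le:
  assumes "polytope P" "polytope Q" "combinatorially_equivalent P Q"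
  shows "aff_dim P \<le> aff_dim Q"
  using assms
proof (induction "nat (aff_dim P + 1)" arbitrary: P Q rule: less_induct)
  case less
  obtain f where f: "\<And>F. F face_of P \<Longrightarrow> f F face_of Q"
    "\<And>G. G face_of Q \<Longrightarrow> \<exists>F. F face_of P \<and> f F = G"
    "\<And>F F'. F face_of P \<Longrightarrow> F' face_of P \<Longrightarrow> F \<subseteq> F' \<longleftrightarrow> f F \<subseteq> f F'"
    using combinatorially_equivalentE[OF less.prems(3)] by blast
  have cP: "convex P" and cQ: "convex Q"
    using less.prems polytope_imp_convex by auto
  show ?case
  proof (cases "P = {}")
    case True
    then show ?thesis
      by (simp add: aff_dim_geq)
  next
    case False
    then have P0: "aff_dim P \<ge> 0"
      using aff_dim_geq[of P] aff_dim_empty[of P] by linarith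
    obtain T where T: "T face_of P" "aff_dim T = aff_dim P - 1"
    \<comment> \<open>For a single point the empty face, of dimension -1, takes the place of a
      facet.\<close>
    proof (cases "aff_dim P = 0")
      case True
      then show ?thesis
        using that[of "{}"] by simp
    next
      case False
      then show ?thesis
        using polytope_facet_exists[OF less.prems(1)] P0 that unfolding facet_of_def by auto
    qed
    have "f T face_of Q"
      using f(1) T(1) by blast
    have "f T \<noteq> Q"
    proof
      assume "f T = Q"
      then have "f P \<subseteq> f T"
        using f(1)[OF face_of_refl[OF cP]] face_of_imp_subset by blast
      then have "P \<subseteq> T"
        using f(3)[OF face_of_refl[OF cP] T(1)] by blast
      then show False
        using T face_of_imp_subset by fastforce
    qed
    then have "aff_dim (f T) < aff_dim Q"
      using face_of_aff_dim_lt[OF cQ \<open>f T face_of Q\<close>] by blast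
    moreover have "aff_dim T \<le> aff_dim (f T)"
    proof (rule less.hyps)
      show "nat (aff_dim T + 1) < nat (aff_dim P + 1)"
        using T(2) P0 by simp
      show "polytope T" "polytope (f T)"
        using less.prems T(1) \<open>f T face_of Q\<close> face_of_polytope_polytope by blast+
      show "combinatorially_equivalent T (f T)"
        by (rule combinatorially_equivalent_face[OF f T(1)])
    qed
    ultimately show ?thesis
      using T(2) by simp
  qed
qed

lemma combinatorially_equivalent_projective_image:
  fixes f :: "'a::euclidean_space \<Rightarrow> 'b::euclidean_space"
  assumes "projective_map C f r" "inj_on (projective_map.g f r) C"
  shows "combinatorially_equivalent C (projective_map.g f r ` C)"
proof -
  interpret projective_map C f r by fact
  show ?thesis
  proof (rule combinatorially_equivalentI[of _ "image g"])
    show "g ` F face_of g ` C" if "F face_of C" for F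
      using that face_of_image_iff[OF assms(2)] face_of_imp_subset by blast
    show "\<exists>F. F face_of C \<and> g ` F = G" if "G face_of g ` C" for G
      using faces_of_image[OF assms(2) that] by blast
    show "F \<subseteq> F' \<longleftrightarrow> g ` F \<subseteq> g ` F'" if "F face_of C" "F' face_of C" for F F'
      using that inj_on_image_subset_iff[OF assms(2)] face_of_imp_subset by metis
  qed
qed

lemma affine_image_projective_map:
  assumes "convex C" "affine_map f"
  shows "projective_map C f (\<lambda>x. 1)" "projective_map.g f (\<lambda>x. 1) = f"
proof -
  show "projective_map C f (\<lambda>x. 1)"
    using assms by unfold_locales (auto intro: affine_map_const)
  then interpret projective_map C f "\<lambda>x. 1" .
  show "g = f"
    by (simp add: g_def fun_eq_iff)
qed

lemma combinatorially_equivalent_affine_image: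
  fixes f :: "'a::euclidean_space \<Rightarrow> 'b::euclidean_space"
  assumes "convex C" "affine_map f" "inj_on f C"
  shows "combinatorially_equivalent C (f ` C)"
  using combinatorially_equivalent_projective_image[OF affine_image_projective_map(1)[OF assms(1,2)]]
    affine_image_projective_map(2)[OF assms(1,2)] assms(3) by simp

lemma combinatorially_equivalent_Times:
  fixes P :: "'a::euclidean_space set" and Q :: "'b::euclidean_space set" and I :: "'c::euclidean_space set"
  assumes "combinatorially_equivalent P Q"
  shows "combinatorially_equivalent (P \<times> I) (Q \<times> I)"
proof -
  obtain f where f: "\<And>F. F face_of P \<Longrightarrow> f F face_of Q"
    "\<And>G. G face_of Q \<Longrightarrow> \<exists>F. F face_of P \<and> f F = G"
    "\<And>F F'. F face_of P \<Longrightarrow> F' face_of P \<Longrightarrow> F \<subseteq> F' \<longleftrightarrow> f F \<subseteq> f F'"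
    using combinatorially_equivalentE[OF assms] by blast
  have f0: "f {} = {}"
    by (rule order_embedding_empty_face[OF f(2,3)])
  have fne: "f A = {} \<longleftrightarrow> A = {}" if "A face_of P" for A
    using f(3)[OF that, of "{}"] f0 by auto
  \<comment> \<open>The factors of a nonempty product face are recovered by projection. Several
    pairs describe the empty product, but \<open>f {} = {}\<close> gives the right value there
    too.\<close>
  define h :: "('a \<times> 'c) set \<Rightarrow> ('b \<times> 'c) set" where "h c = f (fst ` c) \<times> (snd ` c)" for c
  have h: "h (A \<times> B) = (if A = {} \<or> B = {} then {} else f A \<times> B)" for A and B :: "'c set"
    by (simp add: h_def f0)
  have h': "h (A \<times> B) = f A \<times> B" if "A face_of P" for A and B :: "'c set"
    using fne[OF that] by (auto simp: h)
  show ?thesis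
  proof (rule combinatorially_equivalentI[of _ h])
    fix c assume "c face_of P \<times> I"
    then obtain A B where c: "c = A \<times> B" "A face_of P" "B face_of I"
      unfolding face_of_Times_decomp by blast
    then show "h c face_of Q \<times> I"
      unfolding face_of_Times_decomp using h' f(1) by blast
  next
    fix c assume "c face_of Q \<times> I"
    then obtain A B where c: "c = A \<times> B" "A face_of Q" "B face_of I"
      unfolding face_of_Times_decomp by blast
    then obtain A' where A': "A' face_of P" "f A' = A"
      using f(2) by blast
    then have "h (A' \<times> B) = c" "A' \<times> B face_of P \<times> I"
      using h' c by (auto simp: face_of_Times)
    then show "\<exists>F. F face_of P \<times> I \<and> h F = c"
      by blast
  next
    fix c c' assume "c face_of P \<times> I" "c' face_of P \<times> I"
    then obtain A B A' B' where c: "c = A \<times> B" "A face_of P" "B face_of I"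
      and c': "c' = A' \<times> B'" "A' face_of P" "B' face_of I"
      unfolding face_of_Times_decomp by blast
    then show "c \<subseteq> c' \<longleftrightarrow> h c \<subseteq> h c'"
      using f(3) fne by (simp add: h' times_subset_iff)
  qed
qed

subsection \<open>Cubes\<close>

lemma inner_sum_Basis_subset:
  fixes B :: "'a::euclidean_space set"
  assumes "B \<subseteq> Basis" "i \<in> Basis"
  shows "(\<Sum>B) \<bullet> i = of_bool (i \<in> B)"
proof -
  have fin: "finite B"
    using assms(1) finite_Basis finite_subset by blast
  have "(\<Sum>B) \<bullet> i = (\<Sum>j\<in>B. j \<bullet> i)"
    by (simp add: inner_sum_left)
  also have "\<dots> = (\<Sum>j\<in>B. if j = i then 1 else 0)"
    using assms by (intro sum.cong) (auto simp: inner_Basis)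
  finally show ?thesis
    using fin by simp
qed

lemma mem_std_cube:
  fixes B :: "'a::euclidean_space set"
  assumes "B \<subseteq> Basis"
  shows "x \<in> cbox 0 (\<Sum>B) \<longleftrightarrow> (\<forall>i\<in>Basis. 0 \<le> x \<bullet> i \<and> x \<bullet> i \<le> of_bool (i \<in> B))"
  using assms by (simp add: mem_box inner_sum_Basis_subset)

text \<open>The coordinate b vanishes on the smaller cube, so \<open>s *\<^sub>R b\<close> fills
  precisely this coordinate: a cube is a prism over a cube, the basis of all inductions on
  B.\<close>

lemma std_cube_insert:
  fixes B :: "'a::euclidean_space set"
  assumes "B \<subseteq> Basis" "b \<in> Basis" "b \<notin> B"
  shows "(\<lambda>(x, s). x + s *\<^sub>R b) ` (cbox 0 (\<Sum>B) \<times> {0..1}) = cbox 0 (\<Sum>(insert b B))"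
    and "inj_on (\<lambda>(x, s). x + s *\<^sub>R b) (cbox 0 (\<Sum>B) \<times> {0..1})"
proof -
  have B': "insert b B \<subseteq> Basis"
    using assms by auto
  have 0: "x \<bullet> b = 0" if "x \<in> cbox 0 (\<Sum>B)" for x
    using that assms by (force simp: mem_std_cube)
  show "inj_on (\<lambda>(x, s). x + s *\<^sub>R b) (cbox 0 (\<Sum>B) \<times> {0..1})"
  proof (rule inj_onI, clarify)
    fix x s y t assume *: "x \<in> cbox 0 (\<Sum>B)" "y \<in> cbox 0 (\<Sum>B)" "x + s *\<^sub>R b = y + t *\<^sub>R b"
    then have "(x + s *\<^sub>R b) \<bullet> b = (y + t *\<^sub>R b) \<bullet> b"
      by simp
    then have "s = t"
      using 0[OF *(1)] 0[OF *(2)] assms(2) by (simp add: inner_add_left)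
    then show "x = y \<and> s = t"
      using * by simp
  qed
  show "(\<lambda>(x, s). x + s *\<^sub>R b) ` (cbox 0 (\<Sum>B) \<times> {0..1}) = cbox 0 (\<Sum>(insert b B))"
  proof (intro equalityI subsetI)
    fix z assume "z \<in> (\<lambda>(x, s). x + s *\<^sub>R b) ` (cbox 0 (\<Sum>B) \<times> {0..1})"
    then obtain x s where z: "z = x + s *\<^sub>R b" "x \<in> cbox 0 (\<Sum>B)" "0 \<le> s" "s \<le> 1"
      by auto
    show "z \<in> cbox 0 (\<Sum>(insert b B))"
      unfolding mem_std_cube[OF B']
    proof
      fix i :: 'a assume i: "i \<in> Basis"
      have "0 \<le> x \<bullet> i" "x \<bullet> i \<le> of_bool (i \<in> B)"
        using z(2) i by (auto simp: mem_std_cube[OF assms(1)])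
      then show "0 \<le> z \<bullet> i \<and> z \<bullet> i \<le> of_bool (i \<in> insert b B)"
        using z i assms 0[OF z(2)] by (cases "i = b") (auto simp: inner_add_left inner_Basis)
    qed
  next
    fix z assume z: "z \<in> cbox 0 (\<Sum>(insert b B))"
    define x where "x = z - (z \<bullet> b) *\<^sub>R b"
    have "x \<in> cbox 0 (\<Sum>B)"
      unfolding mem_std_cube[OF assms(1)]
    proof
      fix i :: 'a assume i: "i \<in> Basis"
      have "0 \<le> z \<bullet> i" "z \<bullet> i \<le> of_bool (i \<in> insert b B)"
        using z i by (auto simp: mem_std_cube[OF B'])
      then show "0 \<le> x \<bullet> i \<and> x \<bullet> i \<le> of_bool (i \<in> B)"
        using i assms by (cases "i = b") (auto simp: x_def inner_diff_left inner_Basis)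
    qed
    moreover have "z \<bullet> b \<in> {0..1}"
      using z assms(2) by (auto simp: mem_std_cube[OF B'])
    ultimately show "z \<in> (\<lambda>(x, s). x + s *\<^sub>R b) ` (cbox 0 (\<Sum>B) \<times> {0..1})"
      by (intro image_eqI[of _ _ "(x, z \<bullet> b)"]) (auto simp: x_def)
  qed
qed

lemma affine_map_add_scaleR_snd: "affine_map (\<lambda>(x, s::real). x + s *\<^sub>R b)"
  unfolding case_prod_beta by (intro affine_map_intros)

lemma combinatorially_equivalent_std_cube_insert:
  fixes B :: "'a::euclidean_space set"
  assumes "B \<subseteq> Basis" "b \<in> Basis" "b \<notin> B"
  shows "combinatorially_equivalent (cbox 0 (\<Sum>B) \<times> {0..1::real}) (cbox 0 (\<Sum>(insert b B)))"
  using combinatorially_equivalent_affine_image[OF _ affine_map_add_scaleR_snd std_cube_insert(2)[OF assms]]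
  by (simp add: std_cube_insert(1)[OF assms] convex_Times)

lemma face_of_unit_interval:
  fixes T :: "real set"
  assumes "T face_of {0..1}" "T \<noteq> {}"
  shows "T = {0..1} \<or> (\<exists>c. T = {c})"
proof (cases "\<exists>s\<in>T. 0 < s \<and> s < 1")
  case True
  then obtain s where s: "s \<in> T" "0 < s" "s < 1"
    by blast
  then have "s \<in> open_segment 0 1"
    by (simp add: open_segment_eq_real_ivl)
  then have "0 \<in> T" "1 \<in> T"
    using face_ofD[OF assms(1), of s 0 1] s(1) by auto
  then have "closed_segment 0 1 \<subseteq> T"
    using assms(1) by (simp add: closed_segment_subset face_of_imp_convex)
  then show ?thesis
    using face_of_imp_subset[OF assms(1)] by (auto simp: closed_segment_eq_real_ivl)
next
  case False
  have T: "T \<subseteq> {0, 1}"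
    using False face_of_imp_subset[OF assms(1)] by force
  have "\<not> (0 \<in> T \<and> 1 \<in> T)"
  proof
    assume "0 \<in> T \<and> 1 \<in> T"
    then have "closed_segment 0 1 \<subseteq> T"
      using assms(1) by (simp add: closed_segment_subset face_of_imp_convex)
    then have "1/2 \<in> T"
      by (auto simp: closed_segment_eq_real_ivl)
    then show False
      using T by auto
  qed
  then show ?thesis
    using T assms(2) by blast
qed

text \<open>A face of the prism is a product of a face of the smaller cube with a face of the
  interval. A point as second factor changes nothing; the whole interval adds b to the index
  set.\<close>

lemma face_of_std_cube:
  fixes B :: "'a::euclidean_space set"
  assumes "finite B" "B \<subseteq> Basis" "T face_of cbox 0 (\<Sum>B)" "T \<noteq> {}"
  shows "\<exists>B'\<subseteq>B. combinatorially_equivalent T (cbox 0 (\<Sum>B'))"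
  using assms
proof (induction B arbitrary: T rule: finite_induct)
  case empty
  then have "T = {0}"
    using face_of_imp_subset by fastforce
  then show ?case
    using combinatorially_equivalent_affine_image[OF _ affine_map_id, of "{0::'a}"] by auto
next
  case (insert b B)
  let ?h = "\<lambda>(x, s::real). x + s *\<^sub>R b"
  let ?C = "cbox 0 (\<Sum>B) \<times> {0..1::real}"
  have B: "B \<subseteq> Basis" "b \<in> Basis" "b \<notin> B"
    using insert by auto
  have cC: "convex ?C"
    by (simp add: convex_Times)
  interpret pm: projective_map ?C ?h "\<lambda>x. 1"
    by (rule affine_image_projective_map(1)[OF cC affine_map_add_scaleR_snd])
  have g: "pm.g = ?h"
    by (rule affine_image_projective_map(2)[OF cC affine_map_add_scaleR_snd])
  have inj: "inj_on ?h ?C"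
    by (rule std_cube_insert(2)[OF B])
  have "T face_of pm.g ` ?C"
    unfolding g std_cube_insert(1)[OF B] by fact
  then obtain U where U: "U face_of ?C" "T = ?h ` U"
    using pm.faces_of_image inj unfolding g by blast
  then obtain T1 T2 where T12: "U = T1 \<times> T2" "T1 face_of cbox 0 (\<Sum>B)" "T2 face_of {0..1::real}"
    unfolding face_of_Times_decomp by blast
  have ne: "T1 \<noteq> {}" "T2 \<noteq> {}"
    using insert.prems(3) U(2) T12(1) by auto
  have "combinatorially_equivalent U T"
    unfolding U(2)
  proof (rule combinatorially_equivalent_affine_image[OF _ affine_map_add_scaleR_snd])
    show "convex U"
      using U(1) face_of_imp_convex by blast
    show "inj_on ?h U"
      using inj U(1) face_of_imp_subset inj_on_subset by blast
  qed
  then have TU: "combinatorially_equivalent T U"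
    by (rule combinatorially_equivalent_sym)
  obtain B' where B': "B' \<subseteq> B" "combinatorially_equivalent T1 (cbox 0 (\<Sum>B'))"
    using insert.IH[OF B(1) T12(2) ne(1)] by blast
  have cT1: "convex T1"
    using T12(2) face_of_imp_convex by blast
  consider "T2 = {0..1}" | c where "T2 = {c}"
    using face_of_unit_interval[OF T12(3) ne(2)] by blast
  then show ?case
  proof cases
    case 1
    have 1: "combinatorially_equivalent U (cbox 0 (\<Sum>B') \<times> {0..1::real})"
      unfolding T12(1) 1 by (rule combinatorially_equivalent_Times[OF B'(2)])
    have "combinatorially_equivalent (cbox 0 (\<Sum>B') \<times> {0..1::real}) (cbox 0 (\<Sum>(insert b B')))"
      using B B' by (intro combinatorially_equivalent_std_cube_insert) auto
    then have "combinatorially_equivalent T (cbox 0 (\<Sum>(insert b B')))"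
      by (rule combinatorially_equivalent_trans[OF combinatorially_equivalent_trans[OF TU 1]])
    then show ?thesis
      using B'(1) by blast
  next
    case 2
    have "combinatorially_equivalent U (fst ` U)"
    proof (rule combinatorially_equivalent_affine_image)
      show "convex U"
        using U(1) face_of_imp_convex by blast
      show "affine_map (fst :: 'a \<times> real \<Rightarrow> 'a)"
        by (intro linear_imp_affine_map linear_fst)
      show "inj_on fst U"
        by (auto simp: T12(1) 2 inj_on_def)
    qed
    then have "combinatorially_equivalent U T1"
      by (simp add: T12(1) 2)
    then have "combinatorially_equivalent T (cbox 0 (\<Sum>B'))"
      by (rule combinatorially_equivalent_trans[OF TU combinatorially_equivalent_trans[OF _ B'(2)]])
    then show ?thesis
      using B'(1) by blast
  qed
qed

lemma aff_dim_std_cube: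
  fixes B :: "'a::euclidean_space set"
  assumes "B \<subseteq> Basis"
  shows "aff_dim (cbox 0 (\<Sum>B)) = int (card B)"
proof -
  let ?Q = "cbox 0 (\<Sum>B)"
  have fin: "finite B"
    using assms finite_Basis finite_subset by blast
  have "0 \<in> ?Q"
    using assms by (simp add: mem_std_cube)
  then have "aff_dim ?Q = int (dim ?Q)"
    by (simp add: aff_dim_zero hull_inc)
  moreover have "dim ?Q = card B"
  proof (rule dim_unique)
    show "B \<subseteq> ?Q"
      using assms by (auto simp: mem_std_cube[OF assms] inner_Basis)
    show "?Q \<subseteq> span B"
    proof
      fix x assume x: "x \<in> ?Q"
      have "x = (\<Sum>i\<in>Basis. (x \<bullet> i) *\<^sub>R i)"
        by (simp add: euclidean_representation)
      also have "\<dots> = (\<Sum>i\<in>B. (x \<bullet> i) *\<^sub>R i)"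
        using x assms by (intro sum.mono_neutral_right) (force simp: mem_std_cube[OF assms])+
      also have "\<dots> \<in> span B"
        by (intro span_sum span_scale span_base)
      finally show "x \<in> span B" .
    qed
    show "independent B"
      using assms independent_Basis independent_mono by blast
  qed simp
  ultimately show ?thesis
    by simp
qed

lemma combinatorial_cube_polytope: "combinatorial_cube k C \<Longrightarrow> polytope C"
  by (simp add: combinatorial_cube_def)

lemma combinatorial_cubeE:
  fixes C :: "'a::euclidean_space set"
  assumes "combinatorial_cube k C"
  obtains B :: "'a set" where "B \<subseteq> Basis" "card B = k" "combinatorially_equivalent C (cbox 0 (\<Sum>B))"
  using assms by (auto simp: combinatorial_cube_def)

lemma combinatorial_cubeI:
  fixes C :: "'a::euclidean_space set" and B :: "'a set"
  assumes "polytope C" "B \<subseteq> Basis" "combinatorially_equivalent C (cbox 0 (\<Sum>B))"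
  shows "combinatorial_cube (card B) C"
  unfolding combinatorial_cube_def using assms by metis

text \<open>Dimension is a combinatorial invariant. This determines the k whose mere existence is
  asserted in \<open>cubical_complex\<close>.\<close>

lemma combinatorial_cube_aff_dim:
  fixes C :: "'a::euclidean_space set"
  assumes "combinatorial_cube k C"
  shows "aff_dim C = int k"
proof -
  obtain B :: "'a set" where B: "B \<subseteq> Basis" "card B = k" "combinatorially_equivalent C (cbox 0 (\<Sum>B))"
    by (rule combinatorial_cubeE[OF assms])
  have C: "polytope C"
    by (rule combinatorial_cube_polytope[OF assms])
  have "aff_dim C = aff_dim (cbox 0 (\<Sum>B))"
    by (rule antisym)
      (rule combinatorially_equivalent_aff_dim_le[OF C polytope_interval B(3)],
        rule combinatorially_equivalent_aff_dim_le[OF polytope_interval C combinatorially_equivalent_sym[OF B(3)]])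
  then show ?thesis
    using aff_dim_std_cube[OF B(1)] B(2) by simp
qed

lemma combinatorial_cube_face:
  fixes C T :: "'a::euclidean_space set"
  assumes "combinatorial_cube k C" "T face_of C" "T \<noteq> {}"
  shows "\<exists>j. combinatorial_cube j T"
proof -
  obtain B :: "'a set" where B: "B \<subseteq> Basis" "card B = k" "combinatorially_equivalent C (cbox 0 (\<Sum>B))"
    by (rule combinatorial_cubeE[OF assms(1)])
  have C: "polytope C"
    by (rule combinatorial_cube_polytope[OF assms(1)])
  obtain f where f: "\<And>F. F face_of C \<Longrightarrow> f F face_of cbox 0 (\<Sum>B)"
    "\<And>G. G face_of cbox 0 (\<Sum>B) \<Longrightarrow> \<exists>F. F face_of C \<and> f F = G"
    "\<And>F F'. F face_of C \<Longrightarrow> F' face_of C \<Longrightarrow> F \<subseteq> F' \<longleftrightarrow> f F \<subseteq> f F'"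
    using combinatorially_equivalentE[OF B(3)] by blast
  have 1: "combinatorially_equivalent T (f T)"
    by (rule combinatorially_equivalent_face[OF f assms(2)])
  have "f T \<noteq> {}"
    using f(3)[OF assms(2), of "{}"] order_embedding_empty_face[OF f(2,3)] assms(3) by auto
  then obtain B' where B': "B' \<subseteq> B" "combinatorially_equivalent (f T) (cbox 0 (\<Sum>B'))"
    using face_of_std_cube[OF _ B(1) f(1)[OF assms(2)]] B(1) finite_Basis finite_subset by metis
  then have "combinatorially_equivalent T (cbox 0 (\<Sum>B'))"
    using combinatorially_equivalent_trans[OF 1] by blast
  moreover have "polytope T"
    using C assms(2) face_of_polytope_polytope by blast
  moreover have "B' \<subseteq> Basis"
    using B(1) B'(1) by blast
  ultimately show ?thesis
    using combinatorial_cubeI by blast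
qed

lemma combinatorial_cube_equivalent:
  fixes C D :: "'a::euclidean_space set"
  assumes "combinatorial_cube k C" "polytope D" "combinatorially_equivalent C D"
  shows "combinatorial_cube k D"
proof -
  obtain B :: "'a set" where B: "B \<subseteq> Basis" "card B = k" "combinatorially_equivalent C (cbox 0 (\<Sum>B))"
    by (rule combinatorial_cubeE[OF assms(1)])
  show ?thesis
    using combinatorial_cubeI[OF assms(2) B(1)
        combinatorially_equivalent_trans[OF combinatorially_equivalent_sym[OF assms(3)] B(3)]] B(2)
    by simp
qed

lemma combinatorial_cube_projective_image:
  fixes f :: "'a::euclidean_space \<Rightarrow> 'a"
  assumes "combinatorial_cube k C" "affine_map f" "affine_map r" "\<And>x. x \<in> C \<Longrightarrow> 0 < r x"
    and "inj_on (\<lambda>x. (1 / r x) *\<^sub>R f x) C"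
  shows "combinatorial_cube k ((\<lambda>x. (1 / r x) *\<^sub>R f x) ` C)"
proof -
  have C: "polytope C"
    using assms(1) combinatorial_cube_polytope by blast
  then have pm: "projective_map C f r"
    using assms by unfold_locales (auto simp: polytope_imp_convex)
  then interpret projective_map C f r .
  have "g = (\<lambda>x. (1 / r x) *\<^sub>R f x)"
    by (simp add: fun_eq_iff g_def)
  then show ?thesis
    using combinatorial_cube_equivalent[OF assms(1) polytope_image[OF C]
        combinatorially_equivalent_projective_image[OF pm]] assms(5) by simp
qed

lemma combinatorial_cube_affine_image:
  fixes f :: "'a::euclidean_space \<Rightarrow> 'a"
  assumes "combinatorial_cube k C" "affine_map f" "inj_on f C"
  shows "combinatorial_cube k (f ` C)"
  using combinatorial_cube_projective_image[OF assms(1,2) affine_map_const[of 1]] assms(3) by simp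

subsection \<open>Truncated pyramids over cubes\<close>

text \<open>Parametrized by rays from q rather than as a convex hull, since an affine function that
  vanishes at q is multiplied by l along such a ray.\<close>

definition truncated_cone :: "'a::real_vector \<Rightarrow> 'a set \<Rightarrow> ('a \<Rightarrow> real) \<Rightarrow> 'a set" where
  "truncated_cone q F \<kappa> = {q + l *\<^sub>R (v - q) |v l. v \<in> F \<and> 0 \<le> l \<and> l \<le> 1 \<and> 0 \<le> \<kappa> (q + l *\<^sub>R (v - q))}"

lemma mem_truncated_cone:
  "x \<in> truncated_cone q F \<kappa> \<longleftrightarrow>
    (\<exists>v\<in>F. \<exists>l. 0 \<le> l \<and> l \<le> 1 \<and> x = q + l *\<^sub>R (v - q)) \<and> 0 \<le> \<kappa> x"
  unfolding truncated_cone_def by blast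

text \<open>Dividing by \<open>\<kappa>\<close> moves the intersection of the base with the truncating hyperplane to
  infinity; from there the truncated cone is a projective image of a prism.\<close>

lemma combinatorial_cube_truncated_cone:
  fixes F :: "'a::euclidean_space set" and \<gamma> \<kappa> :: "'a \<Rightarrow> real"
  assumes F: "combinatorial_cube k F"
    and \<gamma>: "affine_map \<gamma>" "\<And>v. v \<in> F \<Longrightarrow> \<gamma> v = c" "\<gamma> q \<noteq> c"
    and \<kappa>: "affine_map \<kappa>" "\<And>v. v \<in> F \<Longrightarrow> 0 < \<kappa> v" "\<kappa> q < 0"
  shows "combinatorial_cube (Suc k) (truncated_cone q F \<kappa>)"
proof -
  obtain B :: "'a set" where B: "B \<subseteq> Basis" "card B = k" "combinatorially_equivalent F (cbox 0 (\<Sum>B))"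
    by (rule combinatorial_cubeE[OF F])
  have poly: "polytope F"
    by (rule combinatorial_cube_polytope[OF F])
  have conv: "convex F"
    using poly polytope_imp_convex by blast
  \<comment> \<open>The apex lies off a hyperplane containing F, so F is not full-dimensional and
    some basis vector b is free for the additional direction of the cube.\<close>
  have "q \<notin> affine hull F"
    using affine_map_eq_on_affine_hull[of \<gamma> "\<lambda>x. c" F q] affine_map_const \<gamma> by blast
  then have "aff_dim F \<noteq> DIM('a)"
    by (auto simp: aff_dim_eq_full)
  then have "B \<noteq> Basis"
    using combinatorial_cube_aff_dim[OF F] B(2) by auto
  then obtain b where b: "b \<in> Basis" "b \<notin> B"
    using B(1) by blast
  \<comment> \<open>Keeping \<open>1 / \<kappa> v\<close> as an extra coordinate makes the
    denominator of the second projective map affine on the prism over E.\<close>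
  interpret p1: projective_map F "\<lambda>v. (v, 1::real)" \<kappa>
    using conv \<kappa> by unfold_locales (auto intro!: affine_map_intros)
  define E where "E = p1.g ` F"
  have g1: "p1.g v = ((1 / \<kappa> v) *\<^sub>R v, 1 / \<kappa> v)" for v
    by (simp add: p1.g_def)
  have "inj_on p1.g F"
    by (rule inj_onI) (use \<kappa>(2) in \<open>force simp: g1\<close>)
  then have FE: "combinatorially_equivalent F E"
    unfolding E_def
    by (intro combinatorially_equivalent_projective_image) unfold_locales
  have pE: "polytope E"
    unfolding E_def by (rule p1.polytope_image[OF poly])
  define w where "w = - \<kappa> q"
  have w: "0 < w"
    using \<kappa>(3) by (simp add: w_def)
  let ?C = "E \<times> {0..1::real}"
  let ?f = "\<lambda>z::('a \<times> real) \<times> real. w *\<^sub>R fst (fst z) + snd z *\<^sub>R q"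
  let ?r = "\<lambda>z::('a \<times> real) \<times> real. w * snd (fst z) + snd z"
  have pC: "polytope ?C"
    using pE polytope_interval[of 0 "1::real"] by (intro polytope_Times) (simp_all add: cbox_interval)
  interpret p2: projective_map ?C ?f ?r
  proof
    show "convex ?C"
      using pC polytope_imp_convex by blast
    show "affine_map ?f" "affine_map ?r"
      by (intro affine_map_intros)+
    fix z assume "z \<in> ?C"
    then have "snd (fst z) > 0" "snd z \<ge> 0"
      using \<kappa>(2) by (auto simp: E_def g1)
    then show "0 < ?r z"
      using w by (simp add: add_pos_nonneg)
  qed
  \<comment> \<open>Ray parameter of the image of the prism point at height s: s = 0 gives v itself,
    s = 1 the point between q and v where \<open>\<kappa>\<close> vanishes.\<close>
  define L where "L v s = w / (w + s * \<kappa> v)" for v s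
  have L: "0 < L v s" "L v s \<le> 1" if "v \<in> F" "0 \<le> s" for v s
    using that w \<kappa>(2)[OF that(1)] by (auto simp: L_def add_pos_nonneg)
  have g2: "p2.g (p1.g v, s) = q + L v s *\<^sub>R (v - q)" if "v \<in> F" "0 \<le> s" for v s
  proof -
    have pos: "0 < \<kappa> v" "0 < w + s * \<kappa> v"
      using \<kappa>(2)[OF that(1)] w that(2) by (auto simp: add_pos_nonneg)
    have r: "?r (p1.g v, s) = (w + s * \<kappa> v) / \<kappa> v"
      using pos by (simp add: g1 field_simps)
    have "p2.g (p1.g v, s) = (\<kappa> v / (w + s * \<kappa> v)) *\<^sub>R ((w / \<kappa> v) *\<^sub>R v + s *\<^sub>R q)"
      unfolding p2.g_def r by (simp add: g1)
    also have "\<dots> = (w / (w + s * \<kappa> v)) *\<^sub>R v + (s * \<kappa> v / (w + s * \<kappa> v)) *\<^sub>R q"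
      using pos by (simp add: scaleR_add_right mult.commute)
    also have "s * \<kappa> v / (w + s * \<kappa> v) = 1 - L v s"
      using pos by (simp add: L_def field_simps)
    finally show ?thesis
      by (simp add: L_def algebra_simps)
  qed
  \<comment> \<open>The increment of \<open>\<gamma>\<close> from q is a nonzero multiple of l, so
    the ray parameter can be read off from a point; injectivity follows from this.\<close>
  have \<gamma>L: "\<gamma> (q + l *\<^sub>R (v - q)) - \<gamma> q = l * (c - \<gamma> q)" if "v \<in> F" for v l
    using affine_map_ray[OF \<gamma>(1), of q l v] \<gamma>(2)[OF that] by (simp add: algebra_simps)
  have "inj_on p2.g ?C"
  proof (rule inj_onI)
    fix x y assume x: "x \<in> ?C" and y: "y \<in> ?C" and eq: "p2.g x = p2.g y"
    obtain u s where u: "x = (p1.g u, s)" "u \<in> F" "0 \<le> s"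
      using x by (auto simp: E_def)
    obtain v t where v: "y = (p1.g v, t)" "v \<in> F" "0 \<le> t"
      using y by (auto simp: E_def)
    have 1: "q + L u s *\<^sub>R (u - q) = q + L v t *\<^sub>R (v - q)"
      using eq g2 u v by simp
    then have 2: "L u s = L v t"
      using \<gamma>L[OF u(2), of "L u s"] \<gamma>L[OF v(2), of "L v t"] \<gamma>(3) by simp
    then have "u = v"
      using 1 L[OF u(2,3)] by simp
    moreover have "s = t"
    proof -
      have "w + s * \<kappa> v > 0" "w + t * \<kappa> v > 0"
        using w \<kappa>(2)[OF v(2)] u v by (auto simp: add_pos_nonneg)
      then show ?thesis
        using 2 w \<kappa>(2)[OF v(2)] \<open>u = v\<close> by (simp add: L_def field_simps)
    qed
    ultimately show "x = y"
      using u v by simp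
  qed
  then have C2: "combinatorially_equivalent ?C (p2.g ` ?C)"
    by (intro combinatorially_equivalent_projective_image) unfold_locales
  have \<kappa>L: "\<kappa> (q + l *\<^sub>R (v - q)) = l * \<kappa> v - (1 - l) * w" for v l
    using affine_map_ray[OF \<kappa>(1), of q l v] by (simp add: w_def)
  have im: "p2.g ` ?C = truncated_cone q F \<kappa>"
  proof (intro equalityI subsetI)
    fix x assume "x \<in> p2.g ` ?C"
    then obtain v s where v: "x = q + L v s *\<^sub>R (v - q)" "v \<in> F" "0 \<le> s" "s \<le> 1"
      using g2 by (auto simp: E_def)
    have pos: "0 < \<kappa> v" "0 < w + s * \<kappa> v"
      using \<kappa>(2)[OF v(2)] w v(3) by (auto simp: add_pos_nonneg)
    have 1: "1 - L v s = s * \<kappa> v / (w + s * \<kappa> v)"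
      using pos by (simp add: L_def field_simps)
    have "L v s * \<kappa> v - (1 - L v s) * w = w * \<kappa> v * (1 - s) / (w + s * \<kappa> v)"
      unfolding 1 by (simp add: L_def right_diff_distrib diff_divide_distrib mult.commute mult.left_commute)
    then have "0 \<le> \<kappa> x"
      using pos w v by (simp add: \<kappa>L)
    then show "x \<in> truncated_cone q F \<kappa>"
      unfolding mem_truncated_cone using v L[OF v(2,3)] less_imp_le by blast
  next
    fix x assume "x \<in> truncated_cone q F \<kappa>"
    then obtain v l where v: "v \<in> F" "0 \<le> l" "l \<le> 1" "x = q + l *\<^sub>R (v - q)" "0 \<le> \<kappa> x"
      unfolding mem_truncated_cone by blast
    have \<kappa>v: "0 < \<kappa> v"
      by (rule \<kappa>(2)[OF v(1)])
    have le: "(1 - l) * w \<le> l * \<kappa> v"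
      using v(4,5) by (simp add: \<kappa>L)
    have l: "0 < l"
      using le w v(2) by (cases "l = 0") auto
    \<comment> \<open>Solves \<open>L v s = l\<close>; the condition
      \<open>0 \<le> \<kappa> x\<close> turns into \<open>s \<le> 1\<close>.\<close>
    define s where "s = (1 - l) * w / (l * \<kappa> v)"
    have s: "0 \<le> s" "s \<le> 1"
      using le l w \<kappa>v v by (simp_all add: s_def)
    have "w + s * \<kappa> v = w / l"
      using l \<kappa>v by (simp add: s_def field_simps)
    then have "L v s = l"
      using w l by (simp add: L_def)
    then have "x = p2.g (p1.g v, s)"
      using g2[OF v(1) s(1)] v(4) by simp
    then show "x \<in> p2.g ` ?C"
      using s v(1) by (auto simp: E_def)
  qed
  have "combinatorially_equivalent ?C (cbox 0 (\<Sum>B) \<times> {0..1::real})"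
    by (intro combinatorially_equivalent_Times
        combinatorially_equivalent_trans[OF combinatorially_equivalent_sym[OF FE] B(3)])
  then have "combinatorially_equivalent ?C (cbox 0 (\<Sum>(insert b B)))"
    by (rule combinatorially_equivalent_trans)
      (rule combinatorially_equivalent_std_cube_insert[OF B(1) b])
  then have "combinatorially_equivalent (truncated_cone q F \<kappa>) (cbox 0 (\<Sum>(insert b B)))"
    by (rule combinatorially_equivalent_trans[OF combinatorially_equivalent_sym[OF C2[unfolded im]]])
  moreover have "polytope (truncated_cone q F \<kappa>)"
    using p2.polytope_image[OF pC] unfolding im .
  moreover have "card (insert b B) = Suc k"
    using B b finite_subset[OF B(1) finite_Basis] by simp
  moreover have "insert b B \<subseteq> Basis"
    using B(1) b(1) by simp
  ultimately show ?thesis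
    using combinatorial_cubeI by metis
qed

subsection \<open>Subdivisions induced by a maximum of affine functions\<close>

locale max_subdivision =
  fixes P :: "'a::euclidean_space set" and LL :: "('a \<Rightarrow> real) set" and z0 :: real
  assumes finite_LL: "finite LL" and LL_nonempty: "LL \<noteq> {}"
    and affine_LL: "\<And>f. f \<in> LL \<Longrightarrow> affine_map f"
    and convex_P: "convex P"
begin

definition M where "M x = Max ((\<lambda>f. f x) ` LL)"

definition \<phi> where "\<phi> x = z0 - M x"

definition cell where "cell f = {x \<in> P. \<forall>g\<in>LL. g x \<le> f x}"

definition cells where "cells = {T. \<exists>f\<in>LL. T face_of cell f}"

lemma M_ge: "f \<in> LL \<Longrightarrow> f x \<le> M x"
  by (simp add: M_def finite_LL)

lemma M_attained: "\<exists>f\<in>LL. M x = f x"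
proof -
  have "M x \<in> (\<lambda>f. f x) ` LL"
    unfolding M_def using finite_LL LL_nonempty by (intro Max_in) auto
  then show ?thesis
    by blast
qed

lemma M_le_iff: "M x \<le> c \<longleftrightarrow> (\<forall>f\<in>LL. f x \<le> c)"
  by (simp add: M_def finite_LL LL_nonempty)

lemma mem_cell: "f \<in> LL \<Longrightarrow> x \<in> cell f \<longleftrightarrow> x \<in> P \<and> M x = f x"
  using M_ge[of f x] M_le_iff[of x "f x"] by (auto simp: cell_def)

lemma Union_cell: "(\<Union>f\<in>LL. cell f) = P"
proof
  show "(\<Union>f\<in>LL. cell f) \<subseteq> P"
    by (auto simp: cell_def)
  show "P \<subseteq> (\<Union>f\<in>LL. cell f)"
    using M_attained mem_cell by blast
qed

lemma concave_\<phi>: "concave_on P \<phi>"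
  unfolding concave_on_iff
proof (intro conjI ballI allI impI convex_P)
  fix x y and u v :: real
  assume *: "x \<in> P" "y \<in> P" "0 \<le> u" "0 \<le> v" "u + v = 1"
  obtain f where f: "f \<in> LL" "M (u *\<^sub>R x + v *\<^sub>R y) = f (u *\<^sub>R x + v *\<^sub>R y)"
    using M_attained by blast
  have u: "u = 1 - v"
    using * by simp
  have "M (u *\<^sub>R x + v *\<^sub>R y) = u * f x + v * f y"
    using f(2) affine_mapD_real[OF affine_LL[OF f(1)], of v x y] by (simp add: u)
  also have "\<dots> \<le> u * M x + v * M y"
    using M_ge[OF f(1)] * by (intro add_mono mult_left_mono)
  finally show "u * \<phi> x + v * \<phi> y \<le> \<phi> (u *\<^sub>R x + v *\<^sub>R y)"
    by (simp add: \<phi>_def u algebra_simps)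
qed

text \<open>At a relative interior point of \<open>D\<close> some \<open>f \<in> LL\<close> attains the maximum, and the affine
  function \<open>M - f \<ge> 0\<close> on \<open>D\<close> vanishes there, hence on all of \<open>D\<close>.\<close>

lemma affine_part_in_cell:
  assumes "D \<subseteq> P" "convex D" "affine_fun_on D \<phi>"
  shows "\<exists>f\<in>LL. D \<subseteq> cell f"
proof (cases "D = {}")
  case True
  then show ?thesis
    using LL_nonempty by blast
next
  case False
  then obtain x0 where x0: "x0 \<in> rel_interior D"
    using assms(2) rel_interior_eq_empty by blast
  then have x0D: "x0 \<in> D"
    using rel_interior_subset by blast
  obtain h where h: "affine_map h" "\<And>x. x \<in> D \<Longrightarrow> \<phi> x = h x"
    using affine_fun_on_affine_map[OF assms(3)] by blast
  obtain f where f: "f \<in> LL" "M x0 = f x0"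
    using M_attained by blast
  define k where "k x = z0 - h x - f x" for x
  have k: "affine_map k"
    unfolding k_def using h(1) affine_LL[OF f(1)] by (intro affine_map_intros)
  have kM: "k x = M x - f x" if "x \<in> D" for x
    using h(2)[OF that] by (simp add: k_def \<phi>_def)
  have "D \<subseteq> cell f"
  proof
    fix y assume y: "y \<in> D"
    then have "y \<in> affine hull D"
      by (simp add: hull_inc)
    then obtain m where m: "m > 1" "\<forall>e. e > 1 \<and> e \<le> m \<longrightarrow> (1 - e) *\<^sub>R y + e *\<^sub>R x0 \<in> D"
      using convex_rel_interior_if[OF assms(2) x0] by blast
    then have w: "(1 - m) *\<^sub>R y + m *\<^sub>R x0 \<in> D"
      by simp
    have "0 \<le> k ((1 - m) *\<^sub>R y + m *\<^sub>R x0)"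
      using kM[OF w] M_ge[OF f(1)] by simp
    also have "\<dots> = (1 - m) * k y"
      using kM[OF x0D] f(2) by (simp add: affine_mapD_real[OF k])
    finally have "k y \<le> 0"
      using m(1) by (simp add: zero_le_mult_iff)
    then have "M y = f y"
      using kM[OF y] M_ge[OF f(1), of y] by simp
    then show "y \<in> cell f"
      using mem_cell[OF f(1)] y assms(1) by blast
  qed
  then show ?thesis
    using f(1) by blast
qed

end

section \<open>Maxima of affine functions with cubical regions\<close>

locale max_cubification = max_subdivision +
  assumes cube_cell: "\<And>f. f \<in> LL \<Longrightarrow> combinatorial_cube DIM('a) (cell f)"
begin

lemma polytope_cell: "f \<in> LL \<Longrightarrow> polytope (cell f)"
  using cube_cell combinatorial_cube_polytope by blast

lemma convex_cell: "f \<in> LL \<Longrightarrow> convex (cell f)"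
  using polytope_cell polytope_imp_convex by blast

text \<open>A cell is full-dimensional and therefore determines its affine function. This makes the
  regions maximal and pairwise incomparable.\<close>

lemma cell_subset_imp_eq:
  assumes "f \<in> LL" "g \<in> LL" "cell f \<subseteq> cell g"
  shows "f = g"
proof
  fix x
  have "aff_dim (cell f) = DIM('a)"
    using combinatorial_cube_aff_dim[OF cube_cell[OF assms(1)]] .
  then have "x \<in> affine hull cell f"
    by (simp add: aff_dim_eq_full)
  moreover have "f y = g y" if "y \<in> cell f" for y
    using that assms mem_cell by (metis subsetD)
  ultimately show "f x = g x"
    using affine_map_eq_on_affine_hull affine_LL assms(1,2) by metis
qed

text \<open>On \<open>cell f\<close> the difference \<open>g - f\<close> is at most 0, and it
  vanishes exactly on the intersection.\<close>

lemma cell_Int_face: 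
  assumes "f \<in> LL" "g \<in> LL"
  shows "cell f \<inter> cell g face_of cell f"
proof -
  have "cell f \<inter> cell g = {x \<in> cell f. g x - f x = 0}"
    using mem_cell[OF assms(1)] mem_cell[OF assms(2)] by auto
  also have "\<dots> face_of cell f"
    using assms affine_LL
    by (intro face_of_affine_eq convex_cell affine_map_diff) (auto simp: cell_def)
  finally show ?thesis .
qed

text \<open>The comparison takes place in the common face of the two regions:
  \<open>T \<inter> cell f\<close> is a face of \<open>cell f \<inter> cell g\<close> and hence of
  \<open>cell f\<close>.\<close>

lemma cells_Int_face:
  assumes "S \<in> cells" "T \<in> cells"
  shows "S \<inter> T face_of S"
proof -
  obtain f g where f: "f \<in> LL" "S face_of cell f" and g: "g \<in> LL" "T face_of cell g"
    using assms by (auto simp: cells_def)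
  have T: "T \<inter> cell f face_of cell f"
  proof -
    have "cell g \<inter> cell f face_of cell g"
      by (rule cell_Int_face[OF g(1) f(1)])
    then have "T \<inter> (cell g \<inter> cell f) face_of cell g"
      using g(2) face_of_Int by blast
    moreover have "T \<inter> (cell g \<inter> cell f) = T \<inter> cell f"
      using g(2) face_of_imp_subset by blast
    ultimately have "T \<inter> cell f face_of cell g"
      by simp
    then have "T \<inter> cell f face_of cell f \<inter> cell g"
      by (rule face_of_subset) (use g(2) face_of_imp_subset in blast)+
    then show ?thesis
      using cell_Int_face[OF f(1) g(1)] face_of_trans by blast
  qed
  then have "S \<inter> (T \<inter> cell f) face_of cell f"
    using f(2) face_of_Int by blast
  moreover have "S \<inter> (T \<inter> cell f) = S \<inter> T"
    using f(2) face_of_imp_subset by blast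
  ultimately show ?thesis
    using f(2) face_of_imp_subset by (metis face_of_subset inf_le1)
qed

lemma cell_in_cells: "f \<in> LL \<Longrightarrow> cell f \<in> cells"
  using convex_cell face_of_refl by (auto simp: cells_def)

lemma polytopal_complex_cells: "polytopal_complex cells"
  unfolding polytopal_complex_def
proof (intro conjI ballI allI impI)
  have "cells = (\<Union>f\<in>LL. {T. T face_of cell f})"
    by (auto simp: cells_def)
  then show "finite cells"
    using finite_LL polytope_cell by (auto intro: finite_polytope_faces)
  show "polytope C" if "C \<in> cells" for C
    using that polytope_cell face_of_polytope_polytope by (auto simp: cells_def)
  show "F \<in> cells" if "C \<in> cells" "F face_of C" for C F
    using that face_of_trans by (auto simp: cells_def)
  show "C \<inter> D face_of C" "C \<inter> D face_of D" if "C \<in> cells" "D \<in> cells" for C D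
    using cells_Int_face that by (metis inf_commute)+
qed

lemma Union_cells: "\<Union>cells = P"
proof
  show "\<Union>cells \<subseteq> P"
    using Union_cell face_of_imp_subset by (fastforce simp: cells_def)
  show "P \<subseteq> \<Union>cells"
    using Union_cell cell_in_cells by fast
qed

lemma polytopal_subdivision_cells: "polytopal_subdivision cells P"
proof -
  have "\<Union>{F. F face_of P} = P"
    using convex_P face_of_refl face_of_imp_subset by fastforce
  then show ?thesis
    unfolding polytopal_subdivision_def subdivision_of_def
    using polytopal_complex_cells Union_cells convex_P face_of_refl by fastforce
qed

lemma cubical_complex_cells: "cubical_complex cells"
  unfolding cubical_complex_def
  using polytopal_complex_cells cube_cell combinatorial_cube_face by (auto simp: cells_def)

lemma complex_facets_cells: "complex_facets cells = cell ` LL"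
proof (intro equalityI subsetI)
  fix C assume C: "C \<in> complex_facets cells"
  then obtain f where f: "f \<in> LL" "C face_of cell f"
    by (auto simp: complex_facets_def cells_def)
  then have "cell f = C"
    using C cell_in_cells face_of_imp_subset by (fastforce simp: complex_facets_def)
  then show "C \<in> cell ` LL"
    using f(1) by blast
next
  fix C assume "C \<in> cell ` LL"
  then obtain f where f: "f \<in> LL" "C = cell f"
    by blast
  have "D = C" if D: "D \<in> cells" "C \<subseteq> D" for D
  proof -
    obtain g where g: "g \<in> LL" "D face_of cell g"
      using D(1) by (auto simp: cells_def)
    then have "D \<subseteq> cell g"
      using face_of_imp_subset by blast
    then have "f = g"
      using cell_subset_imp_eq f g(1) D(2) by blast
    then show ?thesis
      using D f \<open>D \<subseteq> cell g\<close> by blast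
  qed
  then show "C \<in> complex_facets cells"
    using f cell_in_cells by (auto simp: complex_facets_def)
qed

text \<open>Every convex set on which \<open>\<phi>\<close> is affine lies in one region, and no
  region contains another one.\<close>

lemma domains_cells: "domains_of_linearity P \<phi> = cell ` LL"
proof -
  have ok: "cell f \<subseteq> P" "convex (cell f)" "affine_fun_on (cell f) \<phi>" if "f \<in> LL" for f
  proof -
    show "cell f \<subseteq> P"
      by (auto simp: cell_def)
    show "convex (cell f)"
      by (rule convex_cell[OF that])
    have "affine_fun_on (cell f) (\<lambda>x. z0 - f x)"
      using affine_LL[OF that] by (intro affine_map_affine_fun_on affine_map_intros)
    moreover have "\<phi> x = z0 - f x" if "x \<in> cell f" for x
      using mem_cell[OF \<open>f \<in> LL\<close>] that by (simp add: \<phi>_def)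
    ultimately show "affine_fun_on (cell f) \<phi>"
      by (simp add: affine_fun_on_def)
  qed
  show ?thesis
  proof (intro equalityI subsetI)
    fix D assume "D \<in> domains_of_linearity P \<phi>"
    then have D: "D \<subseteq> P" "convex D" "affine_fun_on D \<phi>"
      "\<And>D'. D \<subseteq> D' \<Longrightarrow> D' \<subseteq> P \<Longrightarrow> convex D' \<Longrightarrow> affine_fun_on D' \<phi> \<Longrightarrow> D' = D"
      by (auto simp: domains_of_linearity_def)
    obtain f where f: "f \<in> LL" "D \<subseteq> cell f"
      using affine_part_in_cell[OF D(1-3)] by blast
    then show "D \<in> cell ` LL"
      using D(4)[OF f(2)] ok by blast
  next
    fix D assume "D \<in> cell ` LL"
    then obtain f where f: "f \<in> LL" "D = cell f"
      by blast
    have "D' = D" if D': "D \<subseteq> D'" "D' \<subseteq> P" "convex D'" "affine_fun_on D' \<phi>" for D'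
    proof -
      obtain g where g: "g \<in> LL" "D' \<subseteq> cell g"
        using affine_part_in_cell[OF D'(2-4)] by blast
      then have "f = g"
        using cell_subset_imp_eq f D'(1) by blast
      then show ?thesis
        using g f D' by blast
    qed
    then show "D \<in> domains_of_linearity P \<phi>"
      using ok[OF f(1)] f(2) by (auto simp: domains_of_linearity_def)
  qed
qed

text \<open>Only the boundary data remain to be matched; the other requirements hold for every
  maximum whose regions are cubes.\<close>

lemma lifted_cubification_cells:
  assumes "\<And>f T. f \<in> LL \<Longrightarrow> T face_of cell f \<Longrightarrow> T \<subseteq> frontier P \<Longrightarrow> T \<in> S"
    and "\<And>C. C \<in> S \<Longrightarrow> C \<subseteq> frontier P \<and> (\<exists>f\<in>LL. C face_of cell f)"
    and "\<And>x. x \<in> frontier P \<Longrightarrow> \<phi> x = \<psi> x"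
  shows "lifted_cubification P S \<psi> cells \<phi>"
  unfolding lifted_cubification_def
proof (intro conjI ballI)
  show "boundary_complex cells = S"
    unfolding boundary_complex_def restrict_complex_def Union_cells
    using assms(1,2) by (auto simp: cells_def)
qed (use polytopal_subdivision_cells cubical_complex_cells complex_facets_cells cube_cell
    concave_\<phi> domains_cells assms(3) in auto)

end

subsection \<open>The hexhoop construction\<close>

text \<open>The increment along v is the same everywhere, so the slope may be measured at any y, for
  instance at a zero of f.\<close>

lemma affine_map_add_scaleR:
  fixes f :: "'a::euclidean_space \<Rightarrow> real"
  assumes "affine_map f"
  shows "f (x + s *\<^sub>R v) = f x + s * (f (y + v) - f y)"
proof -
  obtain c k where "f = (\<lambda>x. c \<bullet> x + k)"
    using affine_map_eq_inner[OF assms] by blast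
  then show ?thesis
    by (simp add: inner_add_right)
qed

lemma interior_ray:
  fixes P :: "'a::euclidean_space set"
  assumes "convex P" "c \<in> interior P" "v \<in> P" "0 \<le> l" "l < 1"
  shows "c + l *\<^sub>R (v - c) \<in> interior P"
  using mem_interior_convex_shrink[OF assms(1-3), of "1 - l"] assms(4,5)
  by (simp add: algebra_simps)

text \<open>For l > 1 the frontier point v would arise from a point of P by shrinking towards the
  interior point c, and so be interior.\<close>

lemma ray_parameter_le_one:
  fixes P :: "'a::euclidean_space set"
  assumes "convex P" "c \<in> interior P" "v \<in> frontier P" "0 < l" "c + l *\<^sub>R (v - c) \<in> P"
  shows "l \<le> 1"
proof (rule ccontr)
  assume "\<not> l \<le> 1"
  then have "c + (1 / l) *\<^sub>R ((c + l *\<^sub>R (v - c)) - c) \<in> interior P"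
    using assms by (intro interior_ray) auto
  then show False
    using assms(3,4) by (simp add: frontier_def)
qed

lemma ray_to_frontier_point:
  fixes P :: "'a::euclidean_space set"
  assumes "bounded P" "c \<in> interior P" "y \<noteq> c"
  obtains v l where "v \<in> frontier P" "0 < l" "y = c + l *\<^sub>R (v - c)"
proof -
  obtain d where d: "0 < d" "c + d *\<^sub>R (y - c) \<in> frontier P"
    using ray_to_frontier[OF assms(1,2), of "y - c"] assms(3) by auto
  then show ?thesis
    using that[of "c + d *\<^sub>R (y - c)" "1 / d"] by simp
qed

section \<open>Reflection in a hyperplane\<close>

locale reflection =
  fixes a :: "'a::euclidean_space" and b :: real
  assumes a_nonzero: "a \<noteq> 0"
begin

abbreviation \<sigma> where "\<sigma> \<equiv> hyperplane_reflection a b"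

text \<open>Signed height over H in units of \<open>a\<close>, not of length: adding
  \<open>s *\<^sub>R a\<close> raises it by s.\<close>

definition \<tau> where "\<tau> x = (a \<bullet> x - b) / (a \<bullet> a)"

lemma aa: "0 < a \<bullet> a"
  using a_nonzero by simp

lemma affine_\<tau>: "affine_map \<tau>"
proof -
  have "affine_map (\<lambda>x. (a \<bullet> x - b) / (a \<bullet> a))"
    by (intro affine_map_intros)
  moreover have "\<tau> = (\<lambda>x. (a \<bullet> x - b) / (a \<bullet> a))"
    by (simp add: fun_eq_iff \<tau>_def)
  ultimately show ?thesis
    by simp
qed

lemma \<tau>_shift: "\<tau> (x + s *\<^sub>R a) = \<tau> x + s"
  using aa by (simp add: \<tau>_def inner_add_right field_simps)

lemma \<sigma>_eq: "\<sigma> x = x + (- 2 * \<tau> x) *\<^sub>R a"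
  by (simp add: hyperplane_reflection_def \<tau>_def minus_divide_left flip: scaleR_minus_left)

lemma \<tau>_\<sigma>: "\<tau> (\<sigma> x) = - \<tau> x"
  by (simp only: \<sigma>_eq \<tau>_shift)

lemma \<sigma>_\<sigma>: "\<sigma> (\<sigma> x) = x"
proof -
  have "\<sigma> (\<sigma> x) = \<sigma> x + (2 * \<tau> x) *\<^sub>R a"
    by (simp add: \<sigma>_eq[of "\<sigma> x"] \<tau>_\<sigma>)
  also have "\<dots> = x"
    by (simp add: \<sigma>_eq[of x])
  finally show ?thesis .
qed

lemma affine_\<sigma>: "affine_map \<sigma>"
proof -
  have "affine_map (\<lambda>x. x - (2 * ((a \<bullet> x - b) / (a \<bullet> a))) *\<^sub>R a)"
    by (intro affine_map_intros)
  then show ?thesis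
    by (simp add: hyperplane_reflection_def[abs_def])
qed

lemma inj_\<sigma>: "inj \<sigma>"
  by (rule inj_on_inverseI[of _ \<sigma>]) (simp add: \<sigma>_\<sigma>)

lemma \<tau>_nonneg: "0 \<le> \<tau> x \<longleftrightarrow> b \<le> a \<bullet> x"
  using pos_le_divide_eq[OF aa, of 0 "a \<bullet> x - b"] by (simp add: \<tau>_def)

lemma \<tau>_zero: "\<tau> x = 0 \<longleftrightarrow> a \<bullet> x = b"
  using aa by (simp add: \<tau>_def)

lemma projective_map_\<sigma>:
  assumes "convex C"
  shows "projective_map C \<sigma> (\<lambda>x. 1)" "projective_map.g \<sigma> (\<lambda>x. 1) = \<sigma>"
  using affine_image_projective_map[OF assms affine_\<sigma>] by auto

lemma inj_on_\<sigma>: "inj_on \<sigma> C"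
  using inj_\<sigma> inj_on_subset by blast

lemma face_of_\<sigma>_image:
  assumes "convex C" "K face_of \<sigma> ` C"
  obtains K' where "K' face_of C" "K = \<sigma> ` K'"
  using projective_map.faces_of_image[OF projective_map_\<sigma>(1)[OF assms(1)]] assms(2)
    inj_on_\<sigma> projective_map_\<sigma>(2)[OF assms(1)] by metis

lemma \<sigma>_image_face_of:
  assumes "convex C" "K face_of C"
  shows "\<sigma> ` K face_of \<sigma> ` C"
  using projective_map.face_of_image_iff[OF projective_map_\<sigma>(1)[OF assms(1)], of K] assms(2)
    inj_on_\<sigma> projective_map_\<sigma>(2)[OF assms(1)] face_of_imp_subset by metis

end

text \<open>Separates the geometry of the maximum from the choice of the constant: that
  \<open>z0\<close> is large enters only through \<open>g_le\<close>, \<open>g_eq\<close>,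
  \<open>m_le\<close>, \<open>m_eq\<close> and \<open>z0_large\<close>. The equality cases
  \<open>g_eq\<close> and \<open>m_eq\<close> locate the points where an affine function touches the
  lifted boundary.\<close>

locale hexhoop = reflection a b for a :: "'a::euclidean_space" and b :: real +
  fixes P :: "'a set" and S :: "'a set set" and \<psi> :: "'a \<Rightarrow> real"
    and p :: 'a and T z0 :: real and FF GG :: "'a set set" and g m :: "'a set \<Rightarrow> 'a \<Rightarrow> real"
  assumes polytope_P: "polytope P" and p: "a \<bullet> p = b" and T_pos: "0 < T"
    and q_interior: "p + T *\<^sub>R a \<in> interior P" and q'_interior: "p - T *\<^sub>R a \<in> interior P"
    and \<sigma>_P: "\<sigma> ` P = P"
    and \<sigma>_S: "\<And>C. C \<in> S \<Longrightarrow> \<sigma> ` C \<in> S"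
    and \<psi>_\<sigma>: "\<And>x. x \<in> frontier P \<Longrightarrow> \<psi> (\<sigma> x) = \<psi> x"
    and complex_S: "polytopal_complex S" and Union_S: "\<Union>S = frontier P"
    and FF_S: "FF \<subseteq> S" and GG_S: "GG \<subseteq> S"
    and cube_FF: "\<And>F. F \<in> FF \<Longrightarrow> combinatorial_cube (DIM('a) - 1) F"
    and cube_GG: "\<And>G. G \<in> GG \<Longrightarrow> 2 \<le> DIM('a) \<and> combinatorial_cube (DIM('a) - 2) G"
    and FF_above: "\<And>F x. F \<in> FF \<Longrightarrow> x \<in> F \<Longrightarrow> b \<le> a \<bullet> x"
    and FF_strictly_above: "\<And>F. F \<in> FF \<Longrightarrow> \<exists>x\<in>F. b < a \<bullet> x"
    and FF_support: "\<And>F. F \<in> FF \<Longrightarrow> \<exists>\<gamma>. affine_map \<gamma> \<and> (\<forall>x\<in>F. \<gamma> x = 1) \<and>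
      (\<forall>x\<in>P. \<gamma> x \<le> (1::real)) \<and> (\<forall>x\<in>interior P. \<gamma> x < 1)"
    and GG_in_H: "\<And>G x. G \<in> GG \<Longrightarrow> x \<in> G \<Longrightarrow> a \<bullet> x = b"
    and GG_FF: "\<And>G. G \<in> GG \<Longrightarrow> \<exists>F\<in>FF. G \<subseteq> F"
    and FF_cover: "\<And>x. x \<in> frontier P \<Longrightarrow> b \<le> a \<bullet> x \<Longrightarrow> \<exists>F\<in>FF. x \<in> F"
    and GG_cover: "\<And>x. x \<in> frontier P \<Longrightarrow> a \<bullet> x = b \<Longrightarrow> \<exists>G\<in>GG. x \<in> G"
    and S_pure: "\<And>C. C \<in> S \<Longrightarrow> \<exists>F\<in>FF. C face_of F \<or> C face_of \<sigma> ` F"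
    and affine_g: "\<And>F. F \<in> FF \<Longrightarrow> affine_map (g F)"
    and g_q: "\<And>F. F \<in> FF \<Longrightarrow> g F (p + T *\<^sub>R a) = 0"
    and g_F: "\<And>F x. F \<in> FF \<Longrightarrow> x \<in> F \<Longrightarrow> g F x = z0 - \<psi> x"
    and g_le: "\<And>F x. F \<in> FF \<Longrightarrow> x \<in> frontier P \<Longrightarrow> g F x \<le> z0 - \<psi> x"
    and g_eq: "\<And>F x. F \<in> FF \<Longrightarrow> x \<in> frontier P \<Longrightarrow> g F x = z0 - \<psi> x \<Longrightarrow> x \<in> F"
    and affine_m: "\<And>G. G \<in> GG \<Longrightarrow> affine_map (m G)"
    and m_p: "\<And>G. G \<in> GG \<Longrightarrow> m G p = 0"
    and m_shift: "\<And>G x s. G \<in> GG \<Longrightarrow> m G (x + s *\<^sub>R a) = m G x"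
    and m_G: "\<And>G x. G \<in> GG \<Longrightarrow> x \<in> G \<Longrightarrow> m G x = z0 - \<psi> x"
    and m_le: "\<And>G x. G \<in> GG \<Longrightarrow> x \<in> frontier P \<Longrightarrow> m G x \<le> z0 - \<psi> x"
    and m_eq: "\<And>G x. G \<in> GG \<Longrightarrow> x \<in> frontier P \<Longrightarrow> m G x = z0 - \<psi> x \<Longrightarrow> x \<in> G"
    and z0_large: "\<And>x. x \<in> frontier P \<Longrightarrow> 1 < z0 - \<psi> x"
begin

definition q where "q = p + T *\<^sub>R a"
definition q' where "q' = p - T *\<^sub>R a"
definition \<eta> where "\<eta> x = z0 - \<psi> x"
text \<open>The slope of \<open>g F\<close> in direction \<open>a\<close>, since \<open>g F\<close>
  vanishes at \<open>q\<close>.\<close>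

definition e where "e F = g F (q + a)"
text \<open>The weights are chosen so that the mean of \<open>g F\<close> and 1 vanishes at
  \<open>q'\<close>, where \<open>g F\<close> has the value \<open>- (2 * T * e F)\<close>.\<close>

definition f where "f F x = (g F x + 2 * T * e F) / (1 + 2 * T * e F)"

lemma convex_P: "convex P" and bounded_P: "bounded P" and closed_P: "closed P"
  using polytope_P polytope_imp_convex polytope_imp_bounded polytope_imp_closed by auto

lemma frontier_P: "x \<in> frontier P \<longleftrightarrow> x \<in> P \<and> x \<notin> interior P"
  by (simp add: frontier_def closed_P)

lemma \<tau>_p: "\<tau> p = 0"
  by (simp add: \<tau>_def p)

lemma \<tau>_q: "\<tau> q = T"
  by (simp add: q_def \<tau>_shift \<tau>_p)

lemma \<tau>_q': "\<tau> q' = - T"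
  using \<tau>_shift[of p "- T"] by (simp add: q'_def \<tau>_p)

lemma \<sigma>_mem_P: "\<sigma> x \<in> P \<longleftrightarrow> x \<in> P"
  using \<sigma>_P \<sigma>_\<sigma> by (metis imageI)

lemma \<sigma>_frontier: "x \<in> frontier P \<Longrightarrow> \<sigma> x \<in> frontier P"
  using Union_S \<sigma>_S by (metis Union_iff imageI)

lemma q_int: "q \<in> interior P" and q'_int: "q' \<in> interior P"
  using q_interior q'_interior by (simp_all add: q_def q'_def)

lemma p_int: "p \<in> interior P"
proof -
  have "q + (1/2) *\<^sub>R (q' - q) \<in> interior P"
    by (rule interior_ray[OF convex_P q_int]) (use q'_int interior_subset in auto)
  moreover have "q + (1/2) *\<^sub>R (q' - q) = p"
    by (simp add: q_def q'_def algebra_simps flip: scaleR_add_left)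
  ultimately show ?thesis
    by simp
qed

lemma FF_frontier: "F \<in> FF \<Longrightarrow> x \<in> F \<Longrightarrow> x \<in> frontier P"
  and GG_frontier: "G \<in> GG \<Longrightarrow> x \<in> G \<Longrightarrow> x \<in> frontier P"
  using FF_S GG_S Union_S by auto

lemma FF_\<tau>: "F \<in> FF \<Longrightarrow> x \<in> F \<Longrightarrow> 0 \<le> \<tau> x"
  using FF_above \<tau>_nonneg by blast

lemma GG_\<tau>: "G \<in> GG \<Longrightarrow> x \<in> G \<Longrightarrow> \<tau> x = 0"
  using GG_in_H \<tau>_zero by blast

lemma g_shift: "F \<in> FF \<Longrightarrow> g F (x + s *\<^sub>R a) = g F x + s * e F"
  using affine_map_add_scaleR[OF affine_g, of F x s a q] g_q[of F] by (simp add: e_def q_def)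

lemma g_\<sigma>: "F \<in> FF \<Longrightarrow> g F (\<sigma> x) = g F x - 2 * \<tau> x * e F"
  by (simp only: \<sigma>_eq g_shift)

lemma g_p: "F \<in> FF \<Longrightarrow> g F p = - (T * e F)"
  using g_shift[of F p T] g_q[of F] by simp

lemma g_q': "F \<in> FF \<Longrightarrow> g F q' = - (2 * T * e F)"
  using g_shift[of F p "- T"] g_p[of F] by (simp add: q'_def)

lemma g_at_q: "F \<in> FF \<Longrightarrow> g F q = 0"
  using g_q by (simp add: q_def)

lemma m_\<sigma>: "G \<in> GG \<Longrightarrow> m G (\<sigma> x) = m G x"
  by (simp only: \<sigma>_eq m_shift)

lemma m_q: "G \<in> GG \<Longrightarrow> m G q = 0"
  by (simp add: q_def m_shift m_p)

lemma m_q': "G \<in> GG \<Longrightarrow> m G q' = 0"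
  using m_shift[of G p "- T"] by (simp add: q'_def m_p)

text \<open>A point x of F strictly above H has its mirror image outside F. There \<open>g F\<close>
  is strictly below \<open>z0 - \<psi>\<close>, while equality holds at x; as \<open>\<psi>\<close>
  is symmetric, \<open>g F\<close> increases along \<open>a\<close>.\<close>

lemma e_pos: assumes "F \<in> FF" shows "0 < e F"
proof -
  obtain x where x: "x \<in> F" "b < a \<bullet> x"
    using FF_strictly_above[OF assms] by blast
  have \<tau>: "0 < \<tau> x"
    using x(2) aa by (simp add: \<tau>_def)
  have fr: "x \<in> frontier P"
    using FF_frontier assms x(1) by blast
  have "\<sigma> x \<notin> F"
    using FF_\<tau>[OF assms, of "\<sigma> x"] \<tau> by (auto simp: \<tau>_\<sigma>)
  then have "g F (\<sigma> x) < z0 - \<psi> (\<sigma> x)"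
    using g_le[OF assms \<sigma>_frontier[OF fr]] g_eq[OF assms \<sigma>_frontier[OF fr]] by fastforce
  also have "\<dots> = g F x"
    using \<psi>_\<sigma>[OF fr] g_F[OF assms x(1)] by simp
  finally have "0 < 2 * \<tau> x * e F"
    by (simp add: g_\<sigma>[OF assms])
  then show ?thesis
    using \<tau> by (simp add: zero_less_mult_iff)
qed

lemma Te: "F \<in> FF \<Longrightarrow> 0 < T * e F"
  using e_pos T_pos by simp

lemma f_le_iff: "F \<in> FF \<Longrightarrow> f F x \<le> H \<longleftrightarrow> g F x + 2 * T * e F \<le> H * (1 + 2 * T * e F)"
  using Te[of F] by (simp add: f_def pos_divide_le_eq)

lemma affine_f: "F \<in> FF \<Longrightarrow> affine_map (f F)"
  unfolding f_def[abs_def] by (intro affine_map_intros affine_g)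

lemma f_le: "F \<in> FF \<Longrightarrow> g F x \<le> H \<Longrightarrow> 1 \<le> H \<Longrightarrow> f F x \<le> H"
  using Te[of F] mult_right_mono[of 1 H "2 * T * e F"] by (simp add: f_le_iff distrib_left)

lemma f_q': "F \<in> FF \<Longrightarrow> f F q' = 0"
  by (simp add: f_def g_q')

lemma f_q: "F \<in> FF \<Longrightarrow> 0 < f F q"
  using Te[of F] by (simp add: f_def g_at_q)

lemma f_eq_1: "F \<in> FF \<Longrightarrow> f F x = 1 \<longleftrightarrow> g F x = 1"
  using Te[of F] by (simp add: f_def)

lemma f_le_1: "F \<in> FF \<Longrightarrow> f F x \<le> 1 \<longleftrightarrow> g F x \<le> 1"
  by (simp add: f_le_iff)

lemma g_\<sigma>_le: "F \<in> FF \<Longrightarrow> 0 \<le> \<tau> x \<Longrightarrow> g F (\<sigma> x) \<le> g F x"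
  using e_pos[of F] by (simp add: g_\<sigma>)

text \<open>The reason why H bounds the f-cells: below H the mirror image of \<open>f F\<close> is
  larger.\<close>

lemma f_\<sigma>_le: "F \<in> FF \<Longrightarrow> f F (\<sigma> x) \<le> f F x \<longleftrightarrow> 0 \<le> \<tau> x"
  using Te[of F] e_pos[of F] by (simp add: f_def divide_le_cancel g_\<sigma> zero_le_mult_iff)

text \<open>The projection of x to H is \<open>p\<close> or lies on a ray from \<open>p\<close>
  inside H, which leaves P through a cell of GG. As x is arbitrary, \<open>\<nu>\<close> may exceed
  1.\<close>

lemma axis_cases:
  obtains (axis) "x = p + \<tau> x *\<^sub>R a"
  | (wall) G c \<nu> where "G \<in> GG" "c \<in> G" "0 < \<nu>" "x = (p + \<nu> *\<^sub>R (c - p)) + \<tau> x *\<^sub>R a"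
proof (cases "x + (- \<tau> x) *\<^sub>R a = p")
  case True
  then have "x = p + \<tau> x *\<^sub>R a"
    by auto
  then show ?thesis
    by (rule axis)
next
  case False
  then obtain v l where v: "v \<in> frontier P" "0 < l" "x + (- \<tau> x) *\<^sub>R a = p + l *\<^sub>R (v - p)"
    using ray_to_frontier_point[OF bounded_P p_int] by metis
  have "\<tau> (x + (- \<tau> x) *\<^sub>R a) = 0"
    by (simp only: \<tau>_shift)
  then have "l * \<tau> v = 0"
    unfolding v(3) by (simp add: affine_map_ray[OF affine_\<tau>] \<tau>_p)
  then have "a \<bullet> v = b"
    using v(2) \<tau>_zero by simp
  then obtain G where "G \<in> GG" "v \<in> G"
    using GG_cover v(1) by blast
  moreover have "x = (p + l *\<^sub>R (v - p)) + \<tau> x *\<^sub>R a"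
    using v(3) by (simp add: algebra_simps)
  ultimately show ?thesis
    using wall v(2) by blast
qed

lemma g_axis: "F \<in> FF \<Longrightarrow> g F (p + s *\<^sub>R a) = (s - T) * e F"
  by (simp add: g_shift g_p algebra_simps)

lemma g_wall: "F \<in> FF \<Longrightarrow> g F ((p + \<nu> *\<^sub>R (c - p)) + s *\<^sub>R a) = \<nu> * g F c + (s - (1 - \<nu>) * T) * e F"
  by (simp add: g_shift affine_map_ray[OF affine_g] g_p) (simp add: algebra_simps)

lemma m_wall: "G \<in> GG \<Longrightarrow> m G ((p + \<nu> *\<^sub>R (c - p)) + s *\<^sub>R a) = \<nu> * m G c"
  by (simp add: m_shift affine_map_ray[OF affine_m] m_p)

text \<open>The walls keep the rays from \<open>q\<close> that end below \<open>H\<close> out of the cells above \<open>H\<close>.\<close>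

lemma ray_through_F:
  assumes F: "F \<in> FF" and pos: "0 < g F y"
    and g_max: "\<And>F'. F' \<in> FF \<Longrightarrow> g F' y \<le> g F y"
    and m_max: "\<And>G. G \<in> GG \<Longrightarrow> m G y \<le> g F y"
  shows "\<exists>v\<in>F. \<exists>l>0. y = q + l *\<^sub>R (v - q) \<and> g F y = l * \<eta> v"
proof -
  have "y \<noteq> q"
    using pos g_at_q[OF F] by auto
  then obtain v l where v: "v \<in> frontier P" "0 < l" "y = q + l *\<^sub>R (v - q)"
    using ray_to_frontier_point[OF bounded_P q_int] by metis
  have gy: "g F' y = l * g F' v" if "F' \<in> FF" for F'
    unfolding v(3) by (simp add: affine_map_ray[OF affine_g[OF that]] g_at_q[OF that])
  have my: "m G y = l * m G v" if "G \<in> GG" for G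
    unfolding v(3) by (simp add: affine_map_ray[OF affine_m[OF that]] m_q[OF that])
  have gv: "g F' v \<le> g F v" if "F' \<in> FF" for F'
    using g_max[OF that] v(2) by (simp add: gy that F)
  have mv: "m G v \<le> g F v" if "G \<in> GG" for G
    using m_max[OF that] v(2) by (simp add: gy my that F)
  have gpos: "0 < g F v"
    using pos v(2) by (simp add: gy F zero_less_mult_iff)
  show ?thesis
  proof (cases "0 \<le> \<tau> v")
    case True
    then obtain F' where F': "F' \<in> FF" "v \<in> F'"
      using FF_cover v(1) \<tau>_nonneg by blast
    have "z0 - \<psi> v \<le> g F v"
      using gv[OF F'(1)] g_F[OF F'] by simp
    then have "g F v = z0 - \<psi> v"
      using g_le[OF F v(1)] by simp
    then have "v \<in> F" "g F y = l * \<eta> v"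
      using g_eq[OF F v(1)] gy[OF F] by (auto simp: \<eta>_def)
    then show ?thesis
      using v by blast
  next
    case False
    \<comment> \<open>The parameter at which the segment from \<open>q\<close> to v crosses
      H.\<close>
    define \<mu> where "\<mu> = T / (T - \<tau> v)"
    define c where "c = q + \<mu> *\<^sub>R (v - q)"
    have \<mu>: "0 < \<mu>" "\<mu> < 1"
      using False T_pos by (auto simp: \<mu>_def)
    have "\<tau> c = (1 - \<mu>) * T + \<mu> * \<tau> v"
      by (simp add: c_def affine_map_ray[OF affine_\<tau>] \<tau>_q)
    also have "\<dots> = T - \<mu> * (T - \<tau> v)"
      by (simp add: algebra_simps)
    also have "\<dots> = 0"
      using False T_pos by (simp add: \<mu>_def)
    finally have \<tau>c: "\<tau> c = 0" .
    have cint: "c \<in> interior P"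
      unfolding c_def by (rule interior_ray[OF convex_P q_int]) (use v(1) frontier_P \<mu> in auto)
    have gc: "g F c = \<mu> * g F v"
      by (simp add: c_def affine_map_ray[OF affine_g[OF F]] g_at_q[OF F])
    have mc: "m G c = \<mu> * m G v" if "G \<in> GG" for G
      by (simp add: c_def affine_map_ray[OF affine_m[OF that]] m_q[OF that])
    have gcpos: "0 < g F c"
      using gc gpos \<mu>(1) by simp
    show ?thesis
    proof (cases c rule: axis_cases)
      case axis
      then have "g F c = - (T * e F)"
        using \<tau>c g_p[OF F] by simp
      then show ?thesis
        using gcpos Te[OF F] by simp
    next
      case (wall G w \<nu>)
      have c: "c = p + \<nu> *\<^sub>R (w - p)"
        using wall(4) \<tau>c by simp
      \<comment> \<open>Otherwise the frontier point w would lie on the segment from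
        \<open>p\<close> to the interior point c.\<close>
      have "\<nu> < 1"
      proof (rule ccontr)
        assume n: "\<not> \<nu> < 1"
        have w: "w = p + (1 / \<nu>) *\<^sub>R (c - p)"
          using wall(3) by (simp add: c)
        have "w \<in> interior P"
        proof (cases "\<nu> = 1")
          case True
          then show ?thesis
            using c cint by simp
        next
          case False
          then show ?thesis
            using n cint interior_subset
            by (subst w, intro interior_ray[OF convex_P p_int]) auto
        qed
        then show False
          using GG_frontier[OF wall(1,2)] frontier_P by blast
      qed
      \<comment> \<open>At c the function \<open>g F\<close> falls short of \<open>m G\<close> by at
        least \<open>(1 - \<nu>) * T * e F\<close>, against the maximality of
        \<open>g F\<close>.\<close>
      have "g F c = \<nu> * g F w - (1 - \<nu>) * (T * e F)"
        using g_wall[OF F, of \<nu> w 0] by (simp add: c)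
      also have "\<dots> < \<nu> * g F w"
        using \<open>\<nu> < 1\<close> Te[OF F] by simp
      also have "\<dots> \<le> \<nu> * (z0 - \<psi> w)"
        using g_le[OF F GG_frontier[OF wall(1,2)]] wall(3) by simp
      also have "\<dots> = m G c"
        using m_wall[OF wall(1), of \<nu> w 0] m_G[OF wall(1,2)] by (simp add: c)
      also have "\<dots> \<le> g F c"
        using mv[OF wall(1)] \<mu>(1) by (simp add: mc wall(1) gc)
      finally show ?thesis
        by simp
    qed
  qed
qed

lemma FF_nonempty: "FF \<noteq> {}"
proof -
  have "p + a \<noteq> p"
    using a_nonzero by simp
  then obtain v l where v: "v \<in> frontier P" "0 < l" "p + a = p + l *\<^sub>R (v - p)"
    using ray_to_frontier_point[OF bounded_P p_int] by metis
  have "\<tau> (p + a) = 1"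
    using \<tau>_shift[of p 1] \<tau>_p by simp
  then have "l * \<tau> v = 1"
    unfolding v(3) by (simp add: affine_map_ray[OF affine_\<tau>] \<tau>_p)
  then have "0 \<le> \<tau> v"
    using v(2) by (metis less_eq_real_def zero_less_mult_iff zero_less_one not_less_iff_gr_or_eq)
  then show ?thesis
    using FF_cover[OF v(1)] \<tau>_nonneg by blast
qed

lemma finite_FF: "finite FF" and finite_GG: "finite GG"
  using FF_S GG_S complex_S finite_subset unfolding polytopal_complex_def by blast+

definition LL where
  "LL = g ` FF \<union> (\<lambda>F x. g F (\<sigma> x)) ` FF \<union> f ` FF \<union> (\<lambda>F x. f F (\<sigma> x)) ` FF \<union> m ` GG"

sublocale ms: max_subdivision P LL z0
proof
  show "finite LL"
    by (simp add: LL_def finite_FF finite_GG)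
  show "LL \<noteq> {}"
    using FF_nonempty by (simp add: LL_def)
  show "convex P"
    by (rule convex_P)
  show "affine_map h" if "h \<in> LL" for h
    using that affine_g affine_f affine_m affine_map_compose[OF _ affine_\<sigma>] by (auto simp: LL_def)
qed

lemma mem_cell_iff:
  "x \<in> ms.cell h \<longleftrightarrow> x \<in> P \<and>
    (\<forall>F\<in>FF. g F x \<le> h x \<and> g F (\<sigma> x) \<le> h x \<and> f F x \<le> h x \<and> f F (\<sigma> x) \<le> h x) \<and>
    (\<forall>G\<in>GG. m G x \<le> h x)"
  unfolding ms.cell_def by (auto simp: LL_def)

text \<open>On and above H the mirror images of the g and f are dominated by the originals.\<close>

lemma mem_cell_above:
  assumes "x \<in> P" "0 \<le> \<tau> x" "\<And>F. F \<in> FF \<Longrightarrow> g F x \<le> h x" "\<And>F. F \<in> FF \<Longrightarrow> f F x \<le> h x"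
    and "\<And>G. G \<in> GG \<Longrightarrow> m G x \<le> h x"
  shows "x \<in> ms.cell h"
  unfolding mem_cell_iff using assms g_\<sigma>_le f_\<sigma>_le order_trans by metis

section \<open>Shape of the regions\<close>

lemma eta_gt_1: "x \<in> frontier P \<Longrightarrow> 1 < \<eta> x"
  using z0_large by (simp add: \<eta>_def)

lemma g_on_F: "F \<in> FF \<Longrightarrow> x \<in> F \<Longrightarrow> g F x = \<eta> x"
  and m_on_G: "G \<in> GG \<Longrightarrow> x \<in> G \<Longrightarrow> m G x = \<eta> x"
  and g_le_\<eta>: "F \<in> FF \<Longrightarrow> x \<in> frontier P \<Longrightarrow> g F x \<le> \<eta> x"
  and m_le_\<eta>: "G \<in> GG \<Longrightarrow> x \<in> frontier P \<Longrightarrow> m G x \<le> \<eta> x"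
  using g_F m_G g_le m_le by (simp_all add: \<eta>_def)

lemma frontier_in_P: "x \<in> frontier P \<Longrightarrow> x \<in> P"
  by (simp add: frontier_P)

lemma q_P: "q \<in> P" and q'_P: "q' \<in> P"
  using q_int q'_int interior_subset by auto

lemma segment_in_P: "x \<in> P \<Longrightarrow> y \<in> P \<Longrightarrow> 0 \<le> l \<Longrightarrow> l \<le> 1 \<Longrightarrow> x + l *\<^sub>R (y - x) \<in> P"
  using convexD_alt[OF convex_P, of x y l] by (simp add: algebra_simps)

lemma g_ray_q: "F \<in> FF \<Longrightarrow> g F (q + l *\<^sub>R (v - q)) = l * g F v"
  by (simp add: affine_map_ray[OF affine_g] g_at_q)

lemma m_ray_q: "G \<in> GG \<Longrightarrow> m G (q + l *\<^sub>R (v - q)) = l * m G v"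
  by (simp add: affine_map_ray[OF affine_m] m_q)

lemma m_ray_q': "G \<in> GG \<Longrightarrow> m G (q' + l *\<^sub>R (v - q')) = l * m G v"
  by (simp add: affine_map_ray[OF affine_m] m_q')

lemma f_ray_q': "F \<in> FF \<Longrightarrow> f F (q' + l *\<^sub>R (v - q')) = l * f F v"
  by (simp add: affine_map_ray[OF affine_f] f_q')

lemma g_ray_q': "F \<in> FF \<Longrightarrow> g F (q' + l *\<^sub>R (v - q')) = l * g F v - (1 - l) * (2 * T * e F)"
  by (simp add: affine_map_ray[OF affine_g] g_q')

text \<open>The comparison with \<open>f F\<close> amounts to \<open>g F x \<ge> 1\<close>, and the
  comparison with the other g and the m puts x on a ray through F. Conversely, all g and m are
  scaled by the same l along a ray from \<open>q\<close>, so their inequalities are inherited from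
  the boundary point v.\<close>

lemma cell_g:
  assumes F: "F \<in> FF"
  shows "ms.cell (g F) = truncated_cone q F (\<lambda>x. g F x - 1)"
proof (intro equalityI subsetI)
  fix x assume "x \<in> ms.cell (g F)"
  then have x: "x \<in> P" and le: "\<And>F'. F' \<in> FF \<Longrightarrow> g F' x \<le> g F x" "f F x \<le> g F x"
    "\<And>G. G \<in> GG \<Longrightarrow> m G x \<le> g F x"
    using F by (auto simp: mem_cell_iff)
  have "2 * T * e F * 1 \<le> 2 * T * e F * g F x"
    using le(2) by (simp add: f_le_iff F algebra_simps)
  then have g1: "1 \<le> g F x"
    by (rule mult_left_le_imp_le) (use Te[OF F] in simp)
  then obtain v l where v: "v \<in> F" "0 < l" "x = q + l *\<^sub>R (v - q)"
    using ray_through_F[OF F _ le(1,3)] by auto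
  have "l \<le> 1"
    using ray_parameter_le_one[OF convex_P q_int FF_frontier[OF F v(1)] v(2)] x v(3) by simp
  then show "x \<in> truncated_cone q F (\<lambda>x. g F x - 1)"
    unfolding mem_truncated_cone using g1 v by (intro conjI bexI[of _ v] exI[of _ l]) auto
next
  fix x assume "x \<in> truncated_cone q F (\<lambda>x. g F x - 1)"
  then obtain v l where v: "v \<in> F" "0 \<le> l" "l \<le> 1" "x = q + l *\<^sub>R (v - q)" and g1: "1 \<le> g F x"
    unfolding mem_truncated_cone by auto
  have vf: "v \<in> frontier P"
    using FF_frontier[OF F v(1)] .
  have gx: "g F x = l * \<eta> v"
    by (simp add: v(4) g_ray_q F g_on_F v(1))
  have gle: "g F' x \<le> g F x" if "F' \<in> FF" for F'
    unfolding gx using g_le_\<eta>[OF that vf] v(2) by (simp add: v(4) g_ray_q that mult_left_mono)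
  show "x \<in> ms.cell (g F)"
  proof (rule mem_cell_above)
    show "x \<in> P"
      unfolding v(4) by (rule segment_in_P[OF q_P frontier_in_P[OF vf] v(2,3)])
    have "\<tau> x = (1 - l) * T + l * \<tau> v"
      by (simp add: v(4) affine_map_ray[OF affine_\<tau>] \<tau>_q)
    then show "0 \<le> \<tau> x"
      using v(2,3) T_pos FF_\<tau>[OF F v(1)] by simp
    show "m G x \<le> g F x" if "G \<in> GG" for G
      unfolding gx using m_le_\<eta>[OF that vf] v(2) by (simp add: v(4) m_ray_q that mult_left_mono)
    show "f F' x \<le> g F x" if "F' \<in> FF" for F'
      by (rule f_le[OF that gle[OF that] g1])
  qed (rule gle)
qed

text \<open>The section of the pyramid over F with apex \<open>q\<close> by \<open>g F = 1\<close>,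
  see \<open>mem_FA\<close>. The quotient form exhibits it as a projective image of F with
  denominator \<open>g F\<close>.\<close>

definition FA where "FA F = (\<lambda>v. (1 / g F v) *\<^sub>R (v - q + g F v *\<^sub>R q)) ` F"

lemma FA_point:
  assumes "F \<in> FF" "v \<in> F"
  shows "(1 / g F v) *\<^sub>R (v - q + g F v *\<^sub>R q) = q + (1 / \<eta> v) *\<^sub>R (v - q)"
  using eta_gt_1[OF FF_frontier[OF assms]] by (simp add: g_on_F assms scaleR_add_right)

lemma mem_FA:
  assumes "F \<in> FF"
  shows "y \<in> FA F \<longleftrightarrow> (\<exists>v\<in>F. y = q + (1 / \<eta> v) *\<^sub>R (v - q))"
  using FA_point[OF assms] by (force simp: FA_def)

lemma FA_values:
  assumes F: "F \<in> FF" and y: "y \<in> FA F"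
  shows "g F y = 1" "F' \<in> FF \<Longrightarrow> g F' y \<le> 1" "G \<in> GG \<Longrightarrow> m G y \<le> 1" "y \<in> interior P" "0 < \<tau> y"
proof -
  obtain v where v: "v \<in> F" "y = q + (1 / \<eta> v) *\<^sub>R (v - q)"
    using y mem_FA[OF F] by blast
  have vf: "v \<in> frontier P"
    using FF_frontier[OF F v(1)] .
  have 1: "1 < \<eta> v"
    using eta_gt_1[OF vf] .
  show "g F y = 1"
    using 1 by (simp add: v(2) g_ray_q F g_on_F v(1))
  show "g F' y \<le> 1" if "F' \<in> FF" for F'
    using 1 g_le_\<eta>[OF that vf] by (simp add: v(2) g_ray_q that)
  show "m G y \<le> 1" if "G \<in> GG" for G
    using 1 m_le_\<eta>[OF that vf] by (simp add: v(2) m_ray_q that)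
  show "y \<in> interior P"
    unfolding v(2) using 1 by (intro interior_ray[OF convex_P q_int frontier_in_P[OF vf]]) auto
  have "\<tau> y = (1 - 1 / \<eta> v) * T + 1 / \<eta> v * \<tau> v"
    unfolding v(2) affine_map_ray[OF affine_\<tau>] \<tau>_q ..
  moreover have "0 < (1 - 1 / \<eta> v) * T" "0 \<le> 1 / \<eta> v * \<tau> v"
    using 1 T_pos FF_\<tau>[OF F v(1)] by simp_all
  ultimately show "0 < \<tau> y"
    by linarith
qed

text \<open>Central projection from \<open>q'\<close> to the hyperplane \<open>f F = 1\<close> turns
  the maximality of \<open>f F\<close> at x into upper bounds 1 for all g and m at the projected
  point. There \<open>g F\<close> equals 1, so \<open>ray_through_F\<close> applies.\<close>

lemma cell_f:
  assumes F: "F \<in> FF"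
  shows "ms.cell (f F) = truncated_cone q' (FA F) \<tau>"
proof (intro equalityI subsetI)
  fix x assume "x \<in> ms.cell (f F)"
  then have x: "x \<in> P" and le: "\<And>F'. F' \<in> FF \<Longrightarrow> f F' x \<le> f F x" "g F x \<le> f F x" "f F (\<sigma> x) \<le> f F x"
    "\<And>G. G \<in> GG \<Longrightarrow> m G x \<le> f F x"
    using F by (auto simp: mem_cell_iff)
  have \<tau>: "0 \<le> \<tau> x"
    using le(3) f_\<sigma>_le[OF F] by simp
  \<comment> \<open>Needed for the projection from \<open>q'\<close>. On the axis it holds because x
    lies above \<open>q'\<close>; off the axis some \<open>m G\<close> is positive at x and bounded
    by \<open>f F x\<close>.\<close>
  have pos: "0 < f F x"
  proof (cases x rule: axis_cases)
    case axis
    have "g F x = (\<tau> x - T) * e F"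
      by (subst axis) (rule g_axis[OF F])
    then have "g F x + 2 * T * e F = (\<tau> x + T) * e F"
      by (simp add: algebra_simps)
    moreover have "0 < (\<tau> x + T) * e F"
      using \<tau> T_pos e_pos[OF F] by simp
    ultimately show ?thesis
      using Te[OF F] by (simp add: f_def)
  next
    case (wall G c \<nu>)
    have "m G x = \<nu> * m G c"
      by (subst wall(4)) (rule m_wall[OF wall(1)])
    also have "\<dots> > 0"
      using wall eta_gt_1[OF GG_frontier[OF wall(1,2)]] by (simp add: m_on_G)
    finally show ?thesis
      using le(4)[OF wall(1)] by linarith
  qed
  define y where "y = q' + (1 / f F x) *\<^sub>R (x - q')"
  have xy: "x = q' + f F x *\<^sub>R (y - q')"
    using pos by (simp add: y_def)
  have fy: "f F y = 1"
    using pos by (simp add: y_def f_ray_q' F)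
  then have gy: "g F y = 1"
    using f_eq_1[OF F] by simp
  have "g F' y \<le> 1" if "F' \<in> FF" for F'
  proof -
    have "f F' y \<le> 1"
      using pos le(1)[OF that] by (simp add: y_def f_ray_q' that)
    then show ?thesis
      using f_le_1[OF that] by simp
  qed
  moreover have "m G y \<le> 1" if "G \<in> GG" for G
    using pos le(4)[OF that] by (simp add: y_def m_ray_q' that)
  ultimately obtain v l where v: "v \<in> F" "0 < l" "y = q + l *\<^sub>R (v - q)" "1 = l * \<eta> v"
    using ray_through_F[OF F, of y] by (auto simp: gy)
  have "l = 1 / \<eta> v"
    using v(4) eta_gt_1[OF FF_frontier[OF F v(1)]] by (simp add: field_simps)
  then have "y \<in> FA F"
    using v mem_FA[OF F] by blast
  moreover have "f F x \<le> 1"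
  proof -
    have "g F x * (1 + 2 * T * e F) \<le> g F x + 2 * T * e F"
      using le(2) Te[OF F] by (simp add: f_def pos_le_divide_eq)
    then have "2 * T * e F * g F x \<le> 2 * T * e F * 1"
      by (simp add: algebra_simps)
    then have "g F x \<le> 1"
      by (rule mult_left_le_imp_le) (use Te[OF F] in simp)
    then show ?thesis
      using f_le_1[OF F] by simp
  qed
  ultimately show "x \<in> truncated_cone q' (FA F) \<tau>"
    unfolding mem_truncated_cone using xy pos \<tau> less_imp_le by blast
next
  fix x assume "x \<in> truncated_cone q' (FA F) \<tau>"
  then obtain y l where y: "y \<in> FA F" "0 \<le> l" "l \<le> 1" "x = q' + l *\<^sub>R (y - q')" and \<tau>: "0 \<le> \<tau> x"
    unfolding mem_truncated_cone by blast
  note v = FA_values[OF F y(1)]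
  have fx: "f F x = l"
    using v(1) by (simp add: y(4) f_ray_q' F f_eq_1)
  show "x \<in> ms.cell (f F)"
  proof (rule mem_cell_above[OF _ \<tau>])
    show "x \<in> P"
      unfolding y(4) using v(4) interior_subset by (intro segment_in_P[OF q'_P _ y(2,3)]) auto
    show "g F' x \<le> f F x" if "F' \<in> FF" for F'
    proof -
      have "l * g F' y \<le> l"
        using v(2)[OF that] y(2) mult_left_mono[of "g F' y" 1 l] by simp
      moreover have "0 \<le> (1 - l) * (2 * T * e F')"
        using y(3) Te[OF that] by simp
      moreover have "g F' x = l * g F' y - (1 - l) * (2 * T * e F')"
        unfolding y(4) by (rule g_ray_q'[OF that])
      ultimately show ?thesis
        unfolding fx by linarith
    qed
    show "f F' x \<le> f F x" if "F' \<in> FF" for F'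
    proof -
      have "f F' y \<le> 1"
        using f_le_1[OF that] v(2)[OF that] by simp
      moreover have "f F' x = l * f F' y"
        unfolding y(4) by (rule f_ray_q'[OF that])
      ultimately show ?thesis
        unfolding fx using y(2) mult_left_mono[of "f F' y" 1 l] by simp
    qed
    have "m G x = l * m G y" if "G \<in> GG" for G
      unfolding y(4) by (rule m_ray_q'[OF that])
    then show "m G x \<le> f F x" if "G \<in> GG" for G
      unfolding fx using that v(3)[OF that] y(2) mult_left_mono[of "m G y" 1 l] by simp
  qed
qed

text \<open>In the plane through a point c of G and the axis the region is a quadrilateral with
  sides on four lines: \<open>m G\<close> agrees with \<open>g F\<close> and its mirror image on the
  lines from c to \<open>q\<close> and \<open>q'\<close>, and with \<open>f F\<close> and its mirror
  image on lines through \<open>q'\<close> and \<open>q\<close>. Every F containing G yields the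
  same region.\<close>

lemma cell_m:
  assumes G: "G \<in> GG" and F: "F \<in> FF" "G \<subseteq> F"
  shows "ms.cell (m G) = truncated_cone q (truncated_cone q' G (\<lambda>x. m G x - 1)) (\<lambda>x. m G x - f F x)"
proof (intro equalityI subsetI)
  fix x assume "x \<in> ms.cell (m G)"
  then have x: "x \<in> P" and le: "g F x \<le> m G x" "g F (\<sigma> x) \<le> m G x" "f F x \<le> m G x" "f F (\<sigma> x) \<le> m G x"
    "\<And>G'. G' \<in> GG \<Longrightarrow> m G' x \<le> m G x"
    using F by (auto simp: mem_cell_iff)
  let ?t = "\<tau> x"
  show "x \<in> truncated_cone q (truncated_cone q' G (\<lambda>x. m G x - 1)) (\<lambda>x. m G x - f F x)"
  proof (cases x rule: axis_cases)
    case axis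
    have gx: "g F x = (?t - T) * e F"
      by (subst axis) (rule g_axis[OF F(1)])
    have "m G x = 0"
      by (subst axis) (simp add: m_shift[OF G] m_p[OF G])
    then have "g F x + 2 * T * e F \<le> 0" "g F (\<sigma> x) + 2 * T * e F \<le> 0"
      using le(3,4) by (simp_all add: f_le_iff F(1))
    \<comment> \<open>Adding the two inequalities eliminates the height of x.\<close>
    then have "2 * (T * e F) \<le> 0"
      unfolding g_\<sigma>[OF F(1)] gx by (simp add: algebra_simps)
    then show ?thesis
      using Te[OF F(1)] by simp
  next
    case (wall G' c \<nu>)
    have mx: "m G'' x = \<nu> * m G'' c" if "G'' \<in> GG" for G''
      by (subst wall(4)) (rule m_wall[OF that])
    have cf: "c \<in> frontier P"
      using GG_frontier wall(1,2) .
    have "\<nu> * \<eta> c \<le> \<nu> * m G c"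
      using le(5)[OF wall(1)] mx[OF wall(1)] mx[OF G] m_on_G[OF wall(1,2)] by simp
    then have "m G c = z0 - \<psi> c"
      using wall(3) m_le[OF G cf] by (simp add: \<eta>_def)
    then have c: "c \<in> G"
      using m_eq[OF G cf] by simp
    have \<eta>: "1 < \<eta> c" "m G c = \<eta> c" "g F c = \<eta> c"
      using eta_gt_1[OF cf] m_on_G[OF G c] g_on_F[OF F(1)] c F(2) by auto
    have mGx: "m G x = \<nu> * \<eta> c"
      using mx[OF G] \<eta>(2) by simp
    have gx: "g F x = \<nu> * \<eta> c + (?t - (1 - \<nu>) * T) * e F"
      using g_wall[OF F(1), of \<nu> c ?t] \<eta>(3) wall(4) by simp
    have g\<sigma>x: "g F (\<sigma> x) = \<nu> * \<eta> c + (- ?t - (1 - \<nu>) * T) * e F"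
      unfolding g_\<sigma>[OF F(1)] gx by (simp add: algebra_simps)
    note e = e_pos[OF F(1)]
    have "(?t - (1 - \<nu>) * T) * e F \<le> 0" "(- ?t - (1 - \<nu>) * T) * e F \<le> 0"
      using le(1,2) unfolding gx g\<sigma>x mGx by simp_all
    then have t1: "?t \<le> (1 - \<nu>) * T" "- ?t \<le> (1 - \<nu>) * T"
      using e by (simp_all add: mult_le_0_iff)
    have "(?t + (1 + \<nu>) * T) * e F \<le> (2 * \<nu> * \<eta> c * T) * e F"
      "(- ?t + (1 + \<nu>) * T) * e F \<le> (2 * \<nu> * \<eta> c * T) * e F"
      using le(3,4) unfolding f_le_iff[OF F(1)] gx g\<sigma>x mGx by (simp_all add: algebra_simps)
    then have t2: "?t + (1 + \<nu>) * T \<le> 2 * \<nu> * \<eta> c * T" "- ?t + (1 + \<nu>) * T \<le> 2 * \<nu> * \<eta> c * T"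
      using e by simp_all
    define s where "s = ?t / T"
    have ts: "?t = s * T"
      using T_pos by (simp add: s_def)
    have s1: "s \<le> 1 - \<nu>" "- s \<le> 1 - \<nu>"
      using t1 T_pos mult_le_cancel_right_pos[OF T_pos, of s] mult_le_cancel_right_pos[OF T_pos, of "-s"]
      by (simp_all add: ts)
    have "(- s + (1 + \<nu>)) * T \<le> (2 * \<nu> * \<eta> c) * T"
      using t2 by (simp add: ts algebra_simps)
    then have s2: "- s + (1 + \<nu>) \<le> 2 * \<nu> * \<eta> c"
      using T_pos by simp
    \<comment> \<open>With \<open>y = q' + u (c - q')\<close>, the coefficients of
      \<open>c - p\<close> and \<open>a\<close> in \<open>q + l (y - q)\<close> are
      \<open>l u\<close> and \<open>(1 - 2 l + l u) T\<close>. Equating them with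
      \<open>\<nu>\<close> and \<open>s T\<close> gives l and u.\<close>
    define l where "l = (1 + \<nu> - s) / 2"
    define u where "u = \<nu> / l"
    \<comment> \<open>The bounds \<open>\<nu> \<le> l\<close> (that is, \<open>u \<le> 1\<close>)
      and \<open>l \<le> 1\<close> express the inequalities for \<open>g F\<close> and its mirror
      image; the lower bound on u below comes from the mirror image of \<open>f F\<close>.\<close>
    have l: "\<nu> \<le> l" "l \<le> 1" "0 < l"
      using s1 wall(3) by (auto simp: l_def)
    have u: "0 \<le> u" "u \<le> 1" "\<nu> = l * u"
      using l wall(3) by (auto simp: u_def)
    define y where "y = q' + u *\<^sub>R (c - q')"
    have "l \<le> \<nu> * \<eta> c"
      using s2 by (simp add: l_def)
    then have "l * 1 \<le> l * (u * \<eta> c)"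
      using u(3) by (simp add: mult.assoc)
    then have "1 \<le> u * \<eta> c"
      using l(3) by simp
    then have "1 \<le> m G y"
      by (simp add: y_def m_ray_q' G \<eta>(2))
    then have yE: "y \<in> truncated_cone q' G (\<lambda>x. m G x - 1)"
      unfolding mem_truncated_cone using c u y_def by auto
    have tl: "?t = T - 2 * l * T + \<nu> * T"
      by (simp add: ts l_def field_simps)
    have "q + l *\<^sub>R (y - q) = (p + (l * u) *\<^sub>R (c - p)) + (T - 2 * l * T + l * u * T) *\<^sub>R a"
      by (simp add: y_def q_def q'_def algebra_simps flip: scaleR_add_left)
    then have "x = q + l *\<^sub>R (y - q)"
      using wall(4) tl u(3) by simp
    then show ?thesis
      unfolding mem_truncated_cone[of x] using yE l le(3) by (intro conjI bexI[of _ y] exI[of _ l]) auto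
  qed
next
  fix x assume "x \<in> truncated_cone q (truncated_cone q' G (\<lambda>x. m G x - 1)) (\<lambda>x. m G x - f F x)"
  then obtain y l where y: "y \<in> truncated_cone q' G (\<lambda>x. m G x - 1)" and l: "0 \<le> l" "l \<le> 1"
    and xy: "x = q + l *\<^sub>R (y - q)" and fm: "f F x \<le> m G x"
    unfolding mem_truncated_cone[of x] by auto
  obtain c u where c: "c \<in> G" and u: "0 \<le> u" "u \<le> 1" and yc: "y = q' + u *\<^sub>R (c - q')" and m1: "1 \<le> m G y"
    using y unfolding mem_truncated_cone by auto
  have cf: "c \<in> frontier P"
    using GG_frontier G c .
  have \<eta>: "m G c = \<eta> c" "g F c = \<eta> c"
    using m_on_G[OF G c] g_on_F[OF F(1)] c F(2) by auto
  have u1: "1 \<le> u * \<eta> c"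
    using m1 by (simp add: yc m_ray_q' G \<eta>)
  have mx: "m G' x = l * u * m G' c" if "G' \<in> GG" for G'
    by (simp add: xy yc m_ray_q m_ray_q' that)
  have mGx: "m G x = l * u * \<eta> c"
    by (simp add: mx G \<eta>)
  have gx: "g F' x = l * u * g F' c - l * (1 - u) * (2 * T * e F')" if "F' \<in> FF" for F'
    by (simp add: xy yc g_ray_q g_ray_q' that) (simp add: algebra_simps)
  have \<tau>x: "\<tau> x = (1 - 2 * l + l * u) * T"
    by (simp add: xy yc affine_map_ray[OF affine_\<tau>] \<tau>_q \<tau>_q' GG_\<tau>[OF G c])
      (simp add: algebra_simps)
  have g\<sigma>x: "g F' (\<sigma> x) = l * u * g F' c - (1 - l) * (2 * T * e F')" if "F' \<in> FF" for F'
    unfolding g_\<sigma>[OF that] gx[OF that] \<tau>x by (simp add: algebra_simps)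
  have lu: "0 \<le> l * u"
    using l u by simp
  have gc: "l * u * g F' c \<le> l * u * \<eta> c" if "F' \<in> FF" for F'
    using g_le_\<eta>[OF that cf] lu by (rule mult_left_mono)
  \<comment> \<open>The slope \<open>e F\<close> cancels, so the bound obtained from F serves every
    other F' as well.\<close>
  have "(1 - l + l * u) * (2 * T * e F) \<le> (l * u * \<eta> c) * (2 * T * e F)"
    using fm unfolding f_le_iff[OF F(1)] gx[OF F(1)] mGx \<eta> by (simp add: algebra_simps)
  then have k: "1 - l + l * u \<le> l * u * \<eta> c"
    by (rule mult_right_le_imp_le) (use Te[OF F(1)] in simp)
  have "l * 1 \<le> l * (u * \<eta> c)"
    using u1 l(1) by (rule mult_left_mono)
  then have k': "l \<le> l * u * \<eta> c"
    by (simp add: mult.assoc)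
  have "x \<in> P"
  proof -
    have "y \<in> P"
      unfolding yc by (rule segment_in_P[OF q'_P frontier_in_P[OF cf] u])
    then show ?thesis
      unfolding xy by (rule segment_in_P[OF q_P _ l])
  qed
  moreover have "g F' x \<le> m G x \<and> g F' (\<sigma> x) \<le> m G x \<and> f F' x \<le> m G x \<and> f F' (\<sigma> x) \<le> m G x"
    if F': "F' \<in> FF" for F'
  proof -
    have T2: "0 < 2 * T * e F'"
      using Te[OF F'] by simp
    have 1: "0 \<le> l * (1 - u) * (2 * T * e F')" "0 \<le> (1 - l) * (2 * T * e F')"
      using T2 l u by simp_all
    have 2: "(1 - l + l * u) * (2 * T * e F') \<le> (l * u * \<eta> c) * (2 * T * e F')"
      "l * (2 * T * e F') \<le> (l * u * \<eta> c) * (2 * T * e F')"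
      using k k' T2 by (simp_all add: mult_right_mono)
    show ?thesis
      unfolding f_le_iff[OF F'] gx[OF F'] g\<sigma>x[OF F'] mGx
      using 1 2 gc[OF F'] by (simp add: algebra_simps)
  qed
  moreover have "m G' x \<le> m G x" if "G' \<in> GG" for G'
    unfolding mx[OF that] mGx using m_le_\<eta>[OF that cf] lu by (rule mult_left_mono)
  ultimately show "x \<in> ms.cell (m G)"
    unfolding mem_cell_iff by blast
qed

section \<open>Regions as combinatorial cubes\<close>

lemma LL_\<sigma>: "h \<in> LL \<Longrightarrow> (\<lambda>x. h (\<sigma> x)) \<in> LL"
  by (auto simp: LL_def \<sigma>_\<sigma> m_\<sigma>)

lemma cell_\<sigma>: "ms.cell (\<lambda>x. h (\<sigma> x)) = \<sigma> ` ms.cell h"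
proof -
  have *: "x \<in> ms.cell (\<lambda>x. h (\<sigma> x)) \<longleftrightarrow> \<sigma> x \<in> ms.cell h" for x
    unfolding mem_cell_iff by (auto simp: \<sigma>_\<sigma> m_\<sigma> \<sigma>_mem_P)
  show ?thesis
  proof (intro equalityI subsetI)
    fix x assume "x \<in> ms.cell (\<lambda>x. h (\<sigma> x))"
    then show "x \<in> \<sigma> ` ms.cell h"
      using * \<sigma>_\<sigma> by (metis imageI)
  qed (use * \<sigma>_\<sigma> in auto)
qed

lemma LL_cases:
  assumes "h \<in> LL"
  obtains h' where "h' \<in> g ` FF \<union> f ` FF \<union> m ` GG" "h = h' \<or> h = (\<lambda>x. h' (\<sigma> x))"
  using assms unfolding LL_def by blast

lemma supportE:
  assumes "F \<in> FF"
  obtains \<gamma> where "affine_map \<gamma>" "\<And>x. x \<in> F \<Longrightarrow> \<gamma> x = (1::real)" "\<And>x. x \<in> P \<Longrightarrow> \<gamma> x \<le> 1" "\<gamma> q < 1"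
proof -
  obtain \<gamma> where "affine_map \<gamma> \<and> (\<forall>x\<in>F. \<gamma> x = 1) \<and>
      (\<forall>x\<in>P. \<gamma> x \<le> (1::real)) \<and> (\<forall>x\<in>interior P. \<gamma> x < 1)"
    using FF_support[OF assms] ..
  then show ?thesis
    using q_int by (intro that[of \<gamma>]) auto
qed

lemma cube_cell_g:
  assumes F: "F \<in> FF"
  shows "combinatorial_cube DIM('a) (ms.cell (g F))"
proof -
  obtain \<gamma> :: "'a \<Rightarrow> real" where \<gamma>: "affine_map \<gamma>" "\<And>x. x \<in> F \<Longrightarrow> \<gamma> x = (1::real)" "\<And>x. x \<in> P \<Longrightarrow> \<gamma> x \<le> 1" "\<gamma> q < 1"
    by (rule supportE[OF F]) blast
  have "combinatorial_cube (Suc (DIM('a) - 1)) (truncated_cone q F (\<lambda>x. g F x - 1))"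
  proof (rule combinatorial_cube_truncated_cone[OF cube_FF[OF F] \<gamma>(1,2)])
    show "affine_map (\<lambda>x. g F x - 1)"
      by (intro affine_map_intros affine_g F)
    show "0 < g F v - 1" if "v \<in> F" for v
      using eta_gt_1[OF FF_frontier[OF F that]] g_on_F[OF F that] by simp
  qed (use \<gamma>(4) g_at_q[OF F] in auto)
  then show ?thesis
    by (simp add: cell_g[OF F])
qed

text \<open>A supporting function is constant on F and smaller at \<open>q\<close>, so it recovers
  the factor \<open>1 / \<eta> v\<close> from the image point. Hence the central projection is
  injective.\<close>

lemma cube_FA:
  assumes F: "F \<in> FF"
  shows "combinatorial_cube (DIM('a) - 1) (FA F)"
  unfolding FA_def
proof (rule combinatorial_cube_projective_image[OF cube_FF[OF F]])
  show "affine_map (\<lambda>v. v - q + g F v *\<^sub>R q)"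
    by (intro affine_map_intros affine_g F)
  show "affine_map (g F)"
    by (rule affine_g[OF F])
  show "0 < g F v" if "v \<in> F" for v
    using eta_gt_1[OF FF_frontier[OF F that]] g_on_F[OF F that] by simp
  obtain \<gamma> :: "'a \<Rightarrow> real" where \<gamma>: "affine_map \<gamma>" "\<And>x. x \<in> F \<Longrightarrow> \<gamma> x = (1::real)" "\<And>x. x \<in> P \<Longrightarrow> \<gamma> x \<le> 1" "\<gamma> q < 1"
    by (rule supportE[OF F]) blast
  show "inj_on (\<lambda>v. (1 / g F v) *\<^sub>R (v - q + g F v *\<^sub>R q)) F"
  proof (rule inj_onI)
    fix v w assume v: "v \<in> F" and w: "w \<in> F"
      and "(1 / g F v) *\<^sub>R (v - q + g F v *\<^sub>R q) = (1 / g F w) *\<^sub>R (w - q + g F w *\<^sub>R q)"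
    then have eq: "q + (1 / \<eta> v) *\<^sub>R (v - q) = q + (1 / \<eta> w) *\<^sub>R (w - q)"
      using FA_point[OF F] by simp
    have pos: "0 < \<eta> v" "0 < \<eta> w"
      using eta_gt_1[OF FF_frontier[OF F v]] eta_gt_1[OF FF_frontier[OF F w]] by auto
    have "\<gamma> (q + (1 / \<eta> x) *\<^sub>R (x - q)) = \<gamma> q + (1 - \<gamma> q) * (1 / \<eta> x)" if "x \<in> F" for x
      unfolding affine_map_ray[OF \<gamma>(1)] \<gamma>(2)[OF that] by (simp add: algebra_simps)
    then have "(1 - \<gamma> q) * (1 / \<eta> v) = (1 - \<gamma> q) * (1 / \<eta> w)"
      using eq v w by (metis add_left_cancel)
    then have "\<eta> v = \<eta> w"
      using \<gamma>(4) pos by simp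
    then show "v = w"
      using eq pos by simp
  qed
qed

lemma cube_cell_f:
  assumes F: "F \<in> FF"
  shows "combinatorial_cube DIM('a) (ms.cell (f F))"
proof -
  have "combinatorial_cube (Suc (DIM('a) - 1)) (truncated_cone q' (FA F) \<tau>)"
  proof (rule combinatorial_cube_truncated_cone[OF cube_FA[OF F] affine_f[OF F]])
    show "f F y = 1" if "y \<in> FA F" for y
      using FA_values(1)[OF F that] f_eq_1[OF F] by simp
    show "0 < \<tau> y" if "y \<in> FA F" for y
      using FA_values(5)[OF F that] .
  qed (use affine_\<tau> \<tau>_q' T_pos f_q'[OF F] in auto)
  then show ?thesis
    by (simp add: cell_f[OF F])
qed

text \<open>Two truncated pyramids raise the dimension from d-2 to d. The base of the second lies in
  the hyperplane where the mirror image of \<open>g F\<close> equals \<open>m G\<close>; its apex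
  \<open>q\<close> does not.\<close>

lemma cube_cell_m:
  assumes G: "G \<in> GG"
  shows "combinatorial_cube DIM('a) (ms.cell (m G))"
proof -
  obtain F where F: "F \<in> FF" "G \<subseteq> F"
    using GG_FF[OF G] by blast
  let ?E = "truncated_cone q' G (\<lambda>x. m G x - 1)"
  have cE: "combinatorial_cube (Suc (DIM('a) - 2)) ?E"
  proof (rule combinatorial_cube_truncated_cone[OF _ affine_\<tau> GG_\<tau>[OF G]])
    show "affine_map (\<lambda>x. m G x - 1)"
      by (intro affine_map_intros affine_m G)
    show "0 < m G v - 1" if "v \<in> G" for v
      using eta_gt_1[OF GG_frontier[OF G that]] m_on_G[OF G that] by simp
  qed (use cube_GG[OF G] \<tau>_q' T_pos m_q'[OF G] in auto)
  have E: "g F (\<sigma> y) - m G y = 0" "0 < m G y - f F y" if y: "y \<in> ?E" for y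
  proof -
    obtain c u where c: "c \<in> G" "0 \<le> u" "u \<le> 1" "y = q' + u *\<^sub>R (c - q')" "1 \<le> m G y"
      using y unfolding mem_truncated_cone by auto
    have cF: "c \<in> F"
      using c F by blast
    have \<eta>: "m G c = \<eta> c" "g F c = \<eta> c" "1 < \<eta> c"
      using m_on_G[OF G c(1)] g_on_F[OF F(1) cF] eta_gt_1[OF GG_frontier[OF G c(1)]] by auto
    have my: "m G y = u * \<eta> c"
      by (simp add: c(4) m_ray_q' G \<eta>)
    have "\<tau> y = - ((1 - u) * T)"
      by (simp add: c(4) affine_map_ray[OF affine_\<tau>] \<tau>_q' GG_\<tau>[OF G c(1)])
    moreover have "g F y = u * \<eta> c - (1 - u) * (2 * T * e F)"
      by (simp add: c(4) g_ray_q' F(1) \<eta>)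
    ultimately show "g F (\<sigma> y) - m G y = 0"
      by (simp add: g_\<sigma> F(1) my)
    have "u \<noteq> 0"
      using c(5) my by auto
    then have u: "0 < u"
      using c(2) by simp
    have "0 < 2 * T * e F * (\<eta> c - 1)"
      using Te[OF F(1)] \<eta>(3) by simp
    then have "\<eta> c + 2 * T * e F < \<eta> c * (1 + 2 * T * e F)"
      by (simp add: algebra_simps)
    then have "f F c < \<eta> c"
      using Te[OF F(1)] by (simp add: f_def \<eta> pos_divide_less_eq)
    then have "u * f F c < u * \<eta> c"
      using u by simp
    moreover have "f F y = u * f F c"
      by (simp add: c(4) f_ray_q' F(1))
    ultimately show "0 < m G y - f F y"
      by (simp add: my)
  qed
  have "combinatorial_cube (Suc (Suc (DIM('a) - 2))) (truncated_cone q ?E (\<lambda>x. m G x - f F x))"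
  proof (rule combinatorial_cube_truncated_cone[OF cE, where \<gamma> = "\<lambda>y. g F (\<sigma> y) - m G y" and c = 0])
    show "affine_map (\<lambda>y. g F (\<sigma> y) - m G y)"
      by (intro affine_map_diff affine_m G affine_map_compose[OF _ affine_\<sigma>] affine_g F(1))
    show "affine_map (\<lambda>x. m G x - f F x)"
      by (intro affine_map_diff affine_m G affine_f F(1))
    show "g F (\<sigma> q) - m G q \<noteq> 0"
      using e_pos[OF F(1)] T_pos by (simp add: g_\<sigma> F(1) g_at_q \<tau>_q m_q G)
    show "m G q - f F q < 0"
      using f_q[OF F(1)] by (simp add: m_q G)
  qed (use E in auto)
  moreover have "Suc (Suc (DIM('a) - 2)) = DIM('a)"
    using conjunct1[OF cube_GG[OF G]] by arith
  ultimately show ?thesis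
    by (simp add: cell_m[OF G F])
qed

sublocale mc: max_cubification P LL z0
proof
  fix h assume "h \<in> LL"
  then obtain h' where h': "h' \<in> g ` FF \<union> f ` FF \<union> m ` GG" "h = h' \<or> h = (\<lambda>x. h' (\<sigma> x))"
    by (rule LL_cases)
  have 1: "combinatorial_cube DIM('a) (ms.cell h')"
    using h'(1) cube_cell_g cube_cell_f cube_cell_m by blast
  have "combinatorial_cube DIM('a) (\<sigma> ` ms.cell h')"
    by (rule combinatorial_cube_affine_image[OF 1 affine_\<sigma>]) (use inj_\<sigma> inj_on_subset in blast)
  then show "combinatorial_cube DIM('a) (ms.cell h)"
    using h'(2) 1 by (auto simp: cell_\<sigma>)
qed

section \<open>Boundary complex and boundary values\<close>

lemma F_face_of_cell:
  assumes F: "F \<in> FF"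
  shows "F face_of ms.cell (g F)"
proof -
  obtain \<gamma> :: "'a \<Rightarrow> real" where \<gamma>: "affine_map \<gamma>" "\<And>x. x \<in> F \<Longrightarrow> \<gamma> x = (1::real)" "\<And>x. x \<in> P \<Longrightarrow> \<gamma> x \<le> 1" "\<gamma> q < 1"
    by (rule supportE[OF F]) blast
  have "g F \<in> LL"
    using F by (simp add: LL_def)
  then have "{x \<in> ms.cell (g F). \<gamma> x = 1} face_of ms.cell (g F)"
    using \<gamma> by (intro face_of_affine_eq mc.convex_cell) (auto simp: ms.cell_def)
  moreover have "{x \<in> ms.cell (g F). \<gamma> x = 1} = F"
  proof (intro equalityI subsetI)
    fix x assume "x \<in> {x \<in> ms.cell (g F). \<gamma> x = 1}"
    then obtain v l where v: "v \<in> F" "x = q + l *\<^sub>R (v - q)" "\<gamma> x = 1"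
      unfolding cell_g[OF F] mem_Collect_eq mem_truncated_cone by blast
    \<comment> \<open>As \<open>\<gamma> q < 1\<close>, the value 1 is reached only at ray parameter
      1, which is the base.\<close>
    have "(1 - l) * \<gamma> q + l = 1"
      using v(3) unfolding v(2) affine_map_ray[OF \<gamma>(1)] \<gamma>(2)[OF v(1)] by simp
    then have "(1 - l) * (1 - \<gamma> q) = 0"
      by (simp add: algebra_simps)
    then have "l = 1"
      using \<gamma>(4) by simp
    then show "x \<in> F"
      using v by simp
  next
    fix x assume x: "x \<in> F"
    then have "x \<in> ms.cell (g F)"
      unfolding cell_g[OF F] mem_truncated_cone
      using eta_gt_1[OF FF_frontier[OF F x]] g_on_F[OF F x]
      by (intro conjI bexI[of _ x] exI[of _ 1]) auto
    then show "x \<in> {x \<in> ms.cell (g F). \<gamma> x = 1}"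
      using \<gamma>(2)[OF x] by simp
  qed
  ultimately show ?thesis
    by simp
qed

lemma face_in_S: "C \<in> S \<Longrightarrow> K face_of C \<Longrightarrow> K \<in> S"
  using complex_S unfolding polytopal_complex_def by blast

lemma frontier_ray_q:
  assumes "v \<in> P" "0 \<le> l" "l \<le> 1" "q + l *\<^sub>R (v - q) \<in> frontier P"
  shows "l = 1"
proof (rule ccontr)
  assume "l \<noteq> 1"
  then have "q + l *\<^sub>R (v - q) \<in> interior P"
    using assms by (intro interior_ray[OF convex_P q_int]) auto
  then show False
    using assms(4) frontier_P by blast
qed

lemma frontier_ray_q':
  assumes "v \<in> P" "0 \<le> l" "l \<le> 1" "q' + l *\<^sub>R (v - q') \<in> frontier P"
  shows "l = 1"
proof (rule ccontr)
  assume "l \<noteq> 1"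
  then have "q' + l *\<^sub>R (v - q') \<in> interior P"
    using assms by (intro interior_ray[OF convex_P q'_int]) auto
  then show False
    using assms(4) frontier_P by blast
qed

lemma boundary_face_g:
  assumes F: "F \<in> FF" and K: "K face_of ms.cell (g F)" "K \<subseteq> frontier P"
  shows "K \<in> S"
proof -
  have "K \<subseteq> F"
  proof
    fix x assume x: "x \<in> K"
    then have "x \<in> truncated_cone q F (\<lambda>x. g F x - 1)"
      using K(1) face_of_imp_subset unfolding cell_g[OF F] by blast
    then obtain v l where v: "v \<in> F" "0 \<le> l" "l \<le> 1" "x = q + l *\<^sub>R (v - q)"
      unfolding mem_truncated_cone by blast
    then have "l = 1"
      using frontier_ray_q[OF frontier_in_P[OF FF_frontier[OF F v(1)]]] K(2) x by blast
    then show "x \<in> F"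
      using v by simp
  qed
  then have "K face_of F"
    by (rule face_of_subset[OF K(1) _ face_of_imp_subset[OF F_face_of_cell[OF F]]])
  then show ?thesis
    using F FF_S face_in_S by blast
qed

text \<open>Both the base \<open>FA F\<close> and the apex \<open>q'\<close> are interior, so the
  region avoids the frontier. Only the empty face is left, and S contains it as a face of any of its
  cells.\<close>

lemma boundary_face_f:
  assumes F: "F \<in> FF" and K: "K face_of ms.cell (f F)" "K \<subseteq> frontier P"
  shows "K \<in> S"
proof -
  have "K = {}"
  proof (rule ccontr)
    assume "K \<noteq> {}"
    then obtain x where x: "x \<in> K"
      by blast
    then have "x \<in> truncated_cone q' (FA F) \<tau>"
      using K(1) face_of_imp_subset unfolding cell_f[OF F] by blast
    then obtain y l where y: "y \<in> FA F" "0 \<le> l" "l \<le> 1" "x = q' + l *\<^sub>R (y - q')"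
      unfolding mem_truncated_cone by blast
    have yint: "y \<in> interior P"
      using FA_values(4)[OF F y(1)] .
    then have "l = 1"
      using frontier_ray_q'[of y l] y x K(2) interior_subset by blast
    then show False
      using y yint x K(2) frontier_P by auto
  qed
  moreover obtain F' where "F' \<in> S"
    using F FF_S by blast
  ultimately show ?thesis
    using face_in_S[of F' "{}"] by simp
qed

text \<open>A frontier point has ray parameter 1 in both nested cones and hence lies in G; as G is
  part of the region, K is a face of G.\<close>

lemma boundary_face_m:
  assumes G: "G \<in> GG" and K: "K face_of ms.cell (m G)" "K \<subseteq> frontier P"
  shows "K \<in> S"
proof -
  obtain F where F: "F \<in> FF" "G \<subseteq> F"
    using GG_FF[OF G] by blast
  have "K \<subseteq> G"
  proof
    fix x assume x: "x \<in> K"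
    then have xf: "x \<in> frontier P"
      using K(2) by blast
    have "x \<in> ms.cell (m G)"
      using x K(1) face_of_imp_subset by blast
    then obtain y l where y: "y \<in> truncated_cone q' G (\<lambda>x. m G x - 1)" "0 \<le> l" "l \<le> 1"
      and xy: "x = q + l *\<^sub>R (y - q)"
      unfolding cell_m[OF G F] mem_truncated_cone[of x] by blast
    obtain c u where c: "c \<in> G" "0 \<le> u" "u \<le> 1" and yc: "y = q' + u *\<^sub>R (c - q')"
      using y(1) unfolding mem_truncated_cone by blast
    have cP: "c \<in> P"
      using frontier_in_P[OF GG_frontier[OF G c(1)]] .
    then have "y \<in> P"
      unfolding yc by (rule segment_in_P[OF q'_P _ c(2,3)])
    then have "l = 1"
      using frontier_ray_q y xf unfolding xy by blast
    then have "x = y"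
      using xy by simp
    then have "u = 1"
      using frontier_ray_q'[OF cP c(2,3)] xf yc by simp
    then show "x \<in> G"
      using \<open>x = y\<close> yc c by simp
  qed
  moreover have "G \<subseteq> ms.cell (m G)"
  proof
    fix c assume c: "c \<in> G"
    have fr: "c \<in> frontier P"
      using GG_frontier[OF G c] .
    have "1 \<le> \<eta> c"
      using eta_gt_1[OF fr] by simp
    show "c \<in> ms.cell (m G)"
    proof (rule mem_cell_above)
      show "c \<in> P" "0 \<le> \<tau> c"
        using frontier_in_P[OF fr] GG_\<tau>[OF G c] by auto
      show "g F c \<le> m G c" if "F \<in> FF" for F
        using g_le_\<eta>[OF that fr] m_on_G[OF G c] by simp
      then show "f F c \<le> m G c" if "F \<in> FF" for F
        using f_le[OF that, of c "m G c"] that m_on_G[OF G c] \<open>1 \<le> \<eta> c\<close> by simp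
      show "m G' c \<le> m G c" if "G' \<in> GG" for G'
        using m_le_\<eta>[OF that fr] m_on_G[OF G c] by simp
    qed
  qed
  ultimately have "K face_of G"
    using K(1) face_of_subset by blast
  then show ?thesis
    using G GG_S face_in_S by blast
qed

lemma boundary_face_\<sigma>:
  assumes "convex C" "\<And>K. K face_of C \<Longrightarrow> K \<subseteq> frontier P \<Longrightarrow> K \<in> S"
    and "K face_of \<sigma> ` C" "K \<subseteq> frontier P"
  shows "K \<in> S"
proof -
  obtain K' where K': "K' face_of C" "K = \<sigma> ` K'"
    using face_of_\<sigma>_image[OF assms(1,3)] .
  have "K' \<subseteq> frontier P"
  proof
    fix x assume "x \<in> K'"
    then have "\<sigma> x \<in> frontier P"
      using K'(2) assms(4) by blast
    then show "x \<in> frontier P"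
      using \<sigma>_frontier[of "\<sigma> x"] by (simp add: \<sigma>_\<sigma>)
  qed
  then show ?thesis
    using assms(2)[OF K'(1)] \<sigma>_S K'(2) by blast
qed

theorem lifted_cubification_hexhoop: "lifted_cubification P S \<psi> ms.cells ms.\<phi>"
proof (rule mc.lifted_cubification_cells)
  fix h K assume h: "h \<in> LL" and K: "K face_of ms.cell h" "K \<subseteq> frontier P"
  obtain h' where h': "h' \<in> g ` FF \<union> f ` FF \<union> m ` GG" "h = h' \<or> h = (\<lambda>x. h' (\<sigma> x))"
    using h by (rule LL_cases)
  have h'S: "K \<in> S" if "K face_of ms.cell h'" "K \<subseteq> frontier P" for K
    using h'(1) that boundary_face_g boundary_face_f boundary_face_m by blast
  have "h' \<in> LL"
    using h'(1) by (auto simp: LL_def)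
  then have "convex (ms.cell h')"
    by (rule mc.convex_cell)
  then show "K \<in> S"
    using h'(2) h'S boundary_face_\<sigma>[of "ms.cell h'" K] K by (auto simp: cell_\<sigma>)
next
  fix C assume C: "C \<in> S"
  then obtain F where F: "F \<in> FF" "C face_of F \<or> C face_of \<sigma> ` F"
    using S_pure by blast
  have gLL: "g F \<in> LL"
    using F(1) by (simp add: LL_def)
  note face = F_face_of_cell[OF F(1)]
  have "\<exists>h\<in>LL. C face_of ms.cell h"
    using F(2)
  proof
    assume "C face_of F"
    then show ?thesis
      using face face_of_trans gLL by blast
  next
    assume "C face_of \<sigma> ` F"
    moreover have "\<sigma> ` F face_of ms.cell (\<lambda>x. g F (\<sigma> x))"
      unfolding cell_\<sigma> by (rule \<sigma>_image_face_of[OF mc.convex_cell[OF gLL] face])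
    ultimately show ?thesis
      using face_of_trans LL_\<sigma>[OF gLL] by blast
  qed
  then show "C \<subseteq> frontier P \<and> (\<exists>h\<in>LL. C face_of ms.cell h)"
    using C Union_S by blast
next
  have main: "ms.M x = \<eta> x" if x: "x \<in> frontier P" "0 \<le> \<tau> x" for x
  proof -
    obtain F where F: "F \<in> FF" "x \<in> F"
      using FF_cover x \<tau>_nonneg by blast
    then have "x \<in> ms.cell (g F)"
      using F_face_of_cell face_of_imp_subset by blast
    moreover have "g F \<in> LL"
      using F(1) by (simp add: LL_def)
    ultimately show ?thesis
      using ms.mem_cell g_on_F[OF F] by auto
  qed
  fix x assume x: "x \<in> frontier P"
  have "ms.M x = \<eta> x"
  proof (cases "0 \<le> \<tau> x")
    case True
    then show ?thesis
      using main x by blast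
  next
    case False
    \<comment> \<open>\<open>LL\<close> is closed under composition with \<open>\<sigma>\<close>, so
      the maximum is symmetric and the upper half determines it.\<close>
    have le: "ms.M y \<le> ms.M (\<sigma> y)" for y
      unfolding ms.M_le_iff using ms.M_ge[OF LL_\<sigma>, of _ "\<sigma> y"] by (simp add: \<sigma>_\<sigma>)
    have "ms.M x = ms.M (\<sigma> x)"
      using le[of x] le[of "\<sigma> x"] by (simp add: \<sigma>_\<sigma>)
    also have "\<dots> = \<eta> (\<sigma> x)"
      using main[OF \<sigma>_frontier[OF x]] False by (simp add: \<tau>_\<sigma>)
    also have "\<dots> = \<eta> x"
      using \<psi>_\<sigma>[OF x] by (simp add: \<eta>_def)
    finally show ?thesis .
  qed
  then show "ms.\<phi> x = \<psi> x"
    by (simp add: ms.\<phi>_def \<eta>_def)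
qed

end

subsection \<open>Polytopal complexes and concave functions\<close>

text \<open>Descend to a facet through x as long as x is not a relative interior point.\<close>

lemma polytope_carrier_face:
  fixes C :: "'a::euclidean_space set"
  assumes "polytope C" "x \<in> C"
  shows "\<exists>F. F face_of C \<and> x \<in> rel_interior F"
  using assms
proof (induction "nat (aff_dim C + 1)" arbitrary: C rule: less_induct)
  case less
  show ?case
  proof (cases "x \<in> rel_interior C")
    case True
    then show ?thesis
      using less.prems(1) face_of_refl polytope_imp_convex by blast
  next
    case False
    then obtain F where F: "F facet_of C" "x \<in> F"
      using rel_boundary_of_polyhedron[OF polytope_imp_polyhedron[OF less.prems(1)]] less.prems(2) by blast
    have FC: "F face_of C"
      using F(1) facet_of_imp_face_of by blast
    have "aff_dim F = aff_dim C - 1"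
      using F(1) by (simp add: facet_of_def)
    then have "nat (aff_dim F + 1) < nat (aff_dim C + 1)"
      using aff_dim_geq[of F] by linarith
    moreover have "polytope F"
      using FC less.prems(1) face_of_polytope_polytope by blast
    ultimately obtain F' where "F' face_of F" "x \<in> rel_interior F'"
      using less.hyps F(2) by blast
    then show ?thesis
      using FC face_of_trans by blast
  qed
qed

lemma polytopal_complex_carrier:
  fixes K :: "'a::euclidean_space set set"
  assumes "polytopal_complex K" "x \<in> \<Union>K"
  shows "\<exists>C\<in>K. x \<in> rel_interior C"
proof -
  obtain C where "C \<in> K" "x \<in> C"
    using assms(2) by blast
  then show ?thesis
    using assms(1) polytope_carrier_face unfolding polytopal_complex_def by metis
qed

text \<open>Near a relative interior point of a cell \<open>D\<close> that is maximal in \<open>R\<close>, the set \<open>R\<close> coincides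
  with \<open>D\<close>; hence \<open>D\<close> is full-dimensional in \<open>R\<close>.\<close>

lemma polytopal_complex_pure_in:
  fixes R :: "'a::euclidean_space set"
  assumes K: "polytopal_complex K" and R: "convex R"
    and cover: "\<And>x. x \<in> R \<Longrightarrow> \<exists>C\<in>K. x \<in> C \<and> C \<subseteq> R"
    and C: "C \<in> K" "C \<subseteq> R" "C \<noteq> {}"
  shows "\<exists>D\<in>K. C \<subseteq> D \<and> D \<subseteq> R \<and> aff_dim D = aff_dim R"
proof -
  have fin: "finite K" and poly: "\<And>C. C \<in> K \<Longrightarrow> polytope C"
    and face: "\<And>C D. C \<in> K \<Longrightarrow> D \<in> K \<Longrightarrow> C \<inter> D face_of C"
    using K unfolding polytopal_complex_def by auto
  have "finite {D \<in> K. D \<subseteq> R}"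
    using fin by simp
  then obtain D where "D \<in> {D \<in> K. D \<subseteq> R}" and CD: "C \<subseteq> D"
    and max: "\<forall>E\<in>{D \<in> K. D \<subseteq> R}. D \<subseteq> E \<longrightarrow> D = E"
    using finite_has_maximal2[of "{D \<in> K. D \<subseteq> R}" C] C by blast
  then have D: "D \<in> K" "D \<subseteq> R"
    by auto
  have "convex D" "D \<noteq> {}"
    using poly[OF D(1)] polytope_imp_convex CD C(3) by auto
  then obtain x where x: "x \<in> rel_interior D"
    using rel_interior_eq_empty by blast
  then have xD: "x \<in> D"
    using rel_interior_subset by blast
  \<comment> \<open>The finitely many cells that miss x are closed, so U is an open neighbourhood of
    x met only by cells containing x.\<close>
  define U where "U = - \<Union>{E \<in> K. x \<notin> E}"
  have "closed (\<Union>{E \<in> K. x \<notin> E})"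
    using fin poly polytope_imp_closed by (intro closed_Union) auto
  then have "open U"
    by (simp add: U_def open_Compl)
  have "R \<inter> U \<subseteq> D"
  proof
    fix y assume y: "y \<in> R \<inter> U"
    then obtain E where E: "E \<in> K" "y \<in> E" "E \<subseteq> R"
      using cover by blast
    then have "x \<in> E"
      using y by (auto simp: U_def)
    then have "D \<subseteq> D \<inter> E"
      using subset_of_face_of[OF face[OF D(1) E(1)], of D] x xD by blast
    then have "D = E"
      using max E by blast
    then show "y \<in> D"
      using E by simp
  qed
  moreover have "affine hull (R \<inter> U) = affine hull R"
    using R \<open>open U\<close> xD D(2) by (intro affine_hull_convex_Int_open) (auto simp: U_def)
  ultimately have "aff_dim R \<le> aff_dim D"
    by (metis aff_dim_affine_hull aff_dim_subset)
  then have "aff_dim D = aff_dim R"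
    using aff_dim_subset[OF D(2)] by simp
  then show ?thesis
    using D CD by blast
qed

text \<open>The interior point q makes the denominator positive. With the values 0 at q and 1 on the
  hyperplane, a multiple of \<open>\<gamma>\<close> prescribes a constant on the facet without
  changing the value at q.\<close>

lemma normalized_support:
  fixes P :: "'a::euclidean_space set"
  assumes "P \<subseteq> {x. c \<bullet> x \<le> k}" "c \<noteq> 0" "q \<in> interior P"
  defines "\<gamma> \<equiv> \<lambda>x. (c \<bullet> x - c \<bullet> q) / (k - c \<bullet> q)"
  shows "affine_map \<gamma>" "\<gamma> q = 0" "x \<in> P \<Longrightarrow> \<gamma> x \<le> 1" "x \<in> interior P \<Longrightarrow> \<gamma> x < 1"
    "\<gamma> x = 1 \<longleftrightarrow> c \<bullet> x = k"
proof -
  have int: "interior P \<subseteq> {x. c \<bullet> x < k}"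
    using interior_mono[OF assms(1)] assms(2) by simp
  then have pos: "0 < k - c \<bullet> q"
    using assms(3) by auto
  show "affine_map \<gamma>"
    unfolding \<gamma>_def by (intro affine_map_intros)
  show "\<gamma> q = 0"
    by (simp add: \<gamma>_def)
  show "\<gamma> x \<le> 1" if "x \<in> P"
    using assms(1) that pos by (auto simp: \<gamma>_def)
  show "\<gamma> x < 1" if "x \<in> interior P"
    using int that pos by (auto simp: \<gamma>_def)
  show "\<gamma> x = 1 \<longleftrightarrow> c \<bullet> x = k"
    using pos by (auto simp: \<gamma>_def)
qed

text \<open>Extend the segment from x through a relative interior point y of D to a point z of D. As
  f equals h at y and z, concavity leaves no room for a value above h at x.\<close>

lemma concave_le_affine:
  fixes f h :: "'a::euclidean_space \<Rightarrow> real"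
  assumes f: "concave_on C f" and D: "D \<subseteq> C" "convex D" "D \<noteq> {}" "aff_dim D = aff_dim C"
    and h: "affine_map h" "\<And>x. x \<in> D \<Longrightarrow> f x = h x" and x: "x \<in> C"
  shows "f x \<le> h x"
proof -
  obtain y where y: "y \<in> rel_interior D"
    using D(2,3) rel_interior_eq_empty by blast
  then have yD: "y \<in> D"
    using rel_interior_subset by blast
  have "x \<in> affine hull D"
    using aff_dim_eq_full_gen[OF D(1)] D(4) hull_inc[OF x] by blast
  then obtain m where m: "m > 1" "\<forall>e. e > 1 \<and> e \<le> m \<longrightarrow> (1 - e) *\<^sub>R x + e *\<^sub>R y \<in> D"
    using convex_rel_interior_if[OF D(2) y] by blast
  define z where "z = (1 - m) *\<^sub>R x + m *\<^sub>R y"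
  define u where "u = 1 / m"
  have u: "0 < u" "u < 1"
    using m(1) by (auto simp: u_def)
  have zD: "z \<in> D"
    using m by (simp add: z_def)
  have "u *\<^sub>R z = (u - 1) *\<^sub>R x + y"
    using m(1) by (simp add: z_def u_def scaleR_add_right algebra_simps diff_divide_distrib)
  then have yz: "y = (1 - u) *\<^sub>R x + u *\<^sub>R z"
    by (simp add: algebra_simps)
  have "(1 - u) * f x + u * f z \<le> f y"
    unfolding yz using f x zD D(1) u unfolding concave_on_iff by auto
  also have "\<dots> = (1 - u) * h x + u * h z"
    using h(2)[OF yD] affine_mapD_real[OF h(1), of u x z] by (simp flip: yz)
  finally have "(1 - u) * f x \<le> (1 - u) * h x"
    using h(2)[OF zD] by simp
  then show ?thesis
    using u by simp
qed

text \<open>The contact set of a concave function with an affine majorant is convex, and f is affine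
  on it; by maximality it cannot exceed D.\<close>

lemma domain_of_linearity_eq:
  fixes f h :: "'a::euclidean_space \<Rightarrow> real"
  assumes f: "concave_on C f" and D: "D \<in> domains_of_linearity C f"
    and h: "affine_map h" "\<And>x. x \<in> D \<Longrightarrow> f x = h x" "\<And>x. x \<in> C \<Longrightarrow> f x \<le> h x"
    and x: "x \<in> C" "f x = h x"
  shows "x \<in> D"
proof -
  let ?D = "{x \<in> C. f x = h x}"
  have DC: "D \<subseteq> C"
    using D by (simp add: domains_of_linearity_def)
  have "convex ?D"
    unfolding convex_alt
  proof clarify
    fix y z and u :: real assume *: "y \<in> C" "z \<in> C" "f y = h y" "f z = h z" "0 \<le> u" "u \<le> 1"
    let ?w = "(1 - u) *\<^sub>R y + u *\<^sub>R z"
    have w: "?w \<in> C"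
      using f * by (auto simp: concave_on_iff convex_alt)
    have "(1 - u) * f y + u * f z \<le> f ?w"
      using concave_onD[OF f, of u y z] * by simp
    then have "f ?w = h ?w"
      using h(3)[OF w] affine_mapD_real[OF h(1), of u y z] * by simp
    then show "?w \<in> C \<and> f ?w = h ?w"
      using w by simp
  qed
  moreover have "affine_fun_on ?D f"
    using affine_map_affine_fun_on[OF h(1), of ?D] by (auto simp: affine_fun_on_def)
  moreover have "D \<subseteq> ?D"
    using DC h(2) by auto
  ultimately have "?D = D"
    using D by (auto simp: domains_of_linearity_def)
  then show ?thesis
    using x by blast
qed

text \<open>The set where an affine upper bound is attained is a face, hence spanned by vertices.\<close>

lemma affine_le_from_vertices:
  fixes L k :: "'a::euclidean_space \<Rightarrow> real"
  assumes C: "polytope C" and L: "affine_map L" and k: "affine_map k"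
    and le: "\<And>v. v extreme_point_of C \<Longrightarrow> L v \<le> k v"
    and eq: "\<And>v. v extreme_point_of C \<Longrightarrow> L v = k v \<Longrightarrow> v \<in> F"
    and F: "convex F" and x: "x \<in> C"
  shows "L x \<le> k x" "L x = k x \<Longrightarrow> x \<in> F"
proof -
  have cC: "compact C" "convex C"
    using C polytope_imp_compact polytope_imp_convex by auto
  define D where "D x = L x - k x" for x
  have D: "affine_map D"
    unfolding D_def[abs_def] by (intro affine_map_intros L k)
  have le0: "D y \<le> 0" if "y \<in> C" for y
  proof (rule affine_map_convex_le[OF D])
    show "y \<in> convex hull {v. v extreme_point_of C}"
      using Krein_Milman_Minkowski[OF cC] that by blast
    show "D v \<le> 0" if "v \<in> {v. v extreme_point_of C}" for v
      using le that by (simp add: D_def)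
  qed
  then show "L x \<le> k x"
    using x by (simp add: D_def)
  let ?E = "{y \<in> C. D y = 0}"
  have E: "?E face_of C"
    by (rule face_of_affine_eq[OF cC(2) D le0])
  then have "polytope ?E"
    using C face_of_polytope_polytope by blast
  then have "?E = convex hull {v. v extreme_point_of ?E}"
    by (intro Krein_Milman_Minkowski polytope_imp_compact polytope_imp_convex)
  also have "\<dots> \<subseteq> F"
  proof (rule hull_minimal)
    show "convex F"
      by (rule F)
    show "{v. v extreme_point_of ?E} \<subseteq> F"
    proof clarify
      fix v assume "v extreme_point_of ?E"
      then have "v extreme_point_of C" "v \<in> ?E"
        using extreme_point_of_face[OF E] by blast+
      then show "v \<in> F"
        using eq by (simp add: D_def)
    qed
  qed
  finally show "x \<in> F" if "L x = k x"
    using x that by (auto simp: D_def)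
qed

lemma eventually_less_mult:
  assumes "0 < c"
  shows "eventually (\<lambda>z::real. K < z * c) at_top"
  using eventually_gt_at_top[of "K / c"]
  by eventually_elim (use assms in \<open>simp add: pos_divide_less_eq\<close>)

subsection \<open>Symmetric lifted boundary subdivisions\<close>

context reflection
begin

text \<open>The midpoint of an interior point and its mirror image is interior and lies on H; a ball
  around it has room for both apexes.\<close>

lemma reflection_symmetric_center:
  assumes "convex P" "interior P \<noteq> {}" "\<sigma> ` P = P"
  obtains p T where "a \<bullet> p = b" "0 < T" "p + T *\<^sub>R a \<in> interior P" "p - T *\<^sub>R a \<in> interior P"
proof -
  obtain y where y: "y \<in> interior P"
    using assms(2) by blast
  then have "\<sigma> y \<in> P"
    using assms(3) interior_subset by blast
  define p where "p = y + (1/2) *\<^sub>R (\<sigma> y - y)"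
  have "p \<in> interior P"
    unfolding p_def by (rule interior_ray[OF assms(1) y \<open>\<sigma> y \<in> P\<close>]) auto
  then obtain r where r: "0 < r" "ball p r \<subseteq> interior P"
    using open_interior open_contains_ball by blast
  have "\<tau> p = 0"
    by (simp add: p_def affine_map_ray[OF affine_\<tau>] \<tau>_\<sigma>)
  define T where "T = r / (2 * norm a)"
  have T: "0 < T" "norm (T *\<^sub>R a) < r"
    using r(1) a_nonzero by (simp_all add: T_def)
  have "p + T *\<^sub>R a \<in> ball p r" "p - T *\<^sub>R a \<in> ball p r"
    using T(2) by (simp_all add: dist_norm)
  then show ?thesis
    using that[of p T] \<open>\<tau> p = 0\<close> T(1) r(2) \<tau>_zero by blast
qed

definition proj where "proj x = x + (- \<tau> x) *\<^sub>R a"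

lemma affine_proj: "affine_map proj"
  unfolding proj_def[abs_def] using affine_map_cmult[OF affine_\<tau>, of "-1"]
  by (intro affine_map_intros affine_map_scaleR_left) simp_all

lemma \<tau>_proj: "\<tau> (proj x) = 0"
  by (simp only: proj_def \<tau>_shift)

lemma proj_shift: "proj (x + s *\<^sub>R a) = proj x"
  by (simp add: proj_def \<tau>_shift algebra_simps)

lemma proj_eq: "\<tau> x = 0 \<Longrightarrow> proj x = x"
  by (simp add: proj_def)

lemma proj_midpoint: "proj x = x + (1/2) *\<^sub>R (\<sigma> x - x)"
  by (simp add: proj_def \<sigma>_eq)

lemma \<sigma>_fixed: "\<tau> x = 0 \<Longrightarrow> \<sigma> x = x"
  by (simp add: \<sigma>_eq)

lemma aff_dim_\<sigma>:
  assumes "polytope C"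
  shows "aff_dim (\<sigma> ` C) = aff_dim C"
proof -
  have "convex C"
    using assms polytope_imp_convex by blast
  then have "combinatorially_equivalent C (\<sigma> ` C)"
    by (intro combinatorially_equivalent_affine_image affine_\<sigma> inj_on_\<sigma>)
  moreover have "polytope (\<sigma> ` C)"
    using projective_map.polytope_image[OF projective_map_\<sigma>(1) assms] \<open>convex C\<close> projective_map_\<sigma>(2) by metis
  ultimately show ?thesis
    using combinatorially_equivalent_aff_dim_le[OF assms]
      combinatorially_equivalent_aff_dim_le[OF _ assms combinatorially_equivalent_sym]
    by (intro antisym) blast+
qed

lemma \<sigma>_\<sigma>_image: "\<sigma> ` \<sigma> ` C = C"
  by (simp add: image_image \<sigma>_\<sigma>)

end

locale symmetric_lifting = reflection a b for a :: "'a::euclidean_space" and b :: real +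
  fixes P :: "'a set" and S :: "'a set set" and \<psi> :: "'a \<Rightarrow> real" and p :: 'a and T :: real
  assumes polytope_P: "polytope P" and full_dim: "aff_dim P = int DIM('a)"
    and lifted: "lifted_cubical_boundary_subdivision P S \<psi>"
    and \<sigma>_P: "\<sigma> ` P = P" and \<sigma>_S_image: "(\<lambda>C. \<sigma> ` C) ` S = S"
    and \<psi>_\<sigma>: "\<And>x. x \<in> frontier P \<Longrightarrow> \<psi> (\<sigma> x) = \<psi> x"
    and sub: "subcomplex ((\<lambda>C. C \<inter> {x. a \<bullet> x = b}) ` S) S"
    and p: "a \<bullet> p = b" and T_pos: "0 < T"
    and q_int: "p + T *\<^sub>R a \<in> interior P" and q'_int: "p - T *\<^sub>R a \<in> interior P"
begin

abbreviation H where "H \<equiv> {x. a \<bullet> x = b}"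

text \<open>The dimension is measured against a facet of P, because concavity and domains of
  linearity of \<open>\<psi>\<close> are given facet by facet.\<close>

definition FF where
  "FF = {F \<in> S. (\<exists>\<Phi>. \<Phi> facet_of P \<and> F \<subseteq> \<Phi> \<and> aff_dim F = aff_dim \<Phi>) \<and> (\<forall>x\<in>F. b \<le> a \<bullet> x)}"

text \<open>The facet R of the section supplies the supporting function in
  \<open>GG_data\<close>.\<close>

definition GG where
  "GG = {G \<in> S. \<exists>R. R facet_of (P \<inter> H) \<and> G \<subseteq> R \<and> aff_dim G = aff_dim R}"

lemma convex_P: "convex P" and closed_P: "closed P" and bounded_P: "bounded P"
  and polyhedron_P: "polyhedron P"
  using polytope_P polytope_imp_convex polytope_imp_closed polytope_imp_bounded polytope_imp_polyhedron
  by auto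

lemma p_int: "p \<in> interior P"
proof -
  have "(p + T *\<^sub>R a) + (1/2) *\<^sub>R ((p - T *\<^sub>R a) - (p + T *\<^sub>R a)) \<in> interior P"
    by (rule interior_ray[OF convex_P q_int]) (use q'_int interior_subset in auto)
  moreover have "(p + T *\<^sub>R a) + (1/2) *\<^sub>R ((p - T *\<^sub>R a) - (p + T *\<^sub>R a)) = p"
    by (simp add: algebra_simps flip: scaleR_add_left)
  ultimately show ?thesis
    by (simp only:)
qed

lemma subdivision: "boundary_subdivision S P" and cubical_S: "cubical_complex S"
  and facet_concave: "\<Phi> facet_of P \<Longrightarrow> concave_on \<Phi> \<psi>"
  and facet_domains: "\<Phi> facet_of P \<Longrightarrow> domains_of_linearity \<Phi> \<psi> = complex_facets (restrict_complex S \<Phi>)"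
  using lifted unfolding lifted_cubical_boundary_subdivision_def lifted_boundary_subdivision_def by auto

lemma complex_S: "polytopal_complex S"
  using cubical_S by (simp add: cubical_complex_def)

lemma S_polytope: "C \<in> S \<Longrightarrow> polytope C"
  and S_face: "C \<in> S \<Longrightarrow> K face_of C \<Longrightarrow> K \<in> S"
  and S_Int: "C \<in> S \<Longrightarrow> D \<in> S \<Longrightarrow> C \<inter> D face_of C"
  and finite_S: "finite S"
  using complex_S unfolding polytopal_complex_def by auto

lemma S_convex: "C \<in> S \<Longrightarrow> convex C"
  using S_polytope polytope_imp_convex by blast

lemma frontier_rel: "rel_frontier P = frontier P"
  using full_dim by (simp add: rel_frontier_frontier aff_dim_eq_full)

lemma Union_S: "\<Union>S = frontier P"
proof -
  have "\<Union>S = \<Union>{F. F face_of P \<and> F \<noteq> P}"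
    using subdivision by (simp add: boundary_subdivision_def subdivision_of_def)
  then show ?thesis
    by (simp add: rel_frontier_of_polyhedron_alt[OF polyhedron_P] flip: frontier_rel)
qed

lemma S_frontier: "C \<in> S \<Longrightarrow> x \<in> C \<Longrightarrow> x \<in> frontier P"
  using Union_S by blast

lemma frontier_in_P: "x \<in> frontier P \<Longrightarrow> x \<in> P"
  by (simp add: frontier_def closed_P)

lemma S_in_facet:
  assumes "C \<in> S" "C \<noteq> {}"
  obtains \<Phi> where "\<Phi> facet_of P" "C \<subseteq> \<Phi>"
proof -
  obtain D where D: "D face_of P" "D \<noteq> P" "C \<subseteq> D"
    using subdivision assms(1) unfolding boundary_subdivision_def subdivision_of_def by blast
  then obtain \<Phi> where "\<Phi> facet_of P" "D \<subseteq> \<Phi>"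
    using face_of_polyhedron_subset_facet[OF polyhedron_P D(1) _ D(2)] assms(2) by blast
  then show ?thesis
    using that D(3) by blast
qed

lemma \<sigma>_S: "C \<in> S \<Longrightarrow> \<sigma> ` C \<in> S"
  using \<sigma>_S_image by blast

lemma \<sigma>_frontier: "x \<in> frontier P \<Longrightarrow> \<sigma> x \<in> frontier P"
  using Union_S \<sigma>_S by (metis Union_iff imageI)

section \<open>Cells of the subdivision relative to H\<close>

lemma carrier:
  assumes "x \<in> frontier P"
  obtains C where "C \<in> S" "x \<in> rel_interior C" "x \<in> C"
proof -
  obtain C where "C \<in> S" "x \<in> rel_interior C"
    using polytopal_complex_carrier[OF complex_S] assms Union_S by blast
  then show ?thesis
    using that[of C] rel_interior_subset by blast
qed

text \<open>The subcomplex hypothesis makes \<open>C \<inter> H\<close> a cell, and two cells meet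
  in a common face.\<close>

lemma H_cell:
  assumes "C \<in> S"
  shows "C \<inter> H \<in> S" "C \<inter> H face_of C"
proof -
  show CH: "C \<inter> H \<in> S"
    using sub assms by (auto simp: subcomplex_def)
  show "C \<inter> H face_of C"
    using S_Int[OF assms CH] by (simp add: Int_assoc[symmetric])
qed

text \<open>A segment of C crossing H would have an inner point in the face
  \<open>C \<inter> H\<close>, which would then contain its end points.\<close>

lemma one_sided:
  assumes C: "C \<in> S"
  shows "(\<forall>x\<in>C. b \<le> a \<bullet> x) \<or> (\<forall>x\<in>C. a \<bullet> x \<le> b)"
proof (rule ccontr)
  assume "\<not> ?thesis"
  then obtain x y where x: "x \<in> C" "a \<bullet> x < b" and y: "y \<in> C" "b < a \<bullet> y"
    by (auto simp: not_le)
  define u where "u = (b - a \<bullet> x) / (a \<bullet> y - a \<bullet> x)"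
  define z where "z = (1 - u) *\<^sub>R x + u *\<^sub>R y"
  have u: "0 < u" "u < 1"
    using x y by (auto simp: u_def)
  have "u * (a \<bullet> y - a \<bullet> x) = b - a \<bullet> x"
    using x y by (simp add: u_def)
  then have "a \<bullet> z = b"
    by (simp add: z_def inner_add_right algebra_simps)
  moreover have "z \<in> open_segment x y"
    using x y u by (auto simp: in_segment z_def)
  moreover have "z \<in> C"
    using convexD_alt[OF S_convex[OF C] x(1) y(1), of u] u by (simp add: z_def)
  ultimately have "x \<in> C \<inter> H"
    using face_ofD[OF H_cell(2)[OF C], of z x y] x(1) y(1) by blast
  then show False
    using x(2) by simp
qed

text \<open>The cell with x in its relative interior lies in every face of P through x.\<close>

lemma facet_cover:
  assumes "\<Phi> facet_of P" "x \<in> \<Phi>"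
  shows "\<exists>C\<in>S. x \<in> C \<and> C \<subseteq> \<Phi>"
proof -
  have face: "\<Phi> face_of P" "\<Phi> \<noteq> P"
    using assms(1) facet_of_imp_face_of facet_of_irrefl by blast+
  have "x \<in> frontier P"
    using face_of_subset_rel_frontier[OF face] assms(2) frontier_rel by blast
  then obtain C where C: "C \<in> S" "x \<in> rel_interior C" "x \<in> C"
    by (rule carrier)
  have "C \<subseteq> P"
    using S_frontier[OF C(1)] frontier_in_P by blast
  then have "C \<subseteq> \<Phi>"
    using subset_of_face_of[OF face(1)] C(2) assms(2) by blast
  then show ?thesis
    using C by blast
qed

lemma \<sigma>_facet:
  assumes "\<Phi> facet_of P"
  shows "\<sigma> ` \<Phi> facet_of P"
proof -
  have "\<Phi> face_of P"
    using assms facet_of_imp_face_of by blast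
  then have "\<sigma> ` \<Phi> face_of P"
    using \<sigma>_image_face_of[OF convex_P] \<sigma>_P by metis
  moreover have "aff_dim (\<sigma> ` \<Phi>) = aff_dim \<Phi>"
    using aff_dim_\<sigma> polytope_P \<open>\<Phi> face_of P\<close> face_of_polytope_polytope by blast
  ultimately show ?thesis
    using assms by (simp add: facet_of_def)
qed

text \<open>Inside a facet of P, the cell C lies in a cell of full dimension. That cell is on one
  side of H; if it is below, its mirror image belongs to FF.\<close>

lemma S_pure_nonempty:
  assumes C: "C \<in> S" "C \<noteq> {}"
  shows "\<exists>F\<in>FF. C face_of F \<or> C face_of \<sigma> ` F"
proof -
  obtain \<Phi> where \<Phi>: "\<Phi> facet_of P" "C \<subseteq> \<Phi>"
    using S_in_facet[OF C] .
  have "convex \<Phi>"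
    using \<Phi>(1) facet_of_imp_face_of face_of_imp_convex by blast
  then obtain D where D: "D \<in> S" "C \<subseteq> D" "D \<subseteq> \<Phi>" "aff_dim D = aff_dim \<Phi>"
    using polytopal_complex_pure_in[OF complex_S _ facet_cover[OF \<Phi>(1)] C(1) \<Phi>(2) C(2)] by blast
  have CD: "C face_of D"
    using S_Int[OF D(1) C(1)] D(2) by (simp add: Int_absorb1)
  show ?thesis
    using one_sided[OF D(1)]
  proof
    assume "\<forall>x\<in>D. b \<le> a \<bullet> x"
    then have "D \<in> FF"
      using D \<Phi>(1) by (auto simp: FF_def)
    then show ?thesis
      using CD by blast
  next
    assume below: "\<forall>x\<in>D. a \<bullet> x \<le> b"
    have "b \<le> a \<bullet> \<sigma> x" if "x \<in> D" for x
    proof -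
      have "a \<bullet> x \<le> b"
        using below that by blast
      then have "\<tau> x \<le> 0"
        using aa by (simp add: \<tau>_def divide_le_0_iff)
      then have "0 \<le> \<tau> (\<sigma> x)"
        by (simp add: \<tau>_\<sigma>)
      then show ?thesis
        using \<tau>_nonneg by blast
    qed
    moreover have "aff_dim (\<sigma> ` D) = aff_dim (\<sigma> ` \<Phi>)"
      using aff_dim_\<sigma>[OF S_polytope[OF D(1)]] aff_dim_\<sigma>[of \<Phi>] D(4) \<Phi>(1) polytope_P
        face_of_polytope_polytope facet_of_imp_face_of by metis
    moreover have "\<sigma> ` D \<subseteq> \<sigma> ` \<Phi>"
      using D(3) by blast
    ultimately have "\<sigma> ` D \<in> FF"
      using \<sigma>_facet[OF \<Phi>(1)] \<sigma>_S[OF D(1)] unfolding FF_def by blast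
    moreover have "C face_of \<sigma> ` \<sigma> ` D"
      using CD by (simp only: \<sigma>_\<sigma>_image)
    ultimately show ?thesis
      by blast
  qed
qed

lemma frontier_nonempty: "frontier P \<noteq> {}"
proof -
  have "P \<noteq> {}" "P \<noteq> UNIV"
    using p_int interior_subset bounded_P by auto
  then show ?thesis
    by (rule frontier_not_empty)
qed

lemma S_pure:
  assumes "C \<in> S"
  shows "\<exists>F\<in>FF. C face_of F \<or> C face_of \<sigma> ` F"
proof (cases "C = {}")
  \<comment> \<open>The empty cell is a face of every F, so only the existence of some F is at
    stake.\<close>
  case True
  obtain C' where "C' \<in> S" "C' \<noteq> {}"
    using frontier_nonempty Union_S by blast
  then obtain F where "F \<in> FF"
    using S_pure_nonempty by blast
  then show ?thesis
    using True by auto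
next
  case False
  then show ?thesis
    using S_pure_nonempty assms by blast
qed

lemma FF_S: "F \<in> FF \<Longrightarrow> F \<in> S"
  and FF_above: "F \<in> FF \<Longrightarrow> x \<in> F \<Longrightarrow> b \<le> a \<bullet> x"
  and GG_S: "G \<in> GG \<Longrightarrow> G \<in> S"
  by (auto simp: FF_def GG_def)

lemma GG_in_H: "G \<in> GG \<Longrightarrow> x \<in> G \<Longrightarrow> a \<bullet> x = b"
  by (fastforce simp: GG_def dest: facet_of_imp_subset)

text \<open>A point above H whose mirror image is also above H lies on H and is fixed.\<close>

lemma FF_\<sigma>_mem:
  assumes "F \<in> FF" "x \<in> \<sigma> ` F" "b \<le> a \<bullet> x"
  shows "x \<in> F"
proof -
  obtain y where y: "y \<in> F" "x = \<sigma> y"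
    using assms(2) by blast
  have "0 \<le> \<tau> y" "0 \<le> - \<tau> y"
    using FF_above[OF assms(1) y(1)] assms(3) y(2) \<tau>_nonneg \<tau>_\<sigma> by metis+
  then have "\<sigma> y = y"
    using \<sigma>_fixed by simp
  then show ?thesis
    using y by simp
qed

lemma FF_cover:
  assumes "x \<in> frontier P" "b \<le> a \<bullet> x"
  shows "\<exists>F\<in>FF. x \<in> F"
proof -
  obtain C where C: "C \<in> S" "x \<in> rel_interior C" "x \<in> C"
    using assms(1) by (rule carrier)
  then obtain F where F: "F \<in> FF" "C face_of F \<or> C face_of \<sigma> ` F"
    using S_pure by blast
  then have "x \<in> F \<or> x \<in> \<sigma> ` F"
    using C(3) face_of_imp_subset by blast
  then show ?thesis
    using FF_\<sigma>_mem F(1) assms(2) by blast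
qed

lemma GG_FF:
  assumes "G \<in> GG"
  shows "\<exists>F\<in>FF. G \<subseteq> F"
proof -
  obtain F where F: "F \<in> FF" "G face_of F \<or> G face_of \<sigma> ` F"
    using S_pure GG_S[OF assms] by blast
  have "G \<subseteq> F"
    using F(2)
  proof
    assume "G face_of F"
    then show ?thesis
      by (rule face_of_imp_subset)
  next
    assume "G face_of \<sigma> ` F"
    then have "G \<subseteq> \<sigma> ` F"
      by (rule face_of_imp_subset)
    then show ?thesis
      using FF_\<sigma>_mem[OF F(1)] GG_in_H[OF assms] by fastforce
  qed
  then show ?thesis
    using F(1) by blast
qed

section \<open>The section of P by H\<close>

lemma rel_interior_PH: "rel_interior (P \<inter> H) = interior P \<inter> H"
proof -
  have ri: "rel_interior P = interior P"
    using full_dim by (simp add: rel_interior_interior aff_dim_eq_full)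
  then have "rel_interior P \<inter> H \<noteq> {}"
    using p_int p by blast
  then show ?thesis
    using convex_affine_rel_interior_Int[OF convex_P affine_hyperplane, of a b] ri by simp
qed

lemma aff_dim_PH: "aff_dim (P \<inter> H) = int DIM('a) - 1"
proof -
  have "affine hull (H \<inter> interior P) = affine hull H"
    using p_int p by (intro affine_hull_convex_Int_open convex_hyperplane) auto
  then have "aff_dim (H \<inter> interior P) = aff_dim H"
    using aff_dim_affine_hull[of "H \<inter> interior P"] aff_dim_affine_hull[of H] by simp
  moreover have "H \<inter> interior P \<subseteq> P \<inter> H" "P \<inter> H \<subseteq> H"
    using interior_subset by auto
  ultimately have "aff_dim (P \<inter> H) = aff_dim H"
    using aff_dim_subset[of "H \<inter> interior P" "P \<inter> H"] aff_dim_subset[of "P \<inter> H" H] by simp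
  then show ?thesis
    using a_nonzero by (simp add: aff_dim_hyperplane)
qed

lemma polytope_PH: "polytope (P \<inter> H)"
  by (rule polytope_Int_polyhedron[OF polytope_P polyhedron_hyperplane])

text \<open>The cells of S inside H subdivide each facet R of the section, so purity within R yields
  a cell of full dimension around x.\<close>

lemma GG_cover:
  assumes x: "x \<in> frontier P" "a \<bullet> x = b"
  shows "\<exists>G\<in>GG. x \<in> G"
proof -
  have "x \<in> (P \<inter> H) - rel_interior (P \<inter> H)"
    using x frontier_in_P by (auto simp: rel_interior_PH frontier_def)
  then obtain R where R: "R facet_of (P \<inter> H)" "x \<in> R"
    using rel_boundary_of_polyhedron[OF polytope_imp_polyhedron[OF polytope_PH]] by blast
  have Rf: "R face_of (P \<inter> H)" "R \<noteq> P \<inter> H"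
    using R(1) facet_of_imp_face_of facet_of_irrefl by blast+
  have cover: "\<exists>C\<in>S. y \<in> C \<and> C \<subseteq> R" if y: "y \<in> R" for y
  proof -
    have "y \<in> P" "y \<in> H" "y \<notin> rel_interior (P \<inter> H)"
      using y face_of_imp_subset[OF Rf(1)] face_of_disjoint_rel_interior[OF Rf] by auto
    then have "y \<in> frontier P"
      using closed_P by (auto simp: rel_interior_PH frontier_def)
    then obtain C where C: "C \<in> S" "y \<in> rel_interior C" "y \<in> C"
      by (rule carrier)
    \<comment> \<open>The face \<open>C \<inter> H\<close> contains y, a relative interior point of
      C, and therefore is all of C.\<close>
    have "C \<subseteq> C \<inter> H"
      using subset_of_face_of[OF H_cell(2)[OF C(1)] subset_refl] C \<open>y \<in> H\<close> by blast
    moreover have "C \<subseteq> P"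
      using S_frontier[OF C(1)] frontier_in_P by blast
    ultimately have "C \<subseteq> R"
      using subset_of_face_of[OF Rf(1)] C y by blast
    then show ?thesis
      using C by blast
  qed
  obtain C where C: "C \<in> S" "x \<in> C" "C \<subseteq> R"
    using cover R(2) by blast
  have "convex R"
    using Rf(1) face_of_imp_convex by blast
  then obtain G where "G \<in> S" "C \<subseteq> G" "G \<subseteq> R" "aff_dim G = aff_dim R"
    using polytopal_complex_pure_in[OF complex_S _ cover C(1,3)] C(2) by blast
  then show ?thesis
    using R(1) C(2) by (auto simp: GG_def)
qed

lemma cube_S:
  assumes "C \<in> S" "aff_dim C = int k"
  shows "combinatorial_cube k C"
proof -
  have "C \<noteq> {}"
    using assms(2) by auto
  then obtain j where "combinatorial_cube j C"
    using cubical_S assms(1) unfolding cubical_complex_def by blast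
  then show ?thesis
    using combinatorial_cube_aff_dim assms(2) by fastforce
qed

lemma aff_dim_FF:
  assumes "F \<in> FF"
  shows "aff_dim F = int (DIM('a) - 1)"
proof -
  obtain \<Phi> where "\<Phi> facet_of P" "aff_dim F = aff_dim \<Phi>"
    using assms by (auto simp: FF_def)
  then show ?thesis
    using full_dim DIM_positive[where 'a = 'a] by (simp add: facet_of_def of_nat_diff)
qed

lemma aff_dim_GG:
  assumes "G \<in> GG"
  shows "2 \<le> DIM('a)" "aff_dim G = int (DIM('a) - 2)"
proof -
  obtain R where R: "R facet_of (P \<inter> H)" "aff_dim G = aff_dim R"
    using assms by (auto simp: GG_def)
  have 1: "aff_dim R = int DIM('a) - 2" "R \<noteq> {}"
    using R(1) aff_dim_PH by (auto simp: facet_of_def)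
  then have "0 \<le> aff_dim R"
    using aff_dim_geq[of R] aff_dim_empty[of R] by linarith
  then show "2 \<le> DIM('a)" "aff_dim G = int (DIM('a) - 2)"
    using 1 R(2) by auto
qed

section \<open>Supporting functions and affine pieces of the lifting\<close>

definition q where "q = p + T *\<^sub>R a"

text \<open>Having the dimension of its facet, F is a maximal cell there and thus a domain of
  linearity. The affine extension of \<open>\<psi>\<close> from F then majorizes
  \<open>\<psi>\<close> on the facet and touches it only along F.\<close>

lemma FF_data:
  assumes F: "F \<in> FF"
  shows "\<exists>\<gamma> h. affine_map \<gamma> \<and> \<gamma> q = (0::real) \<and> (\<forall>x\<in>P. \<gamma> x \<le> 1) \<and> (\<forall>x\<in>interior P. \<gamma> x < 1) \<and>
    affine_map h \<and> (\<forall>x\<in>F. \<gamma> x = 1 \<and> \<psi> x = h x) \<and>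
    (\<forall>x\<in>P. \<gamma> x = 1 \<longrightarrow> \<psi> x \<le> h x \<and> (\<psi> x = h x \<longrightarrow> x \<in> F))"
proof -
  have FS: "F \<in> S"
    by (rule FF_S[OF F])
  obtain \<Phi> where \<Phi>: "\<Phi> facet_of P" "F \<subseteq> \<Phi>" "aff_dim F = aff_dim \<Phi>"
    using F by (auto simp: FF_def)
  obtain c k where ck: "c \<noteq> 0" "P \<subseteq> {x. c \<bullet> x \<le> k}" "\<Phi> = P \<inter> {x. c \<bullet> x = k}"
    using facet_of_polyhedron[OF polyhedron_P \<Phi>(1)] .
  define \<gamma> where "\<gamma> x = (c \<bullet> x - c \<bullet> q) / (k - c \<bullet> q)" for x
  note \<gamma> = normalized_support[OF ck(2,1) q_int[folded q_def], folded \<gamma>_def]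
  have "D = F" if D: "D \<in> S" "D \<subseteq> \<Phi>" "F \<subseteq> D" for D
  proof (rule ccontr)
    assume "D \<noteq> F"
    have "F face_of D"
      using S_Int[OF D(1) FS] D(3) by (simp add: Int_absorb1)
    then have "aff_dim F < aff_dim D"
      using face_of_aff_dim_lt[OF S_convex[OF D(1)]] \<open>D \<noteq> F\<close> by blast
    then show False
      using aff_dim_subset[OF D(2)] \<Phi>(3) by simp
  qed
  then have dom: "F \<in> domains_of_linearity \<Phi> \<psi>"
    using FS \<Phi>(2) by (auto simp: facet_domains[OF \<Phi>(1)] complex_facets_def restrict_complex_def)
  then have "affine_fun_on F \<psi>"
    by (simp add: domains_of_linearity_def)
  then obtain h where h: "affine_map h" "\<And>x. x \<in> F \<Longrightarrow> \<psi> x = h x"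
    using affine_fun_on_affine_map by blast
  note conc = facet_concave[OF \<Phi>(1)]
  have "F \<noteq> {}"
    using aff_dim_FF[OF F] by auto
  then have le: "\<psi> x \<le> h x" if "x \<in> \<Phi>" for x
    using concave_le_affine[OF conc \<Phi>(2) S_convex[OF FS] _ \<Phi>(3) h that] by blast
  have eq: "x \<in> F" if "x \<in> \<Phi>" "\<psi> x = h x" for x
    by (rule domain_of_linearity_eq[OF conc dom h le that])
  have "x \<in> \<Phi> \<longleftrightarrow> x \<in> P \<and> \<gamma> x = 1" for x
    using ck(3) \<gamma>(5) by blast
  then have "affine_map \<gamma> \<and> \<gamma> q = (0::real) \<and> (\<forall>x\<in>P. \<gamma> x \<le> 1) \<and> (\<forall>x\<in>interior P. \<gamma> x < 1) \<and>
    affine_map h \<and> (\<forall>x\<in>F. \<gamma> x = 1 \<and> \<psi> x = h x) \<and>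
    (\<forall>x\<in>P. \<gamma> x = 1 \<longrightarrow> \<psi> x \<le> h x \<and> (\<psi> x = h x \<longrightarrow> x \<in> F))"
    using \<gamma>(1-4) h \<Phi>(2) le eq by blast
  then show ?thesis
    by blast
qed

lemma proj_PH: assumes "x \<in> P" shows "proj x \<in> P \<inter> H"
proof -
  have "\<sigma> x \<in> P"
    using assms \<sigma>_P by blast
  then have "(1 - 1/2) *\<^sub>R x + (1/2) *\<^sub>R \<sigma> x \<in> P"
    by (intro convexD_alt[OF convex_P assms]) auto
  moreover have "proj x = (1 - 1/2) *\<^sub>R x + (1/2) *\<^sub>R \<sigma> x"
    unfolding proj_midpoint by (simp only: scaleR_diff_left scaleR_diff_right scaleR_one) simp
  ultimately have "proj x \<in> P"
    by (simp only:)
  then show ?thesis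
    using \<tau>_proj \<tau>_zero by blast
qed

text \<open>\<open>\<mu>\<close> is a supporting function of the section along R, composed with the
  projection to H. The composition is constant in direction \<open>a\<close>, and its bound extends
  to all of P because P projects into the section.\<close>

lemma GG_data:
  assumes G: "G \<in> GG"
  shows "\<exists>\<mu>. affine_map \<mu> \<and> (\<forall>x s. \<mu> (x + s *\<^sub>R a) = \<mu> x) \<and> \<mu> p = (0::real) \<and> (\<forall>x\<in>P. \<mu> x \<le> 1) \<and>
    (\<forall>x\<in>G. \<mu> x = 1) \<and> (\<forall>x\<in>P. \<mu> x = 1 \<longrightarrow> proj x \<in> affine hull G)"
proof -
  obtain R where R: "R facet_of (P \<inter> H)" "G \<subseteq> R" "aff_dim G = aff_dim R"
    using G by (auto simp: GG_def)
  obtain c k where ck: "c \<noteq> 0" "P \<inter> H \<subseteq> {x. c \<bullet> x \<le> k}" "R = (P \<inter> H) \<inter> {x. c \<bullet> x = k}"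
    using facet_of_polyhedron[OF polytope_imp_polyhedron[OF polytope_PH] R(1)] .
  have Rf: "R face_of (P \<inter> H)" "R \<noteq> P \<inter> H"
    using R(1) facet_of_imp_face_of facet_of_irrefl by blast+
  have "p \<in> rel_interior (P \<inter> H)"
    using p_int p by (simp add: rel_interior_PH)
  then have "p \<notin> R" "p \<in> P \<inter> H"
    using face_of_disjoint_rel_interior[OF Rf] rel_interior_subset by blast+
  then have pos: "0 < k - c \<bullet> p"
    using ck(2,3) by (auto simp: less_le)
  define \<mu> where "\<mu> x = (c \<bullet> proj x - c \<bullet> p) / (k - c \<bullet> p)" for x
  have "affine_map \<mu>"
    unfolding \<mu>_def[abs_def] by (intro affine_map_intros affine_proj)
  moreover have "\<mu> (x + s *\<^sub>R a) = \<mu> x" for x s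
    by (simp add: \<mu>_def proj_shift)
  moreover have "\<mu> p = 0"
    using p \<tau>_zero by (simp add: \<mu>_def proj_eq)
  moreover have "\<mu> x \<le> 1" if "x \<in> P" for x
    using proj_PH[OF that] ck(2) pos by (auto simp: \<mu>_def)
  moreover have "\<mu> x = 1" if "x \<in> G" for x
  proof -
    have "x \<in> H" "c \<bullet> x = k"
      using that R(2) ck(3) by auto
    then show ?thesis
      using pos \<tau>_zero by (simp add: \<mu>_def proj_eq)
  qed
  moreover have "proj x \<in> affine hull G" if "x \<in> P" "\<mu> x = 1" for x
  proof -
    have "c \<bullet> proj x = k"
      using that(2) pos by (simp add: \<mu>_def)
    then have "proj x \<in> R"
      using ck(3) proj_PH[OF that(1)] by blast
    moreover have "affine hull G = affine hull R"
      using aff_dim_eq_full_gen[OF R(2)] R(3) by blast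
    ultimately show ?thesis
      by (simp add: hull_inc)
  qed
  ultimately show ?thesis
    by blast
qed

lemma \<psi>_affine_on_cells:
  assumes "C \<in> S"
  obtains k where "affine_map k" "\<And>x. x \<in> C \<Longrightarrow> \<psi> x = k x"
proof -
  obtain F where F: "F \<in> FF" "C face_of F \<or> C face_of \<sigma> ` F"
    using S_pure[OF assms] by blast
  obtain h where h: "affine_map h" "\<forall>x\<in>F. \<psi> x = h x"
    using FF_data[OF F(1)] by blast
  show ?thesis
    using F(2)
  proof
    assume "C face_of F"
    then show ?thesis
      using that[OF h(1)] h(2) face_of_imp_subset by blast
  next
    assume "C face_of \<sigma> ` F"
    then have CF: "C \<subseteq> \<sigma> ` F"
      by (rule face_of_imp_subset)
    have "\<psi> x = h (\<sigma> x)" if x: "x \<in> C" for x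
    proof -
      obtain y where y: "y \<in> F" "x = \<sigma> y"
        using CF x by blast
      then show ?thesis
        using \<psi>_\<sigma>[OF S_frontier[OF FF_S[OF F(1)] y(1)]] h(2) by (simp add: \<sigma>_\<sigma>)
    qed
    then show ?thesis
      using that[of "\<lambda>x. h (\<sigma> x)"] affine_map_compose[OF h(1) affine_\<sigma>] by blast
  qed
qed

definition V where "V = {v. {v} \<in> S}"

lemma finite_V: "finite V"
  using finite_vimageI[OF finite_S, of "\<lambda>v. {v}"] by (simp add: V_def vimage_def)

lemma V_frontier: "v \<in> V \<Longrightarrow> v \<in> frontier P"
  using S_frontier[of "{v}" v] by (simp add: V_def)

lemma V_\<sigma>: "v \<in> V \<Longrightarrow> \<sigma> v \<in> V"
  using \<sigma>_S[of "{v}"] by (simp add: V_def)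

text \<open>\<open>\<psi>\<close> is affine on every cell, so both the inequality and its contact
  set are controlled by the vertices of S. As these are finite in number, a single z can serve all
  comparisons.\<close>

lemma affine_le_from_V:
  assumes L: "affine_map L"
    and V: "\<And>v. v \<in> V \<Longrightarrow> L v \<le> z - \<psi> v" "\<And>v. v \<in> V \<Longrightarrow> L v = z - \<psi> v \<Longrightarrow> v \<in> F"
    and F: "convex F" and x: "x \<in> frontier P"
  shows "L x \<le> z - \<psi> x" "L x = z - \<psi> x \<Longrightarrow> x \<in> F"
proof -
  obtain C where C: "C \<in> S" "x \<in> rel_interior C" "x \<in> C"
    using carrier[OF x] .
  obtain k where k: "affine_map k" "\<And>x. x \<in> C \<Longrightarrow> \<psi> x = k x"
    by (rule \<psi>_affine_on_cells[OF C(1)]) blast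
  have k': "affine_map (\<lambda>x. z - k x)"
    by (intro affine_map_intros k(1))
  have ext: "v \<in> V" "v \<in> C" if "v extreme_point_of C" for v
  proof -
    have "{v} face_of C"
      using that by (simp add: face_of_singleton)
    then show "v \<in> V" "v \<in> C"
      using S_face[OF C(1)] face_of_imp_subset by (auto simp: V_def)
  qed
  have *: "L v \<le> z - k v" "L v = z - k v \<Longrightarrow> v \<in> F" if "v extreme_point_of C" for v
    using V[OF ext(1)[OF that]] k(2)[OF ext(2)[OF that]] by auto
  have "L x \<le> z - k x"
    by (rule affine_le_from_vertices(1)[OF S_polytope[OF C(1)] L k' * F C(3)])
  then show "L x \<le> z - \<psi> x"
    by (simp add: k(2)[OF C(3)])
  show "x \<in> F" if "L x = z - \<psi> x"
  proof (rule affine_le_from_vertices(2)[OF S_polytope[OF C(1)] L k' * F C(3)])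
    show "L x = z - k x"
      using that by (simp add: k(2)[OF C(3)])
  qed
qed

text \<open>Otherwise F would span H, and a supporting function of F would take the value 1 at the
  interior point \<open>p\<close>.\<close>

lemma FF_strictly_above:
  assumes F: "F \<in> FF"
  shows "\<exists>x\<in>F. b < a \<bullet> x"
proof (rule ccontr)
  assume "\<not> ?thesis"
  then have "F \<subseteq> H"
    using FF_above[OF F] by force
  then have "affine hull F \<subseteq> H"
    by (simp add: affine_hyperplane hull_minimal)
  moreover have "aff_dim (affine hull F) = aff_dim H"
    using aff_dim_FF[OF F] a_nonzero by (simp add: aff_dim_hyperplane of_nat_diff)
  moreover have "affine hull F \<noteq> {}"
    using aff_dim_FF[OF F] by auto
  ultimately have "affine hull F = H"
    using affine_dim_equal[OF affine_affine_hull affine_hyperplane] by blast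
  then have pF: "p \<in> affine hull F"
    using p by simp
  obtain \<gamma> where \<gamma>: "affine_map \<gamma>" "\<forall>x\<in>interior P. \<gamma> x < (1::real)" "\<forall>x\<in>F. \<gamma> x = 1"
    using FF_data[OF F] by blast
  have "\<gamma> p = 1"
    using affine_map_eq_on_affine_hull[OF \<gamma>(1) affine_map_const[of 1] _ pF] \<gamma>(3) by blast
  then show False
    using \<gamma>(2) p_int by auto
qed

text \<open>All inequalities between \<open>g\<close>, \<open>m\<close> and \<open>z - \<psi>\<close> are checked at the vertices of \<open>S\<close>: where \<open>\<gamma> < 1\<close>
  or \<open>\<mu> < 1\<close> they hold for large \<open>z\<close>; where \<open>\<gamma> = 1\<close> they express the concavity of \<open>\<psi>\<close> on a facet,
  and where \<open>\<mu> = 1\<close> they follow by averaging the inequality for \<open>g\<close> over \<open>v\<close> and \<open>\<sigma> v\<close>.\<close>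

theorem ex_lifted_cubification: "\<exists>B \<phi>. lifted_cubification P S \<psi> B \<phi>"
proof -
  have "\<forall>F\<in>FF. \<exists>\<gamma> h. affine_map \<gamma> \<and> \<gamma> q = (0::real) \<and> (\<forall>x\<in>P. \<gamma> x \<le> 1) \<and> (\<forall>x\<in>interior P. \<gamma> x < 1) \<and>
    affine_map h \<and> (\<forall>x\<in>F. \<gamma> x = 1 \<and> \<psi> x = h x) \<and>
    (\<forall>x\<in>P. \<gamma> x = 1 \<longrightarrow> \<psi> x \<le> h x \<and> (\<psi> x = h x \<longrightarrow> x \<in> F))"
    using FF_data by blast
  then obtain \<gamma> h where FFd: "\<forall>F\<in>FF. affine_map (\<gamma> F) \<and> \<gamma> F q = (0::real) \<and> (\<forall>x\<in>P. \<gamma> F x \<le> 1) \<and>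
    (\<forall>x\<in>interior P. \<gamma> F x < 1) \<and> affine_map (h F) \<and> (\<forall>x\<in>F. \<gamma> F x = 1 \<and> \<psi> x = h F x) \<and>
    (\<forall>x\<in>P. \<gamma> F x = 1 \<longrightarrow> \<psi> x \<le> h F x \<and> (\<psi> x = h F x \<longrightarrow> x \<in> F))"
    unfolding bchoice_iff by blast
  have affine_\<gamma>: "affine_map (\<gamma> F)" and \<gamma>_q: "\<gamma> F q = 0" and affine_h: "affine_map (h F)" if "F \<in> FF" for F
    using FFd that by auto
  have \<gamma>_le: "\<gamma> F x \<le> 1" if "F \<in> FF" "x \<in> P" for F x
    using FFd that by blast
  have \<gamma>_int: "\<gamma> F x < 1" if "F \<in> FF" "x \<in> interior P" for F x
    using FFd that by blast
  have \<gamma>_F: "\<gamma> F x = 1" and h_F: "\<psi> x = h F x" if "F \<in> FF" "x \<in> F" for F x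
    using FFd that by blast+
  have h_le: "\<psi> x \<le> h F x" "\<psi> x = h F x \<Longrightarrow> x \<in> F" if "F \<in> FF" "x \<in> P" "\<gamma> F x = 1" for F x
    using FFd that by blast+
  have "\<forall>G\<in>GG. \<exists>\<mu>. affine_map \<mu> \<and> (\<forall>x s. \<mu> (x + s *\<^sub>R a) = \<mu> x) \<and> \<mu> p = (0::real) \<and> (\<forall>x\<in>P. \<mu> x \<le> 1) \<and>
    (\<forall>x\<in>G. \<mu> x = 1) \<and> (\<forall>x\<in>P. \<mu> x = 1 \<longrightarrow> proj x \<in> affine hull G)"
    using GG_data by blast
  then obtain \<mu> where GGd: "\<forall>G\<in>GG. affine_map (\<mu> G) \<and> (\<forall>x s. \<mu> G (x + s *\<^sub>R a) = \<mu> G x) \<and>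
    \<mu> G p = (0::real) \<and> (\<forall>x\<in>P. \<mu> G x \<le> 1) \<and>
    (\<forall>x\<in>G. \<mu> G x = 1) \<and> (\<forall>x\<in>P. \<mu> G x = 1 \<longrightarrow> proj x \<in> affine hull G)"
    unfolding bchoice_iff by blast
  have affine_\<mu>: "affine_map (\<mu> G)" and \<mu>_p: "\<mu> G p = 0" if "G \<in> GG" for G
    using GGd that by auto
  have \<mu>_shift: "\<mu> G (x + s *\<^sub>R a) = \<mu> G x" if "G \<in> GG" for G x s
    using GGd that by blast
  have \<mu>_le: "\<mu> G x \<le> 1" if "G \<in> GG" "x \<in> P" for G x
    using GGd that by blast
  have \<mu>_G: "\<mu> G x = 1" if "G \<in> GG" "x \<in> G" for G x
    using GGd that by blast
  have \<mu>_hull: "proj x \<in> affine hull G" if "G \<in> GG" "x \<in> P" "\<mu> G x = 1" for G x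
    using GGd that by blast
  have "\<forall>G\<in>GG. \<exists>F. F \<in> FF \<and> G \<subseteq> F"
    using GG_FF by blast
  then obtain N where N: "\<forall>G\<in>GG. N G \<in> FF \<and> G \<subseteq> N G"
    unfolding bchoice_iff by blast
  have N_FF: "N G \<in> FF" and G_N: "G \<subseteq> N G" if "G \<in> GG" for G
    using N that by auto
  \<comment> \<open>On F, where \<open>\<gamma> F = 1\<close>, this is \<open>z - h F\<close>; the
    last term makes it vanish at \<open>q\<close>, where \<open>\<gamma> F = 0\<close>.\<close>
  define g where "g z F x = z * \<gamma> F x - h F x + h F q * (1 - \<gamma> F x)" for z F x
  \<comment> \<open>The same pattern with \<open>p\<close> in place of \<open>q\<close>;
    \<open>proj\<close> removes the dependence on the height.\<close>
  define m where "m z G x = z * \<mu> G x - h (N G) (proj x) + h (N G) p * (1 - \<mu> G x)" for z G x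
  have fin: "finite FF" "finite GG"
    using finite_S by (auto simp: FF_def GG_def)
  have "eventually (\<lambda>z. \<forall>v\<in>V. 1 < z - \<psi> v) at_top"
  proof (intro eventually_ball_finite finite_V ballI)
    fix v
    show "eventually (\<lambda>z. 1 < z - \<psi> v) at_top"
      using eventually_gt_at_top[of "1 + \<psi> v"] by eventually_elim simp
  qed
  moreover have "eventually (\<lambda>z. \<forall>F\<in>FF. \<forall>v\<in>V. \<gamma> F v < 1 \<longrightarrow> g z F v < z - \<psi> v) at_top"
  proof (intro eventually_ball_finite finite_V fin ballI)
    fix F v
    show "eventually (\<lambda>z. \<gamma> F v < 1 \<longrightarrow> g z F v < z - \<psi> v) at_top"
    proof (cases "\<gamma> F v < 1")
      case True
      then have "eventually (\<lambda>z. \<psi> v - h F v + h F q * (1 - \<gamma> F v) < z * (1 - \<gamma> F v)) at_top"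
        by (intro eventually_less_mult) simp
      then show ?thesis
        by eventually_elim (simp add: g_def algebra_simps)
    qed simp
  qed
  moreover have "eventually (\<lambda>z. \<forall>G\<in>GG. \<forall>v\<in>V. \<mu> G v < 1 \<longrightarrow> m z G v < z - \<psi> v) at_top"
  proof (intro eventually_ball_finite finite_V fin ballI)
    fix G v
    show "eventually (\<lambda>z. \<mu> G v < 1 \<longrightarrow> m z G v < z - \<psi> v) at_top"
    proof (cases "\<mu> G v < 1")
      case True
      then have "eventually (\<lambda>z. \<psi> v - h (N G) (proj v) + h (N G) p * (1 - \<mu> G v) < z * (1 - \<mu> G v)) at_top"
        by (intro eventually_less_mult) simp
      then show ?thesis
        by eventually_elim (simp add: m_def algebra_simps)
    qed simp
  qed
  ultimately have "eventually (\<lambda>z. (\<forall>v\<in>V. 1 < z - \<psi> v) \<and>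
      (\<forall>F\<in>FF. \<forall>v\<in>V. \<gamma> F v < 1 \<longrightarrow> g z F v < z - \<psi> v) \<and>
      (\<forall>G\<in>GG. \<forall>v\<in>V. \<mu> G v < 1 \<longrightarrow> m z G v < z - \<psi> v)) at_top"
    by (intro eventually_conj)
  then obtain z :: real where z: "(\<forall>v\<in>V. 1 < z - \<psi> v) \<and>
      (\<forall>F\<in>FF. \<forall>v\<in>V. \<gamma> F v < 1 \<longrightarrow> g z F v < z - \<psi> v) \<and>
      (\<forall>G\<in>GG. \<forall>v\<in>V. \<mu> G v < 1 \<longrightarrow> m z G v < z - \<psi> v)"
    using eventually_happens'[OF trivial_limit_at_top_linorder] by blast
  have z1: "1 < z - \<psi> v" if "v \<in> V" for v
    using z that by blast
  have zg: "g z F v < z - \<psi> v" if "F \<in> FF" "v \<in> V" "\<gamma> F v < 1" for F v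
    using z that by blast
  have zm: "m z G v < z - \<psi> v" if "G \<in> GG" "v \<in> V" "\<mu> G v < 1" for G v
    using z that by blast
  have affine_g: "affine_map (g z F)" if "F \<in> FF" for F
    unfolding g_def[abs_def] using that by (intro affine_map_intros affine_\<gamma> affine_h)
  have affine_m: "affine_map (m z G)" if "G \<in> GG" for G
    unfolding m_def[abs_def] using that N_FF
    by (intro affine_map_intros affine_\<mu> affine_map_compose[OF affine_h affine_proj])
  have VP: "v \<in> P" if "v \<in> V" for v
    using V_frontier[OF that] frontier_in_P by blast
  have gV: "g z F v \<le> z - \<psi> v" "g z F v = z - \<psi> v \<Longrightarrow> v \<in> F" if F: "F \<in> FF" and v: "v \<in> V" for F v
  proof -
    have "g z F v \<le> z - \<psi> v \<and> (g z F v = z - \<psi> v \<longrightarrow> v \<in> F)"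
    proof (cases "\<gamma> F v < 1")
      case True
      then show ?thesis
        using zg[OF F v] by auto
    next
      case False
      then have "\<gamma> F v = 1"
        using \<gamma>_le[OF F VP[OF v]] by simp
      then show ?thesis
        using h_le[OF F VP[OF v]] by (simp add: g_def)
    qed
    then show "g z F v \<le> z - \<psi> v" "g z F v = z - \<psi> v \<Longrightarrow> v \<in> F"
      by auto
  qed
  have mV: "m z G v \<le> z - \<psi> v" "m z G v = z - \<psi> v \<Longrightarrow> v \<in> G" if G: "G \<in> GG" and v: "v \<in> V" for G v
  proof -
    let ?F = "N G"
    note F = N_FF[OF G]
    have "m z G v \<le> z - \<psi> v \<and> (m z G v = z - \<psi> v \<longrightarrow> v \<in> G)"
    proof (cases "\<mu> G v < 1")
      case True
      then show ?thesis
        using zm[OF G v] by auto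
    next
      case False
      then have \<mu>1: "\<mu> G v = 1"
        using \<mu>_le[OF G VP[OF v]] by simp
      then have hull: "proj v \<in> affine hull G"
        by (rule \<mu>_hull[OF G VP[OF v]])
      \<comment> \<open>With \<open>\<mu> G v = 1\<close> and
        \<open>\<gamma> ?F (proj v) = 1\<close> the correction terms at \<open>p\<close> and
        \<open>q\<close> drop out, so \<open>m\<close> at v agrees with \<open>g\<close> at the
        projection.\<close>
      have "\<gamma> ?F (proj v) = 1"
        using affine_map_eq_on_affine_hull[OF affine_\<gamma>[OF F] affine_map_const[of 1] _ hull]
          \<gamma>_F[OF F] G_N[OF G] by blast
      then have "m z G v = g z ?F (proj v)"
        by (simp add: m_def g_def \<mu>1)
      also have "\<dots> = (g z ?F v + g z ?F (\<sigma> v)) / 2"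
        by (simp add: proj_midpoint affine_map_ray[OF affine_g[OF F]])
      finally have mg: "2 * m z G v = g z ?F v + g z ?F (\<sigma> v)"
        by simp
      have le: "g z ?F v \<le> z - \<psi> v" "g z ?F (\<sigma> v) \<le> z - \<psi> v"
        using gV(1)[OF F v] gV(1)[OF F V_\<sigma>[OF v]] \<psi>_\<sigma>[OF V_frontier[OF v]] by auto
      have "v \<in> G" if "m z G v = z - \<psi> v"
      proof -
        \<comment> \<open>A mean attains a common bound only if both values do. Then v and its
          mirror image both belong to \<open>N G\<close>, hence lie above H, which forces v onto
          H.\<close>
        have "g z ?F v = z - \<psi> v" "g z ?F (\<sigma> v) = z - \<psi> (\<sigma> v)"
          using mg le that \<psi>_\<sigma>[OF V_frontier[OF v]] by auto
        then have vF: "v \<in> ?F" "\<sigma> v \<in> ?F"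
          using gV(2)[OF F] v V_\<sigma> by blast+
        then have "0 \<le> \<tau> v" "0 \<le> - \<tau> v"
          using FF_above[OF F] \<tau>_nonneg \<tau>_\<sigma> by metis+
        then have "proj v = v"
          by (simp add: proj_eq)
        then have "v \<in> affine hull G \<inter> ?F"
          using hull vF(1) by simp
        moreover have "G face_of ?F"
          using S_Int[OF FF_S[OF F] GG_S[OF G]] G_N[OF G] by (simp add: Int_absorb1)
        ultimately show ?thesis
          using face_of_imp_eq_affine_Int[OF S_convex[OF FF_S[OF F]]] by blast
      qed
      then show ?thesis
        using mg le by auto
    qed
    then show "m z G v \<le> z - \<psi> v" "m z G v = z - \<psi> v \<Longrightarrow> v \<in> G"
      by auto
  qed
  interpret hx: hexhoop a b P S \<psi> p T z FF GG "g z" "m z"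
  proof
    show "combinatorial_cube (DIM('a) - 1) F" if "F \<in> FF" for F
      by (rule cube_S[OF FF_S[OF that] aff_dim_FF[OF that]])
    show "2 \<le> DIM('a) \<and> combinatorial_cube (DIM('a) - 2) G" if "G \<in> GG" for G
      using cube_S[OF GG_S[OF that]] aff_dim_GG[OF that] by blast
    show "\<exists>\<gamma>. affine_map \<gamma> \<and> (\<forall>x\<in>F. \<gamma> x = 1) \<and> (\<forall>x\<in>P. \<gamma> x \<le> (1::real)) \<and> (\<forall>x\<in>interior P. \<gamma> x < 1)"
      if "F \<in> FF" for F
      using affine_\<gamma>[OF that] \<gamma>_F[OF that] \<gamma>_le[OF that] \<gamma>_int[OF that] by blast
    show "g z F (p + T *\<^sub>R a) = 0" if "F \<in> FF" for F
      using \<gamma>_q[OF that] by (simp add: g_def flip: q_def)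
    show "g z F x = z - \<psi> x" if "F \<in> FF" "x \<in> F" for F x
      using \<gamma>_F[OF that] h_F[OF that] by (simp add: g_def)
    show "g z F x \<le> z - \<psi> x" if "F \<in> FF" "x \<in> frontier P" for F x
      using affine_le_from_V(1)[OF affine_g gV S_convex[OF FF_S]] that by blast
    show "x \<in> F" if "F \<in> FF" "x \<in> frontier P" "g z F x = z - \<psi> x" for F x
      using affine_le_from_V(2)[OF affine_g gV S_convex[OF FF_S]] that by blast
    show "m z G p = 0" if "G \<in> GG" for G
      using \<mu>_p[OF that] p \<tau>_zero by (simp add: m_def proj_eq)
    show "m z G (x + s *\<^sub>R a) = m z G x" if "G \<in> GG" for G x s
      using \<mu>_shift[OF that] by (simp add: m_def proj_shift)
    show "m z G x = z - \<psi> x" if "G \<in> GG" "x \<in> G" for G x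
    proof -
      have "\<psi> x = h (N G) x"
        using h_F[OF N_FF[OF that(1)]] G_N[OF that(1)] that(2) by blast
      then show ?thesis
        using \<mu>_G[OF that] GG_in_H[OF that] \<tau>_zero by (simp add: m_def proj_eq)
    qed
    show "m z G x \<le> z - \<psi> x" if "G \<in> GG" "x \<in> frontier P" for G x
      using affine_le_from_V(1)[OF affine_m mV S_convex[OF GG_S]] that by blast
    show "x \<in> G" if "G \<in> GG" "x \<in> frontier P" "m z G x = z - \<psi> x" for G x
      using affine_le_from_V(2)[OF affine_m mV S_convex[OF GG_S]] that by blast
    \<comment> \<open>With the empty set as contact set the case of equality is excluded, which
      makes the inequality strict.\<close>
    show "1 < z - \<psi> x" if "x \<in> frontier P" for x
      using affine_le_from_V[of "\<lambda>x. 1" z "{}", OF affine_map_const _ _ convex_empty that] z1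
      by fastforce
  qed (use polytope_P p T_pos q_int q'_int \<sigma>_P \<sigma>_S \<psi>_\<sigma> complex_S Union_S FF_S GG_S FF_above
      FF_strictly_above GG_in_H GG_FF FF_cover GG_cover S_pure affine_g affine_m in auto)
  show ?thesis
    using hx.lifted_cubification_hexhoop by blast
qed

end

theorem theorem6p2:
  fixes P H :: "'a::euclidean_space set"
    and S :: "'a set set"
    and \<psi> :: "'a \<Rightarrow> real"
    and a :: 'a and b :: real
  assumes "polytope P" and "aff_dim P = int DIM('a)"
    and "lifted_cubical_boundary_subdivision P S \<psi>"
    and "a \<noteq> 0" and "H = {x. a \<bullet> x = b}"
    and "hyperplane_reflection a b ` P = P"
    and "(\<lambda>C. hyperplane_reflection a b ` C) ` S = S"
    and "\<forall>x \<in> frontier P. \<psi> (hyperplane_reflection a b x) = \<psi> x"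
    and "subcomplex ((\<lambda>C. C \<inter> H) ` S) S"
  shows "\<exists>B \<phi>. lifted_cubification P S \<psi> B \<phi>"
proof -
  interpret reflection a b
    by unfold_locales fact
  have "convex P"
    using assms(1) polytope_imp_convex by blast
  moreover have "P \<noteq> {}"
    using assms(2) by auto
  ultimately have "rel_interior P \<noteq> {}"
    using rel_interior_eq_empty by blast
  moreover have "rel_interior P = interior P"
    using assms(2) by (simp add: rel_interior_interior aff_dim_eq_full)
  ultimately have "interior P \<noteq> {}"
    by simp
  with \<open>convex P\<close> obtain p T where pT: "a \<bullet> p = b" "0 < T" "p + T *\<^sub>R a \<in> interior P" "p - T *\<^sub>R a \<in> interior P"
    using reflection_symmetric_center assms(6) by blast
  interpret symmetric_lifting a b P S \<psi> p T
    using assms pT by unfold_locales auto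
  show ?thesis
    by (rule ex_lifted_cubification)
qed

end
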